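(* Let $\mathcal{C}$ be a permutation class which contains only finitely many sum-indecomposable permutations and whose growth function $n\mapsto c_n$ is unbounded. Then $\mathcal{C}$ exhibits a Wilf collapse.
   Context: A permutation class is a set of permutations closed downward under pattern containment. A permutation is sum-indecomposable if it cannot be written as $\alpha\oplus\beta$ with $\alpha,\beta$ nonempty, where $\alpha\oplus\beta$ is the concatenation of $\alpha$ with $\beta$ shifted up by $|\alpha|$. $c_n$ denotes the number of permutations of size $n$ in $\mathcal{C}$. Two permutations $\alpha,\beta\in\mathcal{C}$ are Wilf-equivalent in $\mathcal{C}$ if for every $m$ the number of permutations of size $m$ in $\mathcal{C}$ avoiding $\alpha$ equals the number avoiding $\beta$. Letting $w_n$ be the number of Wilf-equivalence classes formed by the permutations of size $n$ in $\mathcal{C}$, $\mathcal{C}$ exhibits a Wilf collapse if $w_n=o(c_n)$. *)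

theory Defs
  imports
    Complex_Main
    "HOL-Library.Sublist"
    "HOL-Library.Landau_Symbols"
    "HOL-Combinatorics.Multiset_Permutations"
begin

text \<open>
  A permutation of size \<open>n\<close> is its one-line notation, a list that arranges \<open>{1..n}\<close>.
  The empty list is the permutation of size 0.
\<close>

definition is_perm :: "nat list \<Rightarrow> bool" where
  "is_perm p \<longleftrightarrow> p \<in> permutations_of_set {1..length p}"

definition order_isomorphic :: "nat list \<Rightarrow> nat list \<Rightarrow> bool" where
  "order_isomorphic s t \<longleftrightarrow> length s = length t \<and>
     (\<forall>i<length s. \<forall>j<length s. s ! i < s ! j \<longleftrightarrow> t ! i < t ! j)"

definition perm_contains :: "nat list \<Rightarrow> nat list \<Rightarrow> bool" where
  "perm_contains p q \<longleftrightarrow> (\<exists>s. subseq s p \<and> order_isomorphic s q)"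

definition avoids :: "nat list \<Rightarrow> nat list \<Rightarrow> bool" where
  "avoids p q \<longleftrightarrow> \<not> perm_contains p q"

definition perm_class :: "nat list set \<Rightarrow> bool" where
  "perm_class C \<longleftrightarrow> (\<forall>p\<in>C. is_perm p) \<and>
     (\<forall>p\<in>C. \<forall>q. is_perm q \<and> perm_contains p q \<longrightarrow> q \<in> C)"

definition perm_sum :: "nat list \<Rightarrow> nat list \<Rightarrow> nat list" where
  "perm_sum a b = a @ map (\<lambda>x. x + length a) b"

text \<open>
  Read literally, the empty permutation is sum-indecomposable; this cannot affect whether a
  class has finitely many sum-indecomposable members.
\<close>

definition sum_indecomposable :: "nat list \<Rightarrow> bool" where
  "sum_indecomposable p \<longleftrightarrow> is_perm p \<and>
     \<not> (\<exists>a b. is_perm a \<and> is_perm b \<and> a \<noteq> [] \<and> b \<noteq> [] \<and> p = perm_sum a b)"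

definition of_size :: "nat list set \<Rightarrow> nat \<Rightarrow> nat list set" where
  "of_size C n = {p \<in> C. length p = n}"

definition growth :: "nat list set \<Rightarrow> nat \<Rightarrow> nat" where
  "growth C n = card (of_size C n)"

definition wilf_equivalence :: "nat list set \<Rightarrow> (nat list \<times> nat list) set" where
  "wilf_equivalence C = {(a, b). a \<in> C \<and> b \<in> C \<and>
     (\<forall>m. card {p \<in> of_size C m. avoids p a} = card {p \<in> of_size C m. avoids p b})}"

definition wilf_classes :: "nat list set \<Rightarrow> nat \<Rightarrow> nat" where
  "wilf_classes C n = card (of_size C n // wilf_equivalence C)"

definition wilf_collapse :: "nat list set \<Rightarrow> bool" where
  "wilf_collapse C \<longleftrightarrow> (\<lambda>n. real (wilf_classes C n)) \<in> o(\<lambda>n. real (growth C n))"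

lemma finite_of_size:
  assumes "perm_class C"
  shows "finite (of_size C n)"
proof (rule finite_subset)
  show "of_size C n \<subseteq> permutations_of_set {1..n}"
    using assms by (auto simp: of_size_def perm_class_def is_perm_def)
qed simp

lemma equiv_wilf_equivalence: "equiv C (wilf_equivalence C)"
  by (rule equivI) (auto simp: wilf_equivalence_def refl_on_def sym_def trans_def)

end

theory Submission
  imports
    Defs
    "HOL-Library.Infinite_Set"
    "HOL-Computational_Algebra.Formal_Power_Series"
begin

text \<open>
  Every permutation is a unique word over the finite alphabet of indecomposables of the class, so
  the class becomes a set \<open>W\<close> of words that is closed under containment, hence under subwords.

  By Higman's lemma \<open>W\<close> has a finite basis, and well-founded induction over subword-closed
  sets covers \<open>W\<close> by finitely many languages \<open>A\<^sub>1\<^sup>* b\<^sub>1 A\<^sub>2\<^sup>* \<dots> A\<^sub>k\<^sup>*\<close> with \<open>b\<^sub>i \<notin> A\<^sub>i\<close>. If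
  \<open>\<theta>\<close> is the inverse of the growth rate and \<open>k\<close> is the largest number of factors \<open>A\<^sub>i\<close> of top
  growth rate that occur together, there are of the order of \<open>n\<^bsup>k-1\<^esup> \<theta>\<^bsup>-n\<^esup>\<close> words of size \<open>n\<close>,
  and all but a vanishing proportion of them contain long universal words of all factors of such a
  top language. A word of \<open>W\<close> that contains such a generic word cannot have letters outside \<open>A\<^sub>i\<close>
  in the interior of the \<open>i\<close>-th factor, since it could otherwise be extended to \<open>k + 1\<close> factors.

  Let \<open>x\<close> be a letter of maximal size in \<open>A = A\<^sub>i\<close>. In an embedding of \<open>u x g x v\<close> with \<open>u\<close>, \<open>v\<close>
  generic, each of the two letters \<open>x\<close> is mapped onto a letter \<open>x\<close>, and so the generating function
  of the words containing \<open>u x g x v\<close> is the product of one that depends only on \<open>g\<close> and the one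
  for \<open>u x x v\<close>. Therefore the words between consecutive letters \<open>x\<close> can be permuted without
  changing the Wilf class. If \<open>\<theta> < 1\<close>, this gives arbitrarily large Wilf classes, because words
  with many equal consecutive gaps are rare. If \<open>\<theta> = 1\<close>, all \<open>A\<^sub>i\<close> consist of the permutation 1
  only, unbounded growth forces \<open>k \<ge> 2\<close>, and the same formula with \<open>x = g = 1\<close> lets one move
  copies of 1 from the first factor to the second.
\<close>

section \<open>Higman's lemma\<close>

text \<open>Containment of permutations is coarser than the subword order: a large indecomposable of
  the host may receive several consecutive letters of the pattern, and different ones in different
  embeddings. Sizes are the only control. One host letter receives at most \<open>max_sz\<close>
  letters, and a host letter of the same size as a pattern letter receives it only by being equal to
  it. This is why the letter \<open>x\<close> has maximal size and why generic words carry spare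
  repetitions on both sides.

  Higman's lemma enters twice, as well-foundedness when growth is measured and as a bound
  \<open>K\<close> on the length of basis words. The bound makes membership in \<open>W\<close> a
  matter of short subwords, so that \<open>K\<close> repetitions of an alphabet can stand in for
  arbitrary powers.

  No exact asymptotics are needed: upper and lower bounds of the same polynomial order suffice. The
  lower bound relies on the permutation 1, which belongs to every alphabet of top growth rate and
  excludes periodicity. At the end it is enough that, for every R, at most a fraction 1/R of the
  words of each large size lies in Wilf classes with fewer than R members.\<close>

definition ascending_rich :: "'a list set \<Rightarrow> bool" where
  "ascending_rich S \<longleftrightarrow> (\<forall>f::nat \<Rightarrow> 'a list. range f \<subseteq> S \<longrightarrow>
     (\<exists>\<phi>::nat \<Rightarrow> nat. strict_mono \<phi> \<and> (\<forall>i j. i \<le> j \<longrightarrow> subseq (f (\<phi> i)) (f (\<phi> j)))))"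

lemma ascending_richD:
  fixes f :: "nat \<Rightarrow> 'a list"
  assumes "ascending_rich S" "\<And>i. f i \<in> S"
  obtains \<phi> :: "nat \<Rightarrow> nat" where "strict_mono \<phi>" "\<And>i j. i \<le> j \<Longrightarrow> subseq (f (\<phi> i)) (f (\<phi> j))"
proof -
  have "range f \<subseteq> S" using assms(2) by blast
  then have "\<exists>\<phi>::nat \<Rightarrow> nat. strict_mono \<phi> \<and> (\<forall>i j. i \<le> j \<longrightarrow> subseq (f (\<phi> i)) (f (\<phi> j)))"
    using assms(1) unfolding ascending_rich_def by (elim allE impE)
  with that show ?thesis by blast
qed

lemma ascending_rich_infinite:
  fixes f :: "nat \<Rightarrow> 'a list"
  assumes "ascending_rich S" "infinite {i. f i \<in> S}"
  obtains \<phi> :: "nat \<Rightarrow> nat" where "strict_mono \<phi>" "\<And>i. f (\<phi> i) \<in> S"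
    "\<And>i j. i \<le> j \<Longrightarrow> subseq (f (\<phi> i)) (f (\<phi> j))"
proof -
  obtain r :: "nat \<Rightarrow> nat" where r: "strict_mono r" "\<And>n. f (r n) \<in> S"
    using infinite_enumerate[OF assms(2)] by blast
  obtain \<psi> :: "nat \<Rightarrow> nat" where \<psi>: "strict_mono \<psi>" "\<And>i j. i \<le> j \<Longrightarrow> subseq (f (r (\<psi> i))) (f (r (\<psi> j)))"
    using ascending_richD[of S "\<lambda>i. f (r i)"] assms(1) r(2) by metis
  show ?thesis
  proof (rule that)
    show "strict_mono (r \<circ> \<psi>)" by (rule strict_mono_o[OF r(1) \<psi>(1)])
    show "f ((r \<circ> \<psi>) i) \<in> S" for i unfolding comp_def by (rule r(2))
    show "subseq (f ((r \<circ> \<psi>) i)) (f ((r \<circ> \<psi>) j))" if "i \<le> j" for i j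
      using \<psi>(2)[OF that] unfolding comp_def .
  qed
qed

text \<open>A word avoiding \<open>a # w\<close> either misses \<open>a\<close> or splits at its
  first \<open>a\<close> into an \<open>a\<close>-free part and a part avoiding \<open>w\<close>.
  Infinitely many terms are of one kind; for the second kind, thinning out for each part in turn
  aligns the whole words.\<close>

lemma ascending_rich_avoid:
  assumes "a \<in> A" "ascending_rich (lists (A - {a}))" "ascending_rich {u \<in> lists A. \<not> subseq w u}"
  shows "ascending_rich {u \<in> lists A. \<not> subseq (a # w) u}"
  unfolding ascending_rich_def
proof (intro allI impI)
  fix f :: "nat \<Rightarrow> 'a list"
  assume f: "range f \<subseteq> {u \<in> lists A. \<not> subseq (a # w) u}"
  show "\<exists>\<phi>::nat \<Rightarrow> nat. strict_mono \<phi> \<and> (\<forall>i j. i \<le> j \<longrightarrow> subseq (f (\<phi> i)) (f (\<phi> j)))"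
  proof (cases "infinite {i. f i \<in> lists (A - {a})}")
    case True
    then show ?thesis using ascending_rich_infinite[OF assms(2) True] by metis
  next
    case False
    define g where "g i = takeWhile (\<lambda>y. y \<noteq> a) (f i)" for i
    define h where "h i = tl (dropWhile (\<lambda>y. y \<noteq> a) (f i))" for i
    have split: "f i = g i @ a # h i" if "f i \<notin> lists (A - {a})" for i
    proof -
      have "f i \<in> lists A" using f by auto
      then have "a \<in> set (f i)" using that by auto
      then have "dropWhile (\<lambda>y. y \<noteq> a) (f i) \<noteq> []" by (auto simp: dropWhile_eq_Nil_conv)
      moreover from this have "hd (dropWhile (\<lambda>y. y \<noteq> a) (f i)) = a"
        using hd_dropWhile[of "\<lambda>y. y \<noteq> a" "f i"] by simp
      ultimately have "dropWhile (\<lambda>y. y \<noteq> a) (f i) = a # h i"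
        unfolding h_def by (metis list.collapse)
      then show ?thesis unfolding g_def by (metis takeWhile_dropWhile_id)
    qed
    have "{i. f i \<notin> lists (A - {a})} = - {i. f i \<in> lists (A - {a})}" by auto
    then have "infinite {i. f i \<notin> lists (A - {a})}"
      using False by (metis finite_compl infinite_UNIV_nat)
    then obtain r :: "nat \<Rightarrow> nat" where r: "strict_mono r" "\<And>n. f (r n) \<notin> lists (A - {a})"
      using infinite_enumerate by (metis (mono_tags, lifting) mem_Collect_eq)
    have fA: "f i \<in> lists A" for i using f by auto
    have "g i \<in> lists (A - {a})" for i
      using fA[of i] by (auto simp: g_def dest: set_takeWhileD)
    then obtain \<psi> :: "nat \<Rightarrow> nat" where \<psi>: "strict_mono \<psi>" "\<And>i j. i \<le> j \<Longrightarrow> subseq (g (r (\<psi> i))) (g (r (\<psi> j)))"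
      using ascending_richD[OF assms(2), of "\<lambda>i. g (r i)"] by metis
    have "h (r i) \<in> {u \<in> lists A. \<not> subseq w u}" for i
    proof -
      have "f (r i) = g (r i) @ a # h (r i)" using split r by blast
      moreover have "\<not> subseq (a # w) (f (r i))" using f by auto
      ultimately have "\<not> subseq w (h (r i))" by (metis subseq_Cons2 subseq_drop_many)
      moreover have "h (r i) \<in> lists A"
        using fA[of "r i"] \<open>f (r i) = g (r i) @ a # h (r i)\<close> by auto
      ultimately show ?thesis by simp
    qed
    then obtain \<chi> :: "nat \<Rightarrow> nat" where \<chi>: "strict_mono \<chi>" "\<And>i j. i \<le> j \<Longrightarrow> subseq (h (r (\<psi> (\<chi> i)))) (h (r (\<psi> (\<chi> j))))"
      using ascending_richD[OF assms(3), of "\<lambda>i. h (r (\<psi> i))"] by metis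
    have "subseq (f ((r \<circ> \<psi> \<circ> \<chi>) i)) (f ((r \<circ> \<psi> \<circ> \<chi>) j))" if "i \<le> j" for i j
    proof -
      have "subseq (g (r (\<psi> (\<chi> i)))) (g (r (\<psi> (\<chi> j))))"
        using \<psi>(2) \<chi>(1) that by (meson strict_mono_less_eq)
      then show ?thesis
        using \<chi>(2)[OF that] split[OF r(2)] by (simp add: list_emb_append_mono)
    qed
    moreover have "strict_mono (r \<circ> \<psi> \<circ> \<chi>)"
      using r(1) \<psi>(1) \<chi>(1) by (intro strict_mono_o)
    ultimately show ?thesis by blast
  qed
qed

text \<open>Double induction on the alphabet and on an avoided word. Either some term is avoided by
  infinitely many others, or every term embeds in all late ones and an ascending chain can be picked
  greedily.\<close>

theorem higman: "finite A \<Longrightarrow> ascending_rich (lists A)"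
proof (induction A rule: finite_psubset_induct)
  case (psubset A)
  have avoid: "ascending_rich {u \<in> lists A. \<not> subseq w u}" if "w \<in> lists A" for w
    using that
  proof (induction w)
    case Nil
    then show ?case by (simp add: ascending_rich_def)
  next
    case (Cons a w)
    then show ?case using psubset.IH[of "A - {a}"] by (intro ascending_rich_avoid) auto
  qed
  show ?case
    unfolding ascending_rich_def
  proof (intro allI impI)
    fix f :: "nat \<Rightarrow> 'a list"
    assume f: "range f \<subseteq> lists A"
    show "\<exists>\<phi>::nat \<Rightarrow> nat. strict_mono \<phi> \<and> (\<forall>i j. i \<le> j \<longrightarrow> subseq (f (\<phi> i)) (f (\<phi> j)))"
    proof (cases "\<exists>k. infinite {j. \<not> subseq (f k) (f j)}")
      case True
      then obtain k where "infinite {j. \<not> subseq (f k) (f j)}" by blast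
      moreover have "{j. \<not> subseq (f k) (f j)} = {j. f j \<in> {u \<in> lists A. \<not> subseq (f k) u}}"
        using f by auto
      ultimately have inf: "infinite {j. f j \<in> {u \<in> lists A. \<not> subseq (f k) u}}" by simp
      have "f k \<in> lists A" using f by blast
      from ascending_rich_infinite[OF avoid[OF this] inf] show ?thesis by metis
    next
      case False
      then have "\<exists>N. \<forall>j\<ge>N. subseq (f k) (f j)" for k
        by (metis (mono_tags, lifting) finite_nat_set_iff_bounded mem_Collect_eq not_le)
      then obtain N where N: "\<And>k j. j \<ge> N k \<Longrightarrow> subseq (f k) (f j)" by metis
      define \<phi> where "\<phi> = rec_nat 0 (\<lambda>_ m. max (Suc m) (N m))"
      have \<phi>_step: "\<phi> (Suc n) = max (Suc (\<phi> n)) (N (\<phi> n))" for n by (simp add: \<phi>_def)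
      have "strict_mono \<phi>" by (simp add: strict_mono_Suc_iff \<phi>_step less_max_iff_disj)
      moreover have "subseq (f (\<phi> i)) (f (\<phi> j))" if "i \<le> j" for i j
        using that
      proof (induction rule: dec_induct)
        case (step n)
        have "N (\<phi> n) \<le> \<phi> (Suc n)" by (simp add: \<phi>_step)
        then show ?case using N step.IH by (blast intro: subseq_order.trans)
      qed simp
      ultimately show ?thesis by blast
    qed
  qed
qed

lemma higman_good:
  assumes "finite A" "range f \<subseteq> lists A"
  obtains i j :: nat where "i < j" "subseq (f i) (f j)"
proof -
  have "f i \<in> lists A" for i using assms(2) by blast
  then obtain \<phi> :: "nat \<Rightarrow> nat" where "strict_mono \<phi>" "\<And>i j. i \<le> j \<Longrightarrow> subseq (f (\<phi> i)) (f (\<phi> j))"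
    using ascending_richD[OF higman[OF assms(1)]] by metis
  then show ?thesis using that[of "\<phi> 0" "\<phi> 1"] by (meson strict_monoD zero_le_one zero_less_one)
qed

section \<open>Subword-closed languages: well-foundedness and finite bases\<close>

definition down_closed :: "'a set \<Rightarrow> 'a list set \<Rightarrow> bool" where
  "down_closed A E \<longleftrightarrow> E \<subseteq> lists A \<and> (\<forall>w v. w \<in> E \<longrightarrow> subseq v w \<longrightarrow> v \<in> E)"

text \<open>Words lost at the successive steps of a descending chain would form a sequence in which
  no term embeds in a later one: the later word still belongs to the language that has lost the
  earlier one.\<close>

lemma wf_down_closed:
  assumes "finite A"
  shows "wf {(D, E). down_closed A D \<and> down_closed A E \<and> D \<subset> E}"
  unfolding wf_iff_no_infinite_down_chain
proof (rule notI, elim exE)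
  fix E :: "nat \<Rightarrow> 'a list set"
  assume "\<forall>i. (E (Suc i), E i) \<in> {(D, E). down_closed A D \<and> down_closed A E \<and> D \<subset> E}"
  then have E: "\<And>i. down_closed A (E i)" "\<And>i. E (Suc i) \<subset> E i" by auto
  then have "\<exists>w. w \<in> E i \<and> w \<notin> E (Suc i)" for i by blast
  then obtain f where f: "\<And>i. f i \<in> E i" "\<And>i. f i \<notin> E (Suc i)" by metis
  have anti: "E j \<subseteq> E i" if "i \<le> j" for i j
    using lift_Suc_antimono_le[of E, OF _ that] E(2) by blast
  have "range f \<subseteq> lists A" using f E(1) unfolding down_closed_def by blast
  then obtain i j where ij: "i < j" "subseq (f i) (f j)" using higman_good[OF assms] by metis
  have "f j \<in> E (Suc i)" using anti[of "Suc i" j] ij f by auto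
  then have "f i \<in> E (Suc i)" using E(1) ij unfolding down_closed_def by blast
  then show False using f by blast
qed

text \<open>The minimal non-members form an antichain, so there are finitely many. Only a bound on
  their length is retained.\<close>

lemma finite_basis:
  assumes "finite A" "down_closed A E"
  obtains K where "\<And>w. w \<in> lists A \<Longrightarrow> w \<notin> E \<Longrightarrow> \<exists>b. subseq b w \<and> b \<notin> E \<and> length b \<le> K"
proof -
  define B where "B = {b \<in> lists A. b \<notin> E \<and> (\<forall>v. subseq v b \<longrightarrow> v \<noteq> b \<longrightarrow> v \<in> E)}"
  have "finite B"
  proof (rule ccontr)
    assume "infinite B"
    then obtain f :: "nat \<Rightarrow> _" where f: "inj f" "range f \<subseteq> B" using infinite_countable_subset by blast
    then have "range f \<subseteq> lists A" unfolding B_def by blast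
    then obtain i j where ij: "i < j" "subseq (f i) (f j)" using higman_good[OF assms(1)] by metis
    have "f i \<noteq> f j" using f(1) ij(1) by (metis injD less_irrefl)
    then show False using f(2) ij(2) unfolding B_def by blast
  qed
  then obtain K where K: "\<And>b. b \<in> B \<Longrightarrow> length b \<le> K"
    by (metis finite_imageI finite_nat_set_iff_bounded_le imageI)
  have "\<exists>b. subseq b w \<and> b \<in> B" if "w \<in> lists A" "w \<notin> E" for w
    using that
  proof (induction "length w" arbitrary: w rule: less_induct)
    case less
    show ?case
    proof (cases "w \<in> B")
      case False
      then obtain v where v: "subseq v w" "v \<noteq> w" "v \<notin> E"
        using less.prems unfolding B_def by blast
      then have "length v < length w"
        using list_emb_length[OF v(1)] subseq_same_length[OF v(1)] by linarith
      moreover have "v \<in> lists A" using less.prems(1) list_emb_set[OF v(1)] by (metis in_lists_conv_set)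
      ultimately obtain b where "subseq b v" "b \<in> B" using less.hyps v(3) by blast
      then show ?thesis using v(1) subseq_order.trans by blast
    qed auto
  qed
  then show ?thesis using that[of K] K unfolding B_def by blast
qed

section \<open>Counting words by weight\<close>

definition conv :: "(nat \<Rightarrow> real) \<Rightarrow> (nat \<Rightarrow> real) \<Rightarrow> nat \<Rightarrow> real" where
  "conv f g n = (\<Sum>j\<le>n. f j * g (n - j))"

text \<open>Level 0 is summability and level \<open>k + 1\<close> is \<open>O(n\<^sup>k)\<close>: convolution with a summable sequence preserves
  the level, convolution with a bounded one raises it by one.\<close>

fun order_le :: "nat \<Rightarrow> (nat \<Rightarrow> real) \<Rightarrow> bool" where
  "order_le 0 f = (\<exists>C. \<forall>n. (\<Sum>i\<le>n. f i) \<le> C)"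
| "order_le (Suc k) f = (\<exists>C. \<forall>n. f n \<le> C * real (n + 1) ^ k)"

lemma order_leE:
  assumes "order_le (Suc k) f"
  obtains C where "C > 0" "\<And>n. f n \<le> C * real (n + 1) ^ k"
proof -
  obtain C where C: "\<And>n. f n \<le> C * real (n + 1) ^ k" using assms by auto
  have "f n \<le> max C 1 * real (n + 1) ^ k" for n
    using C[of n] by (rule order_trans) (intro mult_right_mono, auto)
  then show ?thesis using that[of "max C 1"] by simp
qed

lemma order_le_0E:
  assumes "order_le 0 f"
  obtains C where "C > 0" "\<And>n. (\<Sum>i\<le>n. f i) \<le> C"
proof -
  obtain C where C: "\<And>n. (\<Sum>i\<le>n. f i) \<le> C" using assms by auto
  have "(\<Sum>i\<le>n. f i) \<le> max C 1" for n
    using C[of n] by simp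
  then show ?thesis using that[of "max C 1"] by simp
qed

lemma order_le_mono_seq:
  assumes "\<And>n. f n \<le> g n" "order_le k g"
  shows "order_le k f"
proof (cases k)
  case 0
  then obtain C where "\<And>n. (\<Sum>i\<le>n. g i) \<le> C" using assms(2) by auto
  then show ?thesis using sum_mono[of _ f g] assms(1) unfolding 0 order_le.simps by (meson order_trans)
next
  case (Suc j)
  then show ?thesis using assms by (auto intro: order_trans)
qed

lemma order_le_Suc:
  assumes "\<And>n. 0 \<le> f n" "order_le k f"
  shows "order_le (Suc k) f"
proof (cases k)
  case 0
  then obtain C where C: "\<And>n. (\<Sum>i\<le>n. f i) \<le> C" using assms(2) by auto
  have "f n \<le> C" for n
    using member_le_sum[of n "{..n}" f] C[of n] assms(1) by simp
  then show ?thesis unfolding 0 by (auto intro: exI[of _ C])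
next
  case (Suc j)
  then obtain C where C: "C > 0" "\<And>n. f n \<le> C * real (n + 1) ^ j" using assms(2) order_leE by metis
  have "f n \<le> C * real (n + 1) ^ k" for n
    using C(2)[of n] by (rule order_trans) (use C(1) Suc in \<open>auto intro!: mult_left_mono\<close>)
  then show ?thesis by auto
qed

lemma order_le_mono:
  assumes "\<And>n. 0 \<le> f n" "order_le k f" "k \<le> m"
  shows "order_le m f"
  using assms(3,2) by (induction rule: dec_induct) (simp_all only: order_le_Suc[OF assms(1)])

lemma order_le_add:
  assumes "order_le k f" "order_le k g"
  shows "order_le k (\<lambda>n. f n + g n)"
proof (cases k)
  case 0
  then obtain C D where "\<And>n. (\<Sum>i\<le>n. f i) \<le> C" "\<And>n. (\<Sum>i\<le>n. g i) \<le> D"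
    using assms by auto
  then have "(\<Sum>i\<le>n. f i + g i) \<le> C + D" for n by (simp add: sum.distrib add_mono)
  then show ?thesis unfolding 0 by auto
next
  case (Suc j)
  then obtain C D where CD: "\<And>n. f n \<le> C * real (n + 1) ^ j" "\<And>n. g n \<le> D * real (n + 1) ^ j"
    using assms by auto
  have "f n + g n \<le> (C + D) * real (n + 1) ^ j" for n
    using add_mono[OF CD(1)[of n] CD(2)[of n]] by (simp only: distrib_right)
  then show ?thesis unfolding Suc by auto
qed

lemma order_le_zero: "order_le k (\<lambda>_. 0)"
  by (cases k) (auto intro: exI[of _ 0])

lemma order_le_sum:
  assumes "finite B" "\<And>b. b \<in> B \<Longrightarrow> order_le k (f b)"
  shows "order_le k (\<lambda>n. \<Sum>b\<in>B. f b n)"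
  using assms by (induction B rule: finite_induct) (simp_all add: order_le_zero order_le_add)

lemma sum_atMost_rev: "(\<Sum>j\<le>n. g (n - j)) = (\<Sum>j\<le>n. (g j :: real))" for n :: nat
  by (rule sum.reindex_bij_witness[of _ "\<lambda>j. n - j" "\<lambda>j. n - j"]) auto

lemma order_le_conv_summable:
  assumes f: "\<And>n. 0 \<le> f n" and g: "\<And>n. 0 \<le> g n"
    and "order_le 0 f" "order_le k g"
  shows "order_le k (conv f g)"
proof -
  obtain F where F: "F > 0" "\<And>n. (\<Sum>i\<le>n. f i) \<le> F" using order_le_0E[OF assms(3)] by metis
  show ?thesis
  proof (cases k)
    case 0
    then obtain G where G: "G > 0" "\<And>n. (\<Sum>i\<le>n. g i) \<le> G"
      using assms(4) order_le_0E by blast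
    have "(\<Sum>n\<le>N. conv f g n) \<le> F * G" for N
    proof -
      have "(\<Sum>n\<le>N. conv f g n) = (\<Sum>(i,j)\<in>{(i,j). i + j \<le> N}. f i * g j)"
        unfolding conv_def by (rule sum.triangle_reindex_eq[symmetric])
      also have "\<dots> \<le> (\<Sum>(i,j)\<in>{..N} \<times> {..N}. f i * g j)"
        by (rule sum_mono2) (use f g in auto)
      also have "\<dots> = (\<Sum>i\<le>N. f i) * (\<Sum>j\<le>N. g j)"
        by (simp add: sum_product sum.cartesian_product)
      also have "\<dots> \<le> F * G" using F G f g by (intro mult_mono) (auto intro: sum_nonneg)
      finally show ?thesis .
    qed
    then show ?thesis unfolding 0 by auto
  next
    case (Suc j)
    then obtain G where G: "G > 0" "\<And>n. g n \<le> G * real (n + 1) ^ j"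
      using assms(4) order_leE by blast
    have "conv f g n \<le> F * G * real (n + 1) ^ j" for n
    proof -
      have "g (n - i) \<le> G * real (n + 1) ^ j" for i
        using G(2)[of "n - i"] by (rule order_trans) (use G(1) in \<open>auto intro!: mult_left_mono power_mono\<close>)
      then have "conv f g n \<le> (\<Sum>i\<le>n. f i * (G * real (n + 1) ^ j))"
        unfolding conv_def by (intro sum_mono mult_left_mono f)
      also have "\<dots> = (\<Sum>i\<le>n. f i) * (G * real (n + 1) ^ j)" by (simp only: sum_distrib_right)
      also have "\<dots> \<le> F * (G * real (n + 1) ^ j)" using F G by (intro mult_right_mono) auto
      finally show ?thesis by (simp only: mult.assoc)
    qed
    then show ?thesis unfolding Suc by auto
  qed
qed

lemma order_le_conv_bounded:
  assumes f: "\<And>n. 0 \<le> f n" "\<And>n. f n \<le> 1" and g: "\<And>n. 0 \<le> g n" and k: "order_le k g"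
  shows "order_le (Suc k) (conv f g)"
proof -
  have le: "conv f g n \<le> (\<Sum>j\<le>n. g j)" for n
  proof -
    have "conv f g n \<le> (\<Sum>j\<le>n. 1 * g (n - j))"
      unfolding conv_def by (intro sum_mono mult_right_mono f g)
    then show ?thesis by (simp add: sum_atMost_rev)
  qed
  show ?thesis
  proof (cases k)
    case 0
    then obtain G where "\<And>n. (\<Sum>i\<le>n. g i) \<le> G" using k by auto
    then show ?thesis unfolding 0 using le by (auto intro!: exI[of _ G] intro: order_trans)
  next
    case (Suc j)
    then obtain G where G: "G > 0" "\<And>n. g n \<le> G * real (n + 1) ^ j"
      using k order_leE by blast
    have "conv f g n \<le> G * real (n + 1) ^ k" for n
    proof -
      have "(\<Sum>i\<le>n. g i) \<le> (\<Sum>i\<le>n. G * real (n + 1) ^ j)"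
      proof (rule sum_mono)
        fix i assume "i \<in> {..n}"
        then have "real (i + 1) ^ j \<le> real (n + 1) ^ j" by (intro power_mono) auto
        then show "g i \<le> G * real (n + 1) ^ j"
          using G(2)[of i] G(1) by (meson mult_left_mono less_imp_le order_trans)
      qed
      also have "\<dots> = G * real (n + 1) ^ k" unfolding Suc by simp
      finally show ?thesis using le[of n] by linarith
    qed
    then show ?thesis by auto
  qed
qed

text \<open>Level \<open>k\<close> means order n^(k-1), so \<open>k \<le> m\<close> leaves a whole
  factor n to spare against n^m. At level 0 this factor is replaced by the vanishing of the terms of
  a convergent series.\<close>

lemma order_le_negligible:
  assumes f: "order_le k f" "\<And>n. 0 \<le> f n" and "k \<le> m"
    and g: "c > 0" "\<And>n. n \<ge> n0 \<Longrightarrow> g n \<ge> c * real (n + 1) ^ m" and "\<epsilon> > 0"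
  shows "\<forall>\<^sub>F n in sequentially. f n \<le> \<epsilon> * g n"
proof -
  have "\<forall>\<^sub>F n in sequentially. f n \<le> \<epsilon> * c * real (n + 1) ^ m"
  proof (cases k)
    case 0
    then obtain C where "\<And>n. (\<Sum>i\<le>n. f i) \<le> C" using f by auto
    then have "summable f" using f(2)
      by (intro bounded_imp_summable[of f C]) auto
    then have "f \<longlonglongrightarrow> 0" by (rule summable_LIMSEQ_zero)
    then have "\<forall>\<^sub>F n in sequentially. f n < \<epsilon> * c"
      using g(1) assms(6) by (auto intro: order_tendstoD)
    then show ?thesis
    proof (rule eventually_mono)
      fix n assume "f n < \<epsilon> * c"
      moreover have "\<epsilon> * c * 1 \<le> \<epsilon> * c * real (n + 1) ^ m"
        using g(1) assms(6) by (intro mult_left_mono one_le_power) auto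
      ultimately show "f n \<le> \<epsilon> * c * real (n + 1) ^ m" by simp
    qed
  next
    case (Suc j)
    then obtain C where C: "C > 0" "\<And>n. f n \<le> C * real (n + 1) ^ j"
      using f(1) order_leE by blast
    obtain N :: nat where N: "real N \<ge> C / (\<epsilon> * c)" using real_arch_simple by blast
    show ?thesis
    proof (rule eventually_sequentiallyI[of N])
      fix n assume "N \<le> n"
      then have "C / (\<epsilon> * c) \<le> real (n + 1)" using N by linarith
      then have "C \<le> \<epsilon> * c * real (n + 1)"
        using g(1) assms(6) by (simp add: divide_le_eq mult_ac)
      then have "C * real (n + 1) ^ j \<le> \<epsilon> * c * real (n + 1) * real (n + 1) ^ j"
        by (intro mult_right_mono) auto
      also have "\<dots> = \<epsilon> * c * real (n + 1) ^ k" unfolding Suc by simp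
      also have "\<dots> \<le> \<epsilon> * c * real (n + 1) ^ m"
        using g(1) assms(3,6) by (intro mult_left_mono power_increasing) auto
      finally show "f n \<le> \<epsilon> * c * real (n + 1) ^ m" using C(2)[of n] by linarith
    qed
  qed
  then show ?thesis
    using eventually_ge_at_top[of n0]
  proof eventually_elim
    case (elim n)
    have "\<epsilon> * (c * real (n + 1) ^ m) \<le> \<epsilon> * g n"
      using g(2)[OF elim(2)] assms(6) by (intro mult_left_mono) auto
    then show ?case using elim(1) by (simp only: mult.assoc)
  qed
qed

text \<open>Otherwise the sequence would be negligible against itself, hence eventually
  nonpositive.\<close>

lemma order_le_conflict:
  assumes "order_le k f" "\<And>n. 0 \<le> f n" "c > 0" "\<And>n. n \<ge> n0 \<Longrightarrow> f n \<ge> c * real (n + 1) ^ m"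
  shows "m < k"
proof (rule ccontr)
  assume "\<not> m < k"
  then have "\<forall>\<^sub>F n in sequentially. f n \<le> 1 / 2 * f n"
    using assms by (intro order_le_negligible[of k f m c n0]) auto
  then have "\<forall>\<^sub>F n in sequentially. f n \<le> 0" by (rule eventually_mono) simp
  then obtain N where N: "\<And>n. n \<ge> N \<Longrightarrow> f n \<le> 0" unfolding eventually_sequentially by blast
  have "f (max N n0) \<ge> c * real (max N n0 + 1) ^ m" by (rule assms(4)) simp
  moreover have "c * real (max N n0 + 1) ^ m > 0" using assms(3) by (intro mult_pos_pos zero_less_power) auto
  ultimately show False using N[of "max N n0"] by simp
qed

section \<open>Numbers of words of given weight\<close>

locale weighted_alphabet =
  fixes I :: "'a set" and sz :: "'a \<Rightarrow> nat"
  assumes finite_I: "finite I" and sz_pos: "x \<in> I \<Longrightarrow> 1 \<le> sz x"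
begin

definition wt :: "'a list \<Rightarrow> nat" where "wt w = sum_list (map sz w)"

lemma wt_simps [simp]: "wt [] = 0" "wt (x # w) = sz x + wt w" "wt (u @ v) = wt u + wt v"
  by (simp_all add: wt_def)

lemma length_le_wt: "w \<in> lists I \<Longrightarrow> length w \<le> wt w"
  by (induction w) (use sz_pos in \<open>fastforce+\<close>)

definition cnt :: "'a list set \<Rightarrow> nat \<Rightarrow> nat" where
  "cnt E n = card {w \<in> E. wt w = n}"

lemma finite_wt: "E \<subseteq> lists I \<Longrightarrow> finite {w \<in> E. wt w = n}"
  by (rule finite_subset[OF _ finite_lists_length_le[OF finite_I, of n]])
    (use length_le_wt in fastforce)

lemma cnt_mono: "D \<subseteq> E \<Longrightarrow> E \<subseteq> lists I \<Longrightarrow> cnt D n \<le> cnt E n"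
  unfolding cnt_def by (intro card_mono finite_wt) auto

definition conc :: "'a list set \<Rightarrow> 'a list set \<Rightarrow> 'a list set" where
  "conc P Q = (\<lambda>(u, v). u @ v) ` (P \<times> Q)"

lemma concI: "u \<in> P \<Longrightarrow> v \<in> Q \<Longrightarrow> u @ v \<in> conc P Q"
  unfolding conc_def by (rule image_eqI[of _ _ "(u, v)"]) auto

lemma conc_subset: "P \<subseteq> lists I \<Longrightarrow> Q \<subseteq> lists I \<Longrightarrow> conc P Q \<subseteq> lists I"
  by (auto simp: conc_def lists_eq_set subset_iff)

lemma conc_wt:
  "{w \<in> conc P Q. wt w = n} =
     (\<lambda>(u, v). u @ v) ` (\<Union>j\<in>{..n}. {u \<in> P. wt u = j} \<times> {v \<in> Q. wt v = n - j})"
  by (auto simp: conc_def image_iff)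

lemma card_conc_pairs:
  assumes "P \<subseteq> lists I" "Q \<subseteq> lists I"
  shows "finite (\<Union>j\<in>{..n}. {u \<in> P. wt u = j} \<times> {v \<in> Q. wt v = n - j})"
    and "card (\<Union>j\<in>{..n}. {u \<in> P. wt u = j} \<times> {v \<in> Q. wt v = n - j})
       = (\<Sum>j\<le>n. cnt P j * cnt Q (n - j))"
proof -
  show "finite (\<Union>j\<in>{..n}. {u \<in> P. wt u = j} \<times> {v \<in> Q. wt v = n - j})"
    by (intro finite_UN_I finite_cartesian_product finite_wt assms) auto
  show "card (\<Union>j\<in>{..n}. {u \<in> P. wt u = j} \<times> {v \<in> Q. wt v = n - j})
       = (\<Sum>j\<le>n. cnt P j * cnt Q (n - j))"
    by (subst card_UN_disjoint)
      (auto simp: cnt_def card_cartesian_product intro!: finite_cartesian_product finite_wt assms)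
qed

lemma cnt_conc_le:
  assumes "P \<subseteq> lists I" "Q \<subseteq> lists I"
  shows "cnt (conc P Q) n \<le> (\<Sum>j\<le>n. cnt P j * cnt Q (n - j))"
  unfolding cnt_def[of "conc P Q"] conc_wt card_conc_pairs(2)[OF assms, symmetric]
  by (rule card_image_le[OF card_conc_pairs(1)[OF assms]])

lemma cnt_conc_eq:
  assumes "P \<subseteq> lists I" "Q \<subseteq> lists I" "inj_on (\<lambda>(u, v). u @ v) (P \<times> Q)"
  shows "cnt (conc P Q) n = (\<Sum>j\<le>n. cnt P j * cnt Q (n - j))"
  unfolding cnt_def[of "conc P Q"] conc_wt card_conc_pairs(2)[OF assms(1,2), symmetric]
  by (rule card_image, rule inj_on_subset[OF assms(3)]) auto

lemma cnt_Cons: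
  "cnt ((#) b ` Q) n = (if sz b \<le> n then cnt Q (n - sz b) else 0)"
proof (cases "sz b \<le> n")
  case True
  then have "{w \<in> (#) b ` Q. wt w = n} = (#) b ` {w \<in> Q. wt w = n - sz b}" by auto
  then show ?thesis using True by (simp add: cnt_def card_image)
next
  case False
  then have "{w \<in> (#) b ` Q. wt w = n} = {}" by auto
  then show ?thesis unfolding cnt_def using False by (simp only: card.empty if_False)
qed

lemma cnt_lists_rec:
  assumes "A \<subseteq> I" "n > 0"
  shows "cnt (lists A) n = (\<Sum>x\<in>A. if sz x \<le> n then cnt (lists A) (n - sz x) else 0)"
proof -
  have sub: "lists A \<subseteq> lists I" using assms(1) by (rule lists_mono)
  have finA: "finite A" using assms(1) finite_I finite_subset by blast
  have "{w \<in> lists A. wt w = n} = (\<Union>x\<in>A. {w \<in> (#) x ` lists A. wt w = n})"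
  proof (intro equalityI subsetI)
    fix w assume "w \<in> {w \<in> lists A. wt w = n}"
    then show "w \<in> (\<Union>x\<in>A. {w \<in> (#) x ` lists A. wt w = n})" using assms(2) by (cases w) auto
  qed auto
  then have "cnt (lists A) n = card (\<Union>x\<in>A. {w \<in> (#) x ` lists A. wt w = n})"
    unfolding cnt_def by simp
  also have "\<dots> = (\<Sum>x\<in>A. cnt ((#) x ` lists A) n)"
    unfolding cnt_def
  proof (rule card_UN_disjoint[OF finA])
    show "\<forall>i\<in>A. finite {w \<in> (#) i ` lists A. wt w = n}"
      by (intro ballI finite_wt) (use subsetD[OF assms(1)] in auto)
  qed auto
  finally show ?thesis by (simp only: cnt_Cons)
qed

end

section \<open>Densities relative to a fixed growth rate\<close>

locale weighted_growth = weighted_alphabet +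
  fixes \<theta> :: real
  assumes \<theta>_pos: "0 < \<theta>" and \<theta>_le_1: "\<theta> \<le> 1"
begin

text \<open>Scaling by \<theta>^n turns growth rate 1/\<theta> into polynomial growth, which is what
  the levels of \<open>order_le\<close> measure.\<close>

definition dens :: "'a list set \<Rightarrow> nat \<Rightarrow> real" where
  "dens E n = real (cnt E n) * \<theta> ^ n"

lemma dens_nonneg [simp]: "0 \<le> dens E n"
  using \<theta>_pos by (simp add: dens_def)

lemma dens_mono: "D \<subseteq> E \<Longrightarrow> E \<subseteq> lists I \<Longrightarrow> dens D n \<le> dens E n"
  using \<theta>_pos cnt_mono by (auto simp: dens_def intro!: mult_right_mono)

lemma conv_dens:
  "conv (dens P) (dens Q) n = real (\<Sum>j\<le>n. cnt P j * cnt Q (n - j)) * \<theta> ^ n"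
proof -
  have "dens P j * dens Q (n - j) = real (cnt P j * cnt Q (n - j)) * \<theta> ^ n" if "j \<le> n" for j
  proof -
    have "\<theta> ^ n = \<theta> ^ j * \<theta> ^ (n - j)" using that by (simp flip: power_add)
    then show ?thesis by (simp add: dens_def)
  qed
  then show ?thesis by (simp add: conv_def sum_distrib_right)
qed

lemma dens_conc_le: "P \<subseteq> lists I \<Longrightarrow> Q \<subseteq> lists I \<Longrightarrow> dens (conc P Q) n \<le> conv (dens P) (dens Q) n"
  unfolding conv_dens dens_def using \<theta>_pos cnt_conc_le by (intro mult_right_mono) (auto simp flip: of_nat_sum)

lemma dens_conc_eq:
  "P \<subseteq> lists I \<Longrightarrow> Q \<subseteq> lists I \<Longrightarrow> inj_on (\<lambda>(u, v). u @ v) (P \<times> Q) \<Longrightarrow>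
     dens (conc P Q) n = conv (dens P) (dens Q) n"
  unfolding conv_dens dens_def by (simp add: cnt_conc_eq)

lemma dens_Cons:
  "dens ((#) b ` Q) n = (if sz b \<le> n then \<theta> ^ sz b * dens Q (n - sz b) else 0)"
  by (simp add: dens_def cnt_Cons power_add flip: power_add)

text \<open>The generating polynomial of the letters at \<theta>. As \<open>lists A\<close> has the
  generating function 1 / (1 - polynomial), mass below, equal to or above 1 means growth rate below,
  equal to or above 1/\<theta>.\<close>

definition mass :: "'a set \<Rightarrow> real" where
  "mass A = (\<Sum>x\<in>A. \<theta> ^ sz x)"

lemma dens_lists_rec:
  assumes "A \<subseteq> I" "n > 0"
  shows "dens (lists A) n = (\<Sum>x\<in>A. if sz x \<le> n then \<theta> ^ sz x * dens (lists A) (n - sz x) else 0)"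
proof -
  have "dens (lists A) n = (\<Sum>x\<in>A. dens ((#) x ` lists A) n)"
    unfolding dens_def cnt_lists_rec[OF assms] by (simp add: sum_distrib_right cnt_Cons)
  then show ?thesis by (simp only: dens_Cons)
qed

lemma dens_lists_0: "dens (lists A) 0 \<le> 1" if "A \<subseteq> I"
proof -
  have "w = []" if "w \<in> lists A" "wt w = 0" for w
    using length_le_wt[of w] that \<open>A \<subseteq> I\<close> lists_mono by fastforce
  then have "{w \<in> lists A. wt w = 0} \<subseteq> {[]}" by blast
  then have "card {w \<in> lists A. wt w = 0} \<le> card {[] :: 'a list}" by (intro card_mono) auto
  then show ?thesis by (simp add: dens_def cnt_def)
qed

text \<open>By the recursion on the first letter, each value is a combination of earlier ones with
  weights of sum at most \<open>mass A\<close>, so the bound 1 persists.\<close>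

lemma dens_lists_le_1:
  assumes "A \<subseteq> I" "mass A \<le> 1"
  shows "dens (lists A) n \<le> 1"
proof (induction n rule: less_induct)
  case (less n)
  show ?case
  proof (cases "n = 0")
    case True
    then show ?thesis using dens_lists_0[OF assms(1)] by simp
  next
    case False
    have "(if sz x \<le> n then \<theta> ^ sz x * dens (lists A) (n - sz x) else 0) \<le> \<theta> ^ sz x" if "x \<in> A" for x
    proof -
      have "sz x \<ge> 1" using sz_pos that assms(1) by blast
      then have "dens (lists A) (n - sz x) \<le> 1" using False by (intro less) simp
      then have "\<theta> ^ sz x * dens (lists A) (n - sz x) \<le> \<theta> ^ sz x * 1"
        using \<theta>_pos by (intro mult_left_mono) auto
      then show ?thesis using \<theta>_pos by simp
    qed
    then have "dens (lists A) n \<le> mass A"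
      using dens_lists_rec[OF assms(1)] False unfolding mass_def by (simp add: sum_mono)
    then show ?thesis using assms(2) by simp
  qed
qed

text \<open>Summing the recursion over all sizes up to n bounds the partial sum S by 1 +
  \<open>mass A\<close> * S, hence by 1 / (1 - \<open>mass A\<close>).\<close>

lemma dens_lists_summable:
  assumes "A \<subseteq> I" "mass A < 1"
  shows "order_le 0 (dens (lists A))"
proof -
  let ?a = "dens (lists A)"
  have shift: "(\<Sum>i\<le>n. if s \<le> i then ?a (i - s) else 0) \<le> (\<Sum>i\<le>n. ?a i)" for n s
  proof -
    have "(\<Sum>i\<le>n. if s \<le> i then ?a (i - s) else 0) = (\<Sum>i\<in>{s..n}. ?a (i - s))"
      by (rule sum.mono_neutral_cong_right) auto
    also have "\<dots> = (\<Sum>j\<in>(\<lambda>i. i - s) ` {s..n}. ?a j)"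
      by (subst sum.reindex) (auto simp: inj_on_def)
    also have "\<dots> \<le> (\<Sum>i\<le>n. ?a i)" by (intro sum_mono2) auto
    finally show ?thesis .
  qed
  have "(\<Sum>i\<le>n. ?a i) \<le> 1 / (1 - mass A)" for n
  proof -
    let ?f = "\<lambda>x i. if sz x \<le> i then \<theta> ^ sz x * ?a (i - sz x) else 0"
    have "?a i \<le> (if i = 0 then 1 else 0) + (\<Sum>x\<in>A. ?f x i)" for i
    proof (cases "i = 0")
      case True
      have "(\<Sum>x\<in>A. ?f x 0) \<ge> 0" using \<theta>_pos by (intro sum_nonneg) auto
      then show ?thesis using dens_lists_0[OF assms(1)] unfolding True by simp
    qed (simp add: dens_lists_rec[OF assms(1)])
    then have "(\<Sum>i\<le>n. ?a i) \<le> (\<Sum>i\<le>n. (if i = 0 then 1 else 0) + (\<Sum>x\<in>A. ?f x i))"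
      by (intro sum_mono)
    also have "\<dots> = 1 + (\<Sum>x\<in>A. \<Sum>i\<le>n. ?f x i)"
      by (simp add: sum.distrib sum.swap[of _ "{..n}"])
    also have "(\<Sum>x\<in>A. \<Sum>i\<le>n. ?f x i) \<le> (\<Sum>x\<in>A. \<theta> ^ sz x * (\<Sum>i\<le>n. ?a i))"
    proof (rule sum_mono)
      fix x
      have "(\<Sum>i\<le>n. ?f x i) = \<theta> ^ sz x * (\<Sum>i\<le>n. if sz x \<le> i then ?a (i - sz x) else 0)"
        unfolding sum_distrib_left by (rule sum.cong) auto
      also have "\<dots> \<le> \<theta> ^ sz x * (\<Sum>i\<le>n. ?a i)"
        using \<theta>_pos shift by (intro mult_left_mono) auto
      finally show "(\<Sum>i\<le>n. ?f x i) \<le> \<theta> ^ sz x * (\<Sum>i\<le>n. ?a i)" .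
    qed
    also have "\<dots> = mass A * (\<Sum>i\<le>n. ?a i)" unfolding mass_def by (simp add: sum_distrib_right)
    finally have "(1 - mass A) * (\<Sum>i\<le>n. ?a i) \<le> 1" by (simp add: algebra_simps)
    then show ?thesis using assms(2) by (simp add: pos_le_divide_eq mult.commute)
  qed
  then show ?thesis by auto
qed

text \<open>The letter of size 1 makes every size attainable, which excludes periodic zeros and
  settles n \<le> S. Beyond S no letter is cut off by the size limit, and the recursion is a full
  average with weights of sum 1.\<close>

lemma dens_lists_ge:
  assumes "A \<subseteq> I" "mass A = 1" "one \<in> A" "sz one = 1" and S: "\<And>x. x \<in> I \<Longrightarrow> sz x \<le> S"
  shows "dens (lists A) n \<ge> \<theta> ^ S"
proof (induction n rule: less_induct)
  case (less n)
  show ?case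
  proof (cases "n \<le> S")
    case True
    have "replicate n one \<in> {w \<in> lists A. wt w = n}"
      using assms(3,4) by (auto simp: wt_def sum_list_replicate)
    moreover have "finite {w \<in> lists A. wt w = n}" using assms(1) by (intro finite_wt lists_mono)
    ultimately have "cnt (lists A) n \<noteq> 0" unfolding cnt_def by (metis card_eq_0_iff empty_iff)
    then have "1 * \<theta> ^ n \<le> dens (lists A) n" unfolding dens_def using \<theta>_pos by (intro mult_right_mono) auto
    moreover have "\<theta> ^ S \<le> \<theta> ^ n" using True \<theta>_pos \<theta>_le_1 by (intro power_decreasing) auto
    ultimately show ?thesis by linarith
  next
    case False
    have "\<theta> ^ S = (\<Sum>x\<in>A. \<theta> ^ sz x * \<theta> ^ S)"
      using assms(2) unfolding mass_def by (simp flip: sum_distrib_right)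
    also have "\<dots> \<le> (\<Sum>x\<in>A. if sz x \<le> n then \<theta> ^ sz x * dens (lists A) (n - sz x) else 0)"
    proof (rule sum_mono)
      fix x assume "x \<in> A"
      then have "1 \<le> sz x" "sz x \<le> n" using sz_pos[of x] S[of x] assms(1) False by auto
      then show "\<theta> ^ sz x * \<theta> ^ S \<le> (if sz x \<le> n then \<theta> ^ sz x * dens (lists A) (n - sz x) else 0)"
        using less[of "n - sz x"] \<theta>_pos by (auto intro: mult_left_mono)
    qed
    also have "\<dots> = dens (lists A) n" using dens_lists_rec[OF assms(1)] False by simp
    finally show ?thesis .
  qed
qed

end

section \<open>Growth of subword-closed languages\<close>

context weighted_growth begin

lemma dens_Un_le:
  assumes "D \<subseteq> lists I" "E \<subseteq> lists I"
  shows "dens (D \<union> E) n \<le> dens D n + dens E n"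
proof -
  have "{w \<in> D \<union> E. wt w = n} = {w \<in> D. wt w = n} \<union> {w \<in> E. wt w = n}" by auto
  then have "cnt (D \<union> E) n \<le> cnt D n + cnt E n" unfolding cnt_def by (simp add: card_Un_le)
  then have "real (cnt (D \<union> E) n) \<le> real (cnt D n) + real (cnt E n)" by linarith
  then show ?thesis unfolding dens_def distrib_right[symmetric] using \<theta>_pos by (intro mult_right_mono) auto
qed

lemma dens_empty [simp]: "dens {} n = 0"
  by (simp add: dens_def cnt_def)

lemma dens_UN_le:
  assumes "finite B" "\<And>b. b \<in> B \<Longrightarrow> D b \<subseteq> lists I"
  shows "dens (\<Union>b\<in>B. D b) n \<le> (\<Sum>b\<in>B. dens (D b) n)"
  using assms
proof (induction B rule: finite_induct)
  case (insert b B)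
  have "dens (\<Union>b\<in>insert b B. D b) n \<le> dens (D b) n + dens (\<Union>b\<in>B. D b) n"
    using insert.prems by (simp, intro dens_Un_le UN_least) auto
  then show ?case using insert by fastforce
qed simp

lemma order_le_dens_singleton: "order_le 0 (dens {[b]})"
proof -
  have "dens {[b]} i \<le> (if i = sz b then 1 else 0)" for i
  proof -
    have "{w. w = [b] \<and> wt w = i} = (if i = sz b then {[b]} else {})" by auto
    then show ?thesis using \<theta>_pos \<theta>_le_1 by (simp add: dens_def cnt_def power_le_one)
  qed
  then have "(\<Sum>i\<le>n. dens {[b]} i) \<le> (\<Sum>i\<le>n. if i = sz b then 1 else 0)" for n
    by (intro sum_mono)
  moreover have "(\<Sum>i\<le>n. if i = sz b then 1 else 0) \<le> (1 :: real)" for n by simp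
  ultimately show ?thesis unfolding order_le.simps by (meson order_trans)
qed

lemma order_le_dens_Cons:
  assumes "order_le k (dens D)" "D \<subseteq> lists I" "b \<in> I"
  shows "order_le k (dens ((#) b ` D))"
proof (rule order_le_mono_seq)
  show "order_le k (conv (dens {[b]}) (dens D))"
    by (intro order_le_conv_summable order_le_dens_singleton assms dens_nonneg)
  have "(#) b ` D = conc {[b]} D"
    using concI[of "[b]" "{[b]}"] by (auto simp: conc_def)
  then show "dens ((#) b ` D) n \<le> conv (dens {[b]}) (dens D) n" for n
    using dens_conc_le[of "{[b]}" D n] assms by simp
qed

definition crit :: "'a set \<Rightarrow> bool" where
  "crit A \<longleftrightarrow> A \<subseteq> I \<and> mass A = 1"

text \<open>Under \<open>blocks\<close>, each separator lies outside the alphabet before it. A word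
  then determines its factors, and densities convolve exactly.\<close>

fun lang :: "('a set \<times> 'a) list \<Rightarrow> 'a set \<Rightarrow> 'a list set" where
  "lang [] Z = lists Z"
| "lang ((A, b) # bs) Z = conc (lists A) ((#) b ` lang bs Z)"

definition blocks :: "('a set \<times> 'a) list \<Rightarrow> 'a set \<Rightarrow> bool" where
  "blocks bs Z \<longleftrightarrow> crit Z \<and> (\<forall>(A, b) \<in> set bs. crit A \<and> b \<in> I - A)"

lemma blocks_simps [simp]:
  "blocks [] Z \<longleftrightarrow> crit Z"
  "blocks ((A, b) # bs) Z \<longleftrightarrow> crit A \<and> b \<in> I - A \<and> blocks bs Z"
  by (auto simp: blocks_def)

text \<open>\<open>k\<close> counts starred factors, one more than the separators in
  \<open>bs\<close>. This matches the levels of \<open>order_le\<close>, where \<open>k\<close>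
  factors give order n^(k-1) and none give summable density.\<close>

definition has_blocks :: "nat \<Rightarrow> 'a list set \<Rightarrow> bool" where
  "has_blocks k E \<longleftrightarrow> k = 0 \<or> (\<exists>bs Z. blocks bs Z \<and> Suc (length bs) = k \<and> lang bs Z \<subseteq> E)"

lemma has_blocks_mono: "has_blocks k D \<Longrightarrow> D \<subseteq> E \<Longrightarrow> has_blocks k E"
  unfolding has_blocks_def by blast

lemma lang_subset: "blocks bs Z \<Longrightarrow> lang bs Z \<subseteq> lists I"
proof (induction bs)
  case (Cons Ab bs)
  then show ?case
    by (cases Ab) (auto simp: crit_def conc_def lists_eq_set subset_iff)
qed (auto simp: crit_def)

lemma lang_nonempty: "\<exists>w. w \<in> lang bs Z"
  by (induction bs Z rule: lang.induct) (auto simp: conc_def intro!: exI[of _ "[]"])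

lemma has_blocks_Suc:
  assumes "has_blocks (Suc k) E" "down_closed I E"
  shows "has_blocks k E"
proof -
  obtain bs Z where bs: "blocks bs Z" "length bs = k" "lang bs Z \<subseteq> E"
    using assms(1) unfolding has_blocks_def by auto
  show ?thesis
  proof (cases bs)
    case Nil
    then show ?thesis using bs by (simp add: has_blocks_def)
  next
    case (Cons Ab cs)
    obtain A b where Ab: "Ab = (A, b)" by fastforce
    have "lang cs Z \<subseteq> E"
    proof
      fix v assume "v \<in> lang cs Z"
      then have "[] @ b # v \<in> lang bs Z" unfolding Cons Ab lang.simps by (intro concI) auto
      then have "b # v \<in> E" using bs(3) by auto
      then show "v \<in> E" using assms(2) unfolding down_closed_def by (meson list_emb_Cons subseq_order.refl)
    qed
    then show ?thesis using bs unfolding Cons Ab has_blocks_def by auto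
  qed
qed

lemma has_blocks_antimono:
  assumes "has_blocks k E" "down_closed I E" "m \<le> k"
  shows "has_blocks m E"
  using assms(3,1) by (induction rule: inc_induct) (auto intro: has_blocks_Suc[OF _ assms(2)])

text \<open>With \<open>A\<close> the set of letters \<open>a\<close> whose left quotient \<open>a\<^bsup>-1\<^esup>E\<close> is all of \<open>E\<close>, the language \<open>E\<close> is the
  union of \<open>A\<^sup>*\<close> and the languages \<open>A\<^sup>* b (b\<^bsup>-1\<^esup>E)\<close> for \<open>b \<notin> A\<close>, whose quotients are smaller than \<open>E\<close>.\<close>

lemma growth_upper:
  assumes "\<And>A. A \<subseteq> I \<Longrightarrow> lists A \<subseteq> W \<Longrightarrow> mass A \<le> 1"
    and "down_closed I E" "E \<subseteq> W"
  shows "\<exists>k. has_blocks k E \<and> order_le k (dens E)"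
  using assms(2,3)
proof (induction E rule: wf_induct_rule[OF wf_down_closed[OF finite_I]])
  case (1 E)
  have EI: "E \<subseteq> lists I" and sub: "\<And>w v. w \<in> E \<Longrightarrow> subseq v w \<Longrightarrow> v \<in> E"
    using 1(2) unfolding down_closed_def by auto
  show ?case
  proof (cases "E = {}")
    case True
    then show ?thesis by (intro exI[of _ 0]) (auto simp: has_blocks_def)
  next
    case ne: False
    define der where "der b = {w. b # w \<in> E}" for b
    define A where "A = {a \<in> I. der a = E}"
    have A: "A \<subseteq> I" by (auto simp: A_def)
    have der_sub: "der b \<subseteq> E" for b unfolding der_def using sub by (blast intro: list_emb_Cons)
    have pre: "u @ v \<in> E" if "u \<in> lists A" "v \<in> E" for u v
      using that by (induction u) (auto simp: A_def der_def)
    have "[] \<in> E" using ne sub by auto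
    then have lA: "lists A \<subseteq> E" using pre[of _ "[]"] by auto
    have massA: "mass A \<le> 1" using assms(1)[OF A] lA 1(3) by blast
    have "\<exists>k. has_blocks k (der b) \<and> order_le k (dens (der b))" if "b \<in> I - A" for b
    proof (rule 1(1))
      have "down_closed I (der b)" unfolding down_closed_def
        using der_sub EI by (auto simp: der_def intro: sub)
      moreover have "der b \<subset> E" using that der_sub unfolding A_def by blast
      ultimately show "(der b, E) \<in> {(D, E). down_closed I D \<and> down_closed I E \<and> D \<subset> E}"
        "down_closed I (der b)" "der b \<subseteq> W" using 1(2,3) by auto
    qed
    then obtain k where k: "\<And>b. b \<in> I - A \<Longrightarrow> has_blocks (k b) (der b)"
      "\<And>b. b \<in> I - A \<Longrightarrow> order_le (k b) (dens (der b))" by metis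
    \<comment> \<open>The worst quotient decides and all others are raised to its level; the
      inserted 0 covers an empty \<open>I - A\<close>.\<close>
    define m where "m = Max (insert 0 (k ` (I - A)))"
    have fin: "finite (I - A)" using finite_I by simp
    have km: "k b \<le> m" if "b \<in> I - A" for b unfolding m_def using fin that by (intro Max_ge) auto
    have "m \<in> insert 0 (k ` (I - A))" unfolding m_def using fin by (intro Max_in) auto
    then have m_cases: "m = 0 \<or> (\<exists>b \<in> I - A. m = k b)" by auto
    have derI: "der b \<subseteq> lists I" for b using der_sub EI by blast
    have ordm: "order_le m (dens ((#) b ` der b))" if "b \<in> I - A" for b
      by (rule order_le_mono[OF dens_nonneg order_le_dens_Cons[OF k(2) derI]]) (use that km in auto)
    have E_sub: "E \<subseteq> lists A \<union> (\<Union>b\<in>I - A. conc (lists A) ((#) b ` der b))"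
    proof
      fix w assume w: "w \<in> E"
      show "w \<in> lists A \<union> (\<Union>b\<in>I - A. conc (lists A) ((#) b ` der b))"
      proof (cases "dropWhile (\<lambda>a. a \<in> A) w")
        case Nil
        then show ?thesis by (auto simp: dropWhile_eq_Nil_conv)
      next
        case (Cons b v)
        have wuv: "w = takeWhile (\<lambda>a. a \<in> A) w @ b # v" using Cons by (metis takeWhile_dropWhile_id)
        have "b \<notin> A" using Cons by (metis hd_dropWhile list.distinct(1) list.sel(1))
        moreover have "b \<in> I" using w EI wuv by (metis in_lists_conv_set in_set_conv_decomp subsetD)
        moreover have "v \<in> der b" unfolding der_def
          using sub[OF w] wuv by (metis mem_Collect_eq subseq_drop_many subseq_order.refl)
        moreover have "takeWhile (\<lambda>a. a \<in> A) w \<in> lists A" by (auto dest: set_takeWhileD)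
        ultimately have "w \<in> conc (lists A) ((#) b ` der b)"
          by (subst wuv) (intro concI imageI)
        then show ?thesis using \<open>b \<in> I\<close> \<open>b \<notin> A\<close> by blast
      qed
    qed
    have concI: "conc (lists A) ((#) b ` der b) \<subseteq> lists I" if "b \<in> I - A" for b
      using that derI by (intro conc_subset lists_mono A) (auto simp: lists_eq_set subset_iff)
    have dens_E: "dens E n \<le> dens (lists A) n
        + (\<Sum>b\<in>I - A. conv (dens (lists A)) (dens ((#) b ` der b)) n)" for n
    proof -
      have "dens E n \<le> dens (lists A \<union> (\<Union>b\<in>I - A. conc (lists A) ((#) b ` der b))) n"
        using concI lists_mono[OF A] by (intro dens_mono E_sub) blast
      also have "\<dots> \<le> dens (lists A) n + dens (\<Union>b\<in>I - A. conc (lists A) ((#) b ` der b)) n"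
        using concI lists_mono[OF A] by (intro dens_Un_le) blast+
      also have "dens (\<Union>b\<in>I - A. conc (lists A) ((#) b ` der b)) n
          \<le> (\<Sum>b\<in>I - A. dens (conc (lists A) ((#) b ` der b)) n)"
        by (intro dens_UN_le fin concI)
      also have "\<dots> \<le> (\<Sum>b\<in>I - A. conv (dens (lists A)) (dens ((#) b ` der b)) n)"
      proof (intro sum_mono dens_conc_le lists_mono A)
        fix b assume "b \<in> I - A"
        then show "(#) b ` der b \<subseteq> lists I" using derI by (auto simp: lists_eq_set subset_iff)
      qed
      finally show ?thesis by simp
    qed
    \<comment> \<open>A subcritical \<open>A\<close> contributes a summable factor and leaves the
      level at \<open>m\<close>; a critical one adds one level and, if \<open>m\<close> is positive,
      one block in front of those of the worst quotient.\<close>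
    show ?thesis
    proof (cases "mass A < 1")
      case True
      have summ: "order_le 0 (dens (lists A))" by (rule dens_lists_summable[OF A True])
      have "order_le m (dens E)"
      proof (rule order_le_mono_seq[OF dens_E], intro order_le_add order_le_sum fin)
        show "order_le m (dens (lists A))" by (rule order_le_mono[OF dens_nonneg summ]) simp
        show "order_le m (conv (dens (lists A)) (dens ((#) b ` der b)))" if "b \<in> I - A" for b
          by (intro order_le_conv_summable dens_nonneg summ ordm that)
      qed
      moreover have "has_blocks m E"
        using m_cases k(1) has_blocks_mono der_sub by (metis has_blocks_def)
      ultimately show ?thesis by blast
    next
      case False
      then have mass1: "mass A = 1" using massA by simp
      have le1: "dens (lists A) n \<le> 1" for n by (rule dens_lists_le_1[OF A massA])
      have "order_le (Suc 0) (dens (lists A))" using le1 by (auto intro: exI[of _ 1])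
      then have lists_ord: "order_le (Suc m) (dens (lists A))" by (rule order_le_mono[OF dens_nonneg]) simp
      have "order_le (Suc m) (dens E)"
      proof (rule order_le_mono_seq[OF dens_E], intro order_le_add lists_ord order_le_sum fin)
        show "order_le (Suc m) (conv (dens (lists A)) (dens ((#) b ` der b)))" if "b \<in> I - A" for b
          by (intro order_le_conv_bounded dens_nonneg le1 ordm that)
      qed
      moreover have "has_blocks (Suc m) E"
      proof (cases "m = 0")
        case True
        then show ?thesis unfolding has_blocks_def using A mass1 lA
          by (intro disjI2 exI[of _ "[]"] exI[of _ A]) (auto simp: crit_def)
      next
        case False
        then obtain b where b: "b \<in> I - A" "m = k b" using m_cases by blast
        then obtain bs Z where bs: "blocks bs Z" "Suc (length bs) = m" "lang bs Z \<subseteq> der b"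
          using k(1)[OF b(1)] False unfolding has_blocks_def by auto
        have "lang ((A, b) # bs) Z \<subseteq> E" using bs(3) pre by (auto simp: conc_def der_def)
        then show ?thesis unfolding has_blocks_def using bs b A mass1
          by (intro disjI2 exI[of _ "(A, b) # bs"] exI[of _ Z]) (auto simp: crit_def)
      qed
      ultimately show ?thesis by blast
    qed
  qed
qed

lemma inj_on_conc_Cons:
  assumes "b \<notin> A"
  shows "inj_on (\<lambda>(u, v). u @ v) (lists A \<times> (#) b ` Q)"
proof (rule inj_onI)
  fix p q assume "p \<in> lists A \<times> (#) b ` Q" "q \<in> lists A \<times> (#) b ` Q"
    and eq: "(\<lambda>(u, v). u @ v) p = (\<lambda>(u, v). u @ v) q"
  then obtain u v u' v' where pq: "p = (u, b # v)" "q = (u', b # v')" "u \<in> lists A" "u' \<in> lists A"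
    by auto
  have tw: "takeWhile (\<lambda>a. a \<in> A) (x @ b # y) = x" if "x \<in> lists A" for x y
    using that assms by (subst takeWhile_append2) auto
  have "u @ b # v = u' @ b # v'" using eq unfolding pq by simp
  moreover from this have "u = u'" using tw[OF pq(3), of v] tw[OF pq(4), of v'] by simp
  ultimately show "p = q" unfolding pq by simp
qed

lemma growth_lower:
  assumes "blocks bs Z" and one: "\<And>A. A \<in> insert Z (fst ` set bs) \<Longrightarrow> one \<in> A" "sz one = 1"
  shows "\<exists>c n0. c > 0 \<and> (\<forall>n\<ge>n0. dens (lang bs Z) n \<ge> c * real (n + 1) ^ length bs)"
  using assms(1) one(1)
proof (induction bs)
  obtain S where S: "\<And>x. x \<in> I \<Longrightarrow> sz x \<le> S"
    using finite_I finite_nat_set_iff_bounded_le[of "sz ` I"] by auto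
  {
    case Nil
    then have "dens (lang [] Z) n \<ge> \<theta> ^ S * real (n + 1) ^ length []" for n
      using dens_lists_ge[of Z one S n] S one(2) by (auto simp: crit_def)
    then show ?case using \<theta>_pos by (intro exI[of _ "\<theta> ^ S"] exI[of _ 0]) auto
  next
    case (Cons Ab bs)
    obtain A b where Ab: "Ab = (A, b)" by fastforce
    obtain c n0 where c: "c > 0" "\<And>n. n \<ge> n0 \<Longrightarrow> dens (lang bs Z) n \<ge> c * real (n + 1) ^ length bs"
      using Cons unfolding Ab by auto
    let ?s = "sz b" and ?k = "length bs" and ?L = "lang bs Z"
    have A: "A \<subseteq> I" "mass A = 1" "one \<in> A" and b: "b \<in> I - A"
      using Cons.prems unfolding Ab by (auto simp: crit_def)
    have LI: "?L \<subseteq> lists I" using Cons.prems(1) unfolding Ab by (intro lang_subset) auto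
    \<comment> \<open>Only splits whose first factor has size j \<le> n/2 are kept. There are at
      least (n + 1)/2 of them, and each leaves a rest of size about n/4 or more, whence the 2 and
      the power of 4.\<close>
    let ?c = "\<theta> ^ S * \<theta> ^ ?s * c / (2 * 4 ^ ?k)"
    have "dens (lang (Ab # bs) Z) n \<ge> ?c * real (n + 1) ^ length (Ab # bs)" if n: "n \<ge> 4 * (n0 + ?s)" for n
    proof -
      let ?h = "n div 2" and ?d = "\<theta> ^ S * (\<theta> ^ ?s * (c * (real (n + 1) / 4) ^ ?k))"
      have "dens (lang (Ab # bs) Z) n = conv (dens (lists A)) (dens ((#) b ` ?L)) n"
        unfolding Ab lang.simps
      proof (rule dens_conc_eq)
        show "inj_on (\<lambda>(u, v). u @ v) (lists A \<times> (#) b ` ?L)" using b by (intro inj_on_conc_Cons) simp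
      qed (use A b LI in \<open>auto simp: lists_eq_set subset_iff\<close>)
      also have "\<dots> \<ge> (\<Sum>j\<le>?h. dens (lists A) j * dens ((#) b ` ?L) (n - j))"
        unfolding conv_def by (rule sum_mono2) auto
      also have "(\<Sum>j\<le>?h. dens (lists A) j * dens ((#) b ` ?L) (n - j)) \<ge> (\<Sum>j\<le>?h. ?d)"
      proof (rule sum_mono)
        fix j assume "j \<in> {..?h}"
        then have j: "?s \<le> n - j" "n0 \<le> n - j - ?s" "real (n + 1) / 4 \<le> real (n - j - ?s + 1)"
          using n by (auto simp: of_nat_diff)
        have "c * (real (n + 1) / 4) ^ ?k \<le> c * real (n - j - ?s + 1) ^ ?k"
          using j(3) c(1) by (intro mult_left_mono power_mono) auto
        also have "\<dots> \<le> dens ?L (n - j - ?s)" by (rule c(2)[OF j(2)])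
        finally have "\<theta> ^ ?s * (c * (real (n + 1) / 4) ^ ?k) \<le> dens ((#) b ` ?L) (n - j)"
          unfolding dens_Cons using j(1) \<theta>_pos by (auto intro: mult_left_mono)
        moreover have "\<theta> ^ S \<le> dens (lists A) j" by (rule dens_lists_ge[OF A one(2) S])
        ultimately show "?d \<le> dens (lists A) j * dens ((#) b ` ?L) (n - j)"
          using \<theta>_pos c(1) by (intro mult_mono) auto
      qed
      also have "(\<Sum>j\<le>?h. ?d) = real (?h + 1) * ?d" by simp
      also have "\<dots> \<ge> real (n + 1) / 2 * ?d"
      proof (rule mult_right_mono)
        have "n + 1 \<le> 2 * (?h + 1)" by simp
        then have "real (n + 1) \<le> real (2 * (?h + 1))" by (rule of_nat_mono)
        then have "real (n + 1) \<le> real (?h + 1) * 2" by (simp only: of_nat_mult of_nat_numeral mult.commute)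
        then show "real (n + 1) / 2 \<le> real (?h + 1)" unfolding divide_le_eq_numeral1(1) .
      qed (use \<theta>_pos c(1) in auto)
      also have "real (n + 1) / 2 * ?d = ?c * real (n + 1) ^ length (Ab # bs)"
        by (simp add: power_divide)
      finally show ?thesis by simp
    qed
    then show ?case using \<theta>_pos c(1) by (intro exI[of _ ?c] exI[of _ "4 * (n0 + ?s)"]) auto
  }
qed

end

section \<open>Containment of words and the gap formula\<close>

text \<open>A suffix \<open>v\<close> no longer than \<open>b\<close> can absorb letters of
  \<open>b\<close> only. This limits the damage when boundedly many letters are cut off a generic
  word.\<close>

lemma subseq_append_drop_right:
  assumes "subseq (a @ b) (u @ v)" "length v \<le> length b"
  shows "subseq a u"
proof -
  obtain c d where cd: "a @ b = c @ d" "subseq c u" "subseq d v" using assms(1) by (rule subseq_appendE)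
  have "length d \<le> length b" using list_emb_length[OF cd(3)] assms(2) by simp
  then obtain e where "c = a @ e" using cd(1) by (auto simp: append_eq_append_conv2)
  then show ?thesis using cd(2) by (metis list_emb_append2 list_emb_prefix subseq_order.trans prefixI prefix_imp_subseq)
qed

lemma subseq_append_drop_left:
  assumes "subseq (b @ a) (v @ u)" "length v \<le> length b"
  shows "subseq a u"
proof -
  obtain c d where cd: "b @ a = c @ d" "subseq c v" "subseq d u" using assms(1) by (rule subseq_appendE)
  have "length c \<le> length b" using list_emb_length[OF cd(2)] assms(2) by simp
  then obtain e where "d = e @ a" using cd(1) by (auto simp: append_eq_append_conv2)
  then show ?thesis using cd(3) by (metis subseq_drop_many subseq_order.refl subseq_order.trans)
qed

lemma subseq_in_lists: "subseq v w \<Longrightarrow> w \<in> lists A \<Longrightarrow> v \<in> lists A"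
  by (induction rule: list_emb.induct) auto

section \<open>Universal words and shortest prefixes\<close>

definition enum_list :: "'a set \<Rightarrow> 'a list" where
  "enum_list A = (SOME l. set l = A)"

lemma set_enum_list [simp]: "finite A \<Longrightarrow> set (enum_list A) = A"
  unfolding enum_list_def by (rule someI_ex) (rule finite_list)

text \<open>A universal word: each of the \<open>k\<close> passes through the alphabet can supply
  any one letter.\<close>

definition upow :: "'a set \<Rightarrow> nat \<Rightarrow> 'a list" where
  "upow A k = concat (replicate k (enum_list A))"

lemma upow_0 [simp]: "upow A 0 = []"
  by (simp add: upow_def)

lemma upow_Suc: "upow A (Suc k) = enum_list A @ upow A k"
  by (simp add: upow_def)

lemma upow_add: "upow A (j + k) = upow A j @ upow A k"
  by (simp add: upow_def replicate_add)

lemma upow_in_lists: "finite A \<Longrightarrow> upow A k \<in> lists A"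
  by (induction k) (simp_all add: upow_Suc set_enum_list lists_eq_set)

lemma length_upow: "finite A \<Longrightarrow> A \<noteq> {} \<Longrightarrow> k \<le> length (upow A k)"
proof (induction k)
  case (Suc k)
  have "enum_list A \<noteq> []" using set_enum_list[OF Suc.prems(1)] Suc.prems(2) by (metis set_empty)
  then have "1 \<le> length (enum_list A)" by (simp add: Suc_leI)
  then show ?case using Suc by (simp add: upow_Suc)
qed simp

lemma subseq_upow:
  assumes "finite A" "w \<in> lists A" "length w \<le> k"
  shows "subseq w (upow A k)"
  using assms(2,3)
proof (induction w arbitrary: k rule: list.induct)
  case (Cons x w)
  then obtain j where k: "k = Suc j" by (cases k) auto
  have "subseq [x] (enum_list A)" 
    using assms(1) Cons.prems(1) unfolding subseq_singleton_left by auto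
  moreover have "subseq w (upow A j)" using Cons k by auto
  ultimately have "subseq ([x] @ w) (enum_list A @ upow A j)" by (rule list_emb_append_mono)
  then show ?case unfolding k upow_Suc by simp
qed simp

lemma upow_mono: "j \<le> k \<Longrightarrow> subseq (upow A j) (upow A k)"
  using upow_add[of A j "k - j"] by (auto intro: prefix_imp_subseq)

text \<open>A word has at most one such prefix, which makes the factorisations used for counting
  unique.\<close>

definition min_prefix :: "('a list \<Rightarrow> bool) \<Rightarrow> 'a list \<Rightarrow> bool" where
  "min_prefix P p \<longleftrightarrow> P p \<and> (\<forall>q. strict_prefix q p \<longrightarrow> \<not> P q)"

lemma min_prefix_exists:
  assumes "P y"
  obtains p q where "y = p @ q" "min_prefix P p"
proof -
  define k where "k = (LEAST j. P (take j y))"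
  have k: "P (take k y)" unfolding k_def by (rule LeastI[of _ "length y"]) (simp add: assms)
  have "\<not> P q" if q: "strict_prefix q (take k y)" for q
  proof -
    have less: "length q < length (take k y)" using q by (rule prefix_length_less)
    obtain t where t: "take k y = q @ t" using q unfolding strict_prefix_def prefix_def by blast
    have "length q < k" using less by simp
    have "y = q @ (t @ drop k y)" using t by (metis append_assoc append_take_drop_id)
    then have "q = take (length q) y" by (metis append_eq_conv_conj)
    then show ?thesis using not_less_Least[of "length q" "\<lambda>j. P (take j y)"]
      \<open>length q < k\<close> unfolding k_def by metis
  qed
  then have "min_prefix P (take k y)" unfolding min_prefix_def using k by blast
  then show ?thesis using that[of "take k y" "drop k y"] by simp
qed

lemma min_prefix_unique:
  assumes "min_prefix P p" "min_prefix P q" "p @ s = q @ t"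
  shows "p = q"
proof -
  have "prefix p q \<or> prefix q p" using assms(3) by (metis prefixI prefix_same_cases)
  then show ?thesis using assms(1,2) unfolding min_prefix_def by (auto simp: strict_prefix_def)
qed

text \<open>\<open>emb w p\<close> stands for: the sum of the letters of \<open>w\<close> is
  contained in the sum of the letters of \<open>p\<close>. \<open>emb_appendD\<close> expresses that
  a cut of the host never splits a letter of the pattern, as letters are indecomposable, and
  \<open>emb_same_wt\<close> is rigidity at equal size.\<close>

locale pattern_words = weighted_alphabet I sz for I :: "'a set" and sz +
  fixes W :: "'a list set" and emb :: "'a list \<Rightarrow> 'a list \<Rightarrow> bool" and one :: 'a
  assumes W_lists: "W \<subseteq> lists I"
    and W_closed: "p \<in> W \<Longrightarrow> w \<in> lists I \<Longrightarrow> emb w p \<Longrightarrow> w \<in> W"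
    and emb_trans: "emb u v \<Longrightarrow> emb v w \<Longrightarrow> emb u w"
    and emb_subseq: "subseq w p \<Longrightarrow> p \<in> lists I \<Longrightarrow> emb w p"
    and emb_append: "emb w p \<Longrightarrow> emb w' p' \<Longrightarrow> w \<in> lists I \<Longrightarrow> p \<in> lists I \<Longrightarrow>
      w' \<in> lists I \<Longrightarrow> p' \<in> lists I \<Longrightarrow> emb (w @ w') (p @ p')"
    and emb_appendD: "emb w (p @ p') \<Longrightarrow> w \<in> lists I \<Longrightarrow> p \<in> lists I \<Longrightarrow> p' \<in> lists I \<Longrightarrow>
      \<exists>w1 w2. w = w1 @ w2 \<and> emb w1 p \<and> emb w2 p'"
    and emb_wt: "emb w p \<Longrightarrow> w \<in> lists I \<Longrightarrow> p \<in> lists I \<Longrightarrow> wt w \<le> wt p"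
    and emb_same_wt: "emb w p \<Longrightarrow> w \<in> lists I \<Longrightarrow> p \<in> lists I \<Longrightarrow> wt w = wt p \<Longrightarrow> w = p"
    and one: "one \<in> I" "sz one = 1" and emb_one: "x \<in> I \<Longrightarrow> emb [one] [x]"
begin

lemma down_closed_W: "down_closed I W"
  unfolding down_closed_def
proof (intro conjI allI impI W_lists)
  fix w v assume "w \<in> W" "subseq v w"
  moreover from this have "v \<in> lists I" using W_lists subseq_in_lists by blast
  ultimately show "v \<in> W" using W_closed emb_subseq W_lists by blast
qed

definition basis_bound :: nat where
  "basis_bound = (SOME K. \<forall>w. w \<in> lists I \<longrightarrow> w \<notin> W \<longrightarrow> (\<exists>b. subseq b w \<and> b \<notin> W \<and> length b \<le> K))"

lemma basis:
  assumes "w \<in> lists I" "w \<notin> W"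
  obtains b where "subseq b w" "b \<notin> W" "length b \<le> basis_bound"
proof -
  have "\<exists>K. \<forall>w. w \<in> lists I \<longrightarrow> w \<notin> W \<longrightarrow> (\<exists>b. subseq b w \<and> b \<notin> W \<and> length b \<le> K)"
    using finite_basis[OF finite_I down_closed_W] by metis
  from someI_ex[OF this] show ?thesis using assms that unfolding basis_bound_def by blast
qed

definition max_sz :: nat where "max_sz = Max (sz ` I)"

lemma sz_le_max: "x \<in> I \<Longrightarrow> sz x \<le> max_sz"
  unfolding max_sz_def using finite_I by (intro Max_ge) auto

abbreviation K :: nat where "K \<equiv> basis_bound"

text \<open>One letter of a word may absorb up to \<open>max_sz\<close> letters of an embedded word; the margin still leaves
  \<open>K\<close> universal words on both sides of such a loss.\<close>

definition margin :: nat where "margin = K + max_sz + Suc (K + max_sz)"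

text \<open>\<open>l\<close> and \<open>r\<close> stand for the generic words of the blocks before
  and after \<open>A\<close>. Maximality of the number of blocks will exclude a foreign letter
  \<open>b\<close> between two runs of \<open>A\<close>; \<open>K\<close> repetitions suffice as
  witness because basis words have length at most \<open>K\<close>.\<close>

definition stable :: "'a set \<Rightarrow> 'a list \<Rightarrow> 'a list \<Rightarrow> bool" where
  "stable A l r \<longleftrightarrow> A \<subseteq> I \<and> A \<noteq> {} \<and> l \<in> lists I \<and> r \<in> lists I \<and>
     (\<forall>b\<in>I - A. l @ upow A K @ b # upow A K @ r \<notin> W)"

definition left_generic :: "'a set \<Rightarrow> 'a list \<Rightarrow> 'a list \<Rightarrow> bool" where
  "left_generic A l u \<longleftrightarrow> u \<in> lists I \<and> subseq (l @ upow A margin) u"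

definition right_generic :: "'a set \<Rightarrow> 'a list \<Rightarrow> 'a list \<Rightarrow> bool" where
  "right_generic A r v \<longleftrightarrow> v \<in> lists I \<and> subseq (upow A margin @ r) v"

lemma stableD:
  assumes "stable A l r"
  shows "A \<subseteq> I" "A \<noteq> {}" "finite A" "l \<in> lists I" "r \<in> lists I" "upow A k \<in> lists I" "upow A k \<in> lists A"
proof -
  show *: "A \<subseteq> I" "A \<noteq> {}" "l \<in> lists I" "r \<in> lists I" using assms unfolding stable_def by auto
  then show "finite A" using finite_I finite_subset by blast
  then show "upow A k \<in> lists A" by (rule upow_in_lists)
  then show "upow A k \<in> lists I" using lists_mono[OF *(1)] by blast
qed

text \<open>A letter of \<open>m\<close> outside \<open>A\<close>, together with the copies in
  \<open>L\<close> and \<open>R\<close>, would complete the word excluded by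
  \<open>stable\<close>.\<close>

lemma stable_middle:
  assumes st: "stable A l r" and "L @ m @ R \<in> W"
    and "emb (l @ upow A K) L" "emb (upow A K @ r) R"
  shows "m \<in> lists A"
proof (rule ccontr)
  assume "m \<notin> lists A"
  then obtain b where b: "b \<in> set m" "b \<notin> A" by auto
  have I: "L \<in> lists I" "m \<in> lists I" "R \<in> lists I" using assms(2) W_lists by auto
  then have bI: "b \<in> I" using b(1) by auto
  have "emb [b] m" using b(1) I(2) by (intro emb_subseq) (simp_all add: subseq_singleton_left)
  note st' = stableD[OF st]
  have bmR: "emb ([b] @ (upow A K @ r)) (m @ R)"
    by (rule emb_append) (use \<open>emb [b] m\<close> assms(4) bI I st' in auto)
  have "emb ((l @ upow A K) @ ([b] @ (upow A K @ r))) (L @ m @ R)"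
    by (rule emb_append[OF assms(3) bmR]) (use bI I st' in auto)
  then have "l @ upow A K @ b # upow A K @ r \<in> W"
    using W_closed[OF assms(2)] bI st' by simp
  then show False using st b(2) bI unfolding stable_def by blast
qed

lemma emb_refl: "w \<in> lists I \<Longrightarrow> emb w w"
  by (rule emb_subseq) simp_all

text \<open>Host letters are peeled off by \<open>emb_appendD\<close> until one, \<open>y\<close>,
  receives \<open>x\<close>. It may also receive a suffix \<open>u2\<close> of \<open>u\<close> and
  a prefix \<open>v1\<close> of \<open>v\<close>.\<close>

lemma emb_split_letter:
  assumes "emb (u @ x # v) p" "u \<in> lists I" "x \<in> I" "v \<in> lists I" "p \<in> lists I"
  shows "\<exists>s y t u1 u2 v1 v2. p = s @ y # t \<and> u = u1 @ u2 \<and> v = v1 @ v2 \<and>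
    emb u1 s \<and> emb v2 t \<and> emb (u2 @ x # v1) [y]"
  using assms
proof (induction p arbitrary: u)
  case Nil
  have "wt (u @ x # v) \<le> wt []" using Nil by (intro emb_wt) auto
  then show ?case using sz_pos[OF Nil.prems(3)] by simp
next
  case (Cons y p)
  have "emb (u @ x # v) ([y] @ p)" using Cons.prems(1) by simp
  then obtain w1 w2 where w: "u @ x # v = w1 @ w2" "emb w1 [y]" "emb w2 p"
    using emb_appendD[of "u @ x # v" "[y]" p] Cons.prems by auto
  show ?case
  proof (cases "length u < length w1")
    case True
    then obtain v1 where "w1 = u @ x # v1" "v = v1 @ w2"
      using w(1) by (auto simp: append_eq_append_conv2 Cons_eq_append_conv)
    moreover have "emb [] ([] :: 'a list)" by (rule emb_refl) simp
    ultimately show ?thesis using w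
      by (intro exI[of _ "[]"] exI[of _ y] exI[of _ p] exI[of _ "[]"] exI[of _ u] exI[of _ v1] exI[of _ w2]) simp
  next
    case False
    then obtain u' where u': "u = w1 @ u'" "w2 = u' @ x # v"
      using w(1) by (auto simp: append_eq_append_conv2 append_eq_Cons_conv)
    obtain s z t u1 u2 v1 v2 where IH: "p = s @ z # t" "u' = u1 @ u2" "v = v1 @ v2"
        "emb u1 s" "emb v2 t" "emb (u2 @ x # v1) [z]"
      using Cons.IH[of u'] w(3) u' Cons.prems by auto
    have "emb (w1 @ u1) ([y] @ s)" by (rule emb_append) (use w(2) IH Cons.prems u' in auto)
    then show ?thesis using IH u'
      by (intro exI[of _ "y # s"] exI[of _ z] exI[of _ t] exI[of _ "w1 @ u1"] exI[of _ u2]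
          exI[of _ v1] exI[of _ v2]) simp
  qed
qed

lemma emb_letter_length:
  assumes "emb (u @ x # v) [y]" "u \<in> lists I" "x \<in> I" "v \<in> lists I" "y \<in> I"
  shows "length u \<le> max_sz" "length v \<le> max_sz"
proof -
  have "wt (u @ x # v) \<le> wt [y]" using assms by (intro emb_wt) auto
  then show "length u \<le> max_sz" "length v \<le> max_sz"
    using sz_le_max[OF assms(5)] length_le_wt[of u] length_le_wt[of v] assms by auto
qed

lemma left_generic_drop:
  assumes st: "stable A l r" and "left_generic A l (u @ v)" "length v \<le> max_sz"
  shows "emb (l @ upow A K) u"
proof -
  have "margin = K + (max_sz + Suc (K + max_sz))" by (simp add: margin_def)
  then have "subseq ((l @ upow A K) @ upow A (max_sz + Suc (K + max_sz))) (u @ v)"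
    using assms(2) unfolding left_generic_def by (simp only: upow_add append_assoc)
  moreover have "length v \<le> length (upow A (max_sz + Suc (K + max_sz)))"
    using length_upow[OF stableD(3,2)[OF st], of "max_sz + Suc (K + max_sz)"] assms(3) by linarith
  ultimately have "subseq (l @ upow A K) u" by (rule subseq_append_drop_right)
  then show ?thesis using assms(2) by (intro emb_subseq) (auto simp: left_generic_def)
qed

lemma right_generic_drop:
  assumes st: "stable A l r" and "right_generic A r (v @ u)" "length v \<le> max_sz"
  shows "emb (upow A K @ r) u"
proof -
  have "margin = (max_sz + Suc (K + max_sz)) + K" by (simp add: margin_def)
  then have "subseq (upow A (max_sz + Suc (K + max_sz)) @ (upow A K @ r)) (v @ u)"
    using assms(2) unfolding right_generic_def by (simp only: upow_add append_assoc)
  moreover have "length v \<le> length (upow A (max_sz + Suc (K + max_sz)))"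
    using length_upow[OF stableD(3,2)[OF st], of "max_sz + Suc (K + max_sz)"] assms(3) by linarith
  ultimately have "subseq (upow A K @ r) u" by (rule subseq_append_drop_left)
  then show ?thesis using assms(2) by (intro emb_subseq) (auto simp: right_generic_def)
qed

lemma left_generic_emb: "stable A l r \<Longrightarrow> left_generic A l u \<Longrightarrow> emb (l @ upow A K) u"
  using left_generic_drop[of A l r u "[]"] by simp

lemma right_generic_emb: "stable A l r \<Longrightarrow> right_generic A r u \<Longrightarrow> emb (upow A K @ r) u"
  using right_generic_drop[of A l r "[]" u] by simp

text \<open>If the insertion led out of \<open>W\<close>, the new word would have a basis word of
  length at most \<open>K\<close> as a subword. The part of it that falls into \<open>z\<close> and
  the end of \<open>L\<close> is a word over \<open>A\<close> of length at most \<open>K\<close>, so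
  it fits into a copy of \<open>upow A K\<close> at the end of \<open>L\<close>, and the basis word
  would be contained in \<open>L @ R\<close> already.\<close>

lemma stable_insert:
  assumes st: "stable A l r" and W: "L @ R \<in> W" and u: "left_generic A l u" "emb u L"
    and R: "emb (upow A K @ r) R" and z: "z \<in> lists A"
  shows "L @ z @ R \<in> W"
proof (rule ccontr)
  assume notW: "L @ z @ R \<notin> W"
  note st' = stableD[OF st]
  have I: "L \<in> lists I" "R \<in> lists I" "z \<in> lists I" "u \<in> lists I"
    using W W_lists z lists_mono[OF st'(1)] u(1) by (auto simp: left_generic_def)
  obtain c cs where cs: "enum_list A = c # cs"
    using set_enum_list[OF st'(3)] st'(2) by (metis list.exhaust set_empty)
  have "set (c # cs) = A" using set_enum_list[OF st'(3)] unfolding cs .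
  then have cA: "c \<in> A" "cs \<in> lists A" by auto
  then have cI: "c \<in> I" "cs \<in> lists I" using st'(1) by auto
  \<comment> \<open>The \<open>Suc\<close> in \<open>margin\<close> provides a middle letter
    \<open>c\<close> at which the copy in \<open>L\<close> is cut. The \<open>max_sz\<close>
    repetitions on each side make up for neighbours that fall into the same host letter as
    \<open>c\<close>.\<close>
  have m: "upow A margin = upow A (K + max_sz) @ c # cs @ upow A (K + max_sz)"
    unfolding margin_def upow_add[of A "K + max_sz" "Suc (K + max_sz)"] upow_Suc cs by simp
  let ?u = "l @ upow A (K + max_sz)" and ?v = "cs @ upow A (K + max_sz)"
  have "emb (?u @ c # ?v) L"
    using u unfolding left_generic_def m by (auto intro: emb_trans emb_subseq)
  then obtain s y t u1 u2 v1 v2 where sp: "L = s @ y # t" "?u = u1 @ u2" "?v = v1 @ v2"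
      "emb u1 s" "emb v2 t" "emb (u2 @ c # v1) [y]"
    using emb_split_letter[OF _ _ cI(1) _ I(1), of ?u ?v] cI(2) st'(4,6) by (metis append_in_lists_conv)
  have I': "s \<in> lists I" "y \<in> I" "t \<in> lists I" using I(1) sp(1) by auto
  have "u1 @ u2 \<in> lists I" "v1 @ v2 \<in> lists I" using cI st' unfolding sp(2,3)[symmetric] by auto
  then have uv: "u1 \<in> lists I" "u2 \<in> lists I" "v1 \<in> lists I" "v2 \<in> lists I" by auto
  have len: "length u2 \<le> max_sz" "length v1 \<le> max_sz"
    using emb_letter_length[OF sp(6) uv(2) cI(1) uv(3) I'(2)] by auto
  have lenU: "max_sz \<le> length (upow A max_sz)" by (rule length_upow[OF st'(3,2)])
  have "subseq ((l @ upow A K) @ upow A max_sz) (u1 @ u2)"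
    unfolding sp(2)[symmetric] by (simp add: upow_add)
  then have "subseq (l @ upow A K) u1" by (rule subseq_append_drop_right) (use len lenU in linarith)
  then have s: "emb (l @ upow A K) s" using sp(4) emb_trans emb_subseq uv(1) by blast
  have "K + max_sz = max_sz + K" by simp
  then have "subseq (upow A max_sz @ upow A K) (v1 @ v2)"
    unfolding sp(3)[symmetric] by (metis upow_add subseq_drop_many subseq_order.refl)
  then have "subseq (upow A K) v2" by (rule subseq_append_drop_left) (use len lenU in linarith)
  then have t: "emb (upow A K) t" using sp(5) emb_trans emb_subseq uv(4) by blast
  have "s @ (y # t) @ R \<in> W" using W sp(1) by simp
  then have yt: "y # t \<in> lists A" using stable_middle[OF st _ s R] by blast
  obtain b where b: "subseq b (L @ z @ R)" "b \<notin> W" "length b \<le> K"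
    using basis[OF _ notW] I by auto
  have "subseq b (s @ (y # t @ z) @ R)" using b(1) unfolding sp(1) by simp
  then obtain b1 b' where b1: "b = b1 @ b'" "subseq b1 s" "subseq b' ((y # t @ z) @ R)"
    by (rule subseq_appendE)
  obtain b2 b3 where b2: "b' = b2 @ b3" "subseq b2 (y # t @ z)" "subseq b3 R"
    using b1(3) by (rule subseq_appendE)
  have b2A: "b2 \<in> lists A" using subseq_in_lists[OF b2(2)] yt z by simp
  moreover have "length b2 \<le> K" using b(3) b1(1) b2(1) by simp
  ultimately have "subseq b2 (upow A K)" by (intro subseq_upow st'(3))
  then have b2t: "emb b2 t" using emb_trans[OF _ t] emb_subseq st'(6) by blast
  have b13: "b1 \<in> lists I" "b3 \<in> lists I" using subseq_in_lists[OF b1(2) I'(1)] subseq_in_lists[OF b2(3) I(2)] by auto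
  have b2I: "b2 \<in> lists I" using b2A lists_mono[OF st'(1)] by blast
  have b23: "emb (b2 @ b3) (t @ R)"
    by (rule emb_append) (use b2t b13 b2I emb_subseq[OF b2(3) I(2)] I I' in auto)
  have "emb (b1 @ (b2 @ b3)) (s @ (t @ R))"
    by (rule emb_append[OF emb_subseq[OF b1(2) I'(1)] b23]) (use I I' b13 b2I in auto)
  moreover have "emb (s @ (t @ R)) (L @ R)"
    unfolding sp(1) using I I' by (intro emb_subseq) (auto intro: list_emb_append_mono)
  ultimately have "b \<in> W" using emb_trans W_closed[OF W] b13 b2I b1(1) b2(1) by auto
  then show False using b(2) by simp
qed

text \<open>The letter \<open>y\<close> receiving \<open>x\<close> lies in \<open>A\<close> by
  stability, so it is not larger than \<open>x\<close>; hence nothing else fits into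
  \<open>y\<close>, and rigidity gives \<open>y = x\<close>. The prefix \<open>L\<close> allows a
  left context outside \<open>u\<close>, as needed for the second \<open>x\<close> of the gap
  formula.\<close>

lemma stable_split_letter:
  assumes st: "stable A l r" and x: "x \<in> A" "\<And>y. y \<in> A \<Longrightarrow> sz y \<le> sz x"
    and W: "L @ w \<in> W" and e: "emb (u @ x # v) w" and u: "u \<in> lists I" and v: "right_generic A r v"
    and L: "\<And>u1 u2. u = u1 @ u2 \<Longrightarrow> length u2 \<le> max_sz \<Longrightarrow> emb (l @ upow A K) (L @ u1)"
  shows "\<exists>s t. w = s @ x # t \<and> emb u s \<and> emb v t"
proof -
  note st' = stableD[OF st]
  have vI: "v \<in> lists I" and wI: "w \<in> lists I" "L \<in> lists I" and xI: "x \<in> I"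
    using v W W_lists x(1) st'(1) by (auto simp: right_generic_def)
  obtain s y t u1 u2 v1 v2 where sp: "w = s @ y # t" "u = u1 @ u2" "v = v1 @ v2"
      "emb u1 s" "emb v2 t" "emb (u2 @ x # v1) [y]"
    using emb_split_letter[OF e u xI vI wI(1)] by blast
  have I: "s \<in> lists I" "y \<in> I" "t \<in> lists I" "u1 \<in> lists I" "u2 \<in> lists I" "v1 \<in> lists I" "v2 \<in> lists I"
    using wI vI u sp(1,2,3) by auto
  have len: "length u2 \<le> max_sz" "length v1 \<le> max_sz"
    using emb_letter_length[OF sp(6) I(5) xI I(6) I(2)] by auto
  have "emb (L @ u1) (L @ s)" by (rule emb_append) (use emb_refl sp(4) wI I in auto)
  then have 1: "emb (l @ upow A K) (L @ s)" using L[OF sp(2) len(1)] emb_trans by blast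
  have 2: "emb (upow A K @ r) t"
    using right_generic_drop[OF st _ len(2), of v2] v sp(3,5) emb_trans by auto
  have "(L @ s) @ [y] @ t \<in> W" using W sp(1) by simp
  from stable_middle[OF st this 1 2] have "y \<in> A" by simp
  then have "sz y \<le> sz x" by (rule x(2))
  have le: "wt (u2 @ x # v1) \<le> wt [y]" by (rule emb_wt[OF sp(6)]) (use I xI in auto)
  then have eq: "wt (u2 @ x # v1) = wt [y]" using \<open>sz y \<le> sz x\<close> by simp
  have "u2 @ x # v1 = [y]" by (rule emb_same_wt[OF sp(6) _ _ eq]) (use I xI in auto)
  then have "u2 = []" "v1 = []" "x = y" by (auto simp: append_eq_Cons_conv)
  then show ?thesis using sp by auto
qed

section \<open>The gap formula\<close>

definition min_words :: "'a set \<Rightarrow> 'a list \<Rightarrow> 'a list set" where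
  "min_words A g = {p \<in> lists A. min_prefix (emb g) p}"

definition containing :: "'a list \<Rightarrow> 'a list set" where
  "containing a = {p \<in> W. emb a p}"

definition gf :: "'a list set \<Rightarrow> real fps" where
  "gf E = Abs_fps (\<lambda>n. real (cnt E n))"

text \<open>Meant for a word \<open>L @ x # s\<close>: the cut falls at the first letter
  \<open>x\<close> that has a copy of \<open>u\<close> before it.\<close>

definition first_at :: "'a \<Rightarrow> 'a list \<Rightarrow> 'a list \<Rightarrow> bool" where
  "first_at x u L \<longleftrightarrow> emb u L \<and> (\<forall>j < length L. \<not> (L ! j = x \<and> emb u (take j L)))"

text \<open>The appended \<open>x\<close> guarantees a cut; in the applications it is the letter
  \<open>x\<close> known to follow \<open>w\<close>.\<close>

lemma first_at_exists:
  assumes "emb u w"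
  obtains L z where "first_at x u L" "w @ [x] = L @ x # z"
proof -
  let ?P = "\<lambda>j. j \<le> length w \<and> (w @ [x]) ! j = x \<and> emb u (take j w)"
  define k where "k = (LEAST j. ?P j)"
  have "?P (length w)" using assms by simp
  then have k: "?P k" unfolding k_def by (rule LeastI)
  have "\<not> (take k w ! j = x \<and> emb u (take j (take k w)))" if "j < length (take k w)" for j
  proof -
    have j: "j < k" "j < length w" using that k by auto
    then have "\<not> ?P j" unfolding k_def by (intro not_less_Least)
    then show ?thesis using j by (simp add: nth_append min_def)
  qed
  then have "first_at x u (take k w)" unfolding first_at_def using k by blast
  moreover have "w @ [x] = take k w @ x # drop (Suc k) (w @ [x])"
    using k id_take_nth_drop[of k "w @ [x]"] by simp
  ultimately show ?thesis using that by blast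
qed

lemma first_at_unique:
  assumes "first_at x u L" "first_at x u L'" "L @ x # s = L' @ x # s'"
  shows "L = L' \<and> s = s'"
proof -
  have *: "\<not> length M < length M'" if "first_at x u M" "first_at x u M'" "M @ x # t = M' @ x # t'"
    for M M' t t'
  proof
    assume less: "length M < length M'"
    then have "M = take (length M) M'" "M' ! length M = x"
      using that(3) by (auto simp: append_eq_append_conv2 nth_append Cons_eq_append_conv)
    then show False using that(1,2) less unfolding first_at_def by metis
  qed
  have "length L = length L'" using *[OF assms] *[OF assms(2,1) assms(3)[symmetric]] by linarith
  then show ?thesis using assms(3) by simp
qed

text \<open>Cut a word containing \<open>u x x v\<close> after the first letter \<open>x\<close> that completes a copy of \<open>u\<close>, and insert a
  minimal word containing \<open>g\<close> there; every word containing \<open>u x g x v\<close> arises exactly once.\<close>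

theorem gap_factor:
  assumes st: "stable A l r" and x: "x \<in> A" "\<And>y. y \<in> A \<Longrightarrow> sz y \<le> sz x"
    and u: "left_generic A l u" and v: "right_generic A r v" and g: "g \<in> lists A"
  shows "gf (containing (u @ x # g @ x # v)) = gf (min_words A g) * gf (containing (u @ x # x # v))"
proof -
  note st' = stableD[OF st]
  have I: "u \<in> lists I" "v \<in> lists I" "x \<in> I" "g \<in> lists I" and IA: "lists A \<subseteq> lists I"
    using u v x(1) g st'(1) lists_mono[OF st'(1)] by (auto simp: left_generic_def right_generic_def)
  have M: "min_words A g \<subseteq> lists I" using IA by (auto simp: min_words_def)
  let ?big = "containing (u @ x # g @ x # v)" and ?small = "containing (u @ x # x # v)"
  have S: "?small \<subseteq> lists I" using W_lists by (auto simp: containing_def)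
  have rg: "right_generic A r (x # v)" "right_generic A r (g @ x # v)"
    using v I by (auto simp: right_generic_def intro: subseq_drop_many)
  have lg: "emb (l @ upow A K) u1" if "u = u1 @ u2" "length u2 \<le> max_sz" for u1 u2
    using left_generic_drop[OF st _ that(2)] u that(1) by blast
  have split1: "\<exists>w1 w2. p = w1 @ x # w2 \<and> emb u w1 \<and> emb v' w2"
    if "p \<in> W" "emb (u @ x # v') p" "right_generic A r v'" for p v'
    using stable_split_letter[OF st x, of "[]" p u v'] that I lg by simp
  have "cnt ?big n = (\<Sum>j\<le>n. cnt (min_words A g) j * cnt ?small (n - j))" for n
  proof -
    \<comment> \<open>The same triples parametrise both sides: \<open>L @ x # s\<close> contains
      \<open>u @ x # x # v\<close>, and \<open>L @ x # p @ s\<close> contains the pattern with the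
      gap \<open>g\<close>.\<close>
    define T where "T = {(p, L, s). p \<in> min_words A g \<and> first_at x u L \<and> L @ x # s \<in> ?small
      \<and> wt p + wt (L @ x # s) = n}"
    have b1: "bij_betw (\<lambda>(p, L, s). (p, L @ x # s)) T
      (\<Union>j\<in>{..n}. {p \<in> min_words A g. wt p = j} \<times> {q \<in> ?small. wt q = n - j})"
    proof (rule bij_betw_imageI)
      show "inj_on (\<lambda>(p, L, s). (p, L @ x # s)) T"
      proof (rule inj_onI)
        fix a b assume "a \<in> T" "b \<in> T" and eq: "(\<lambda>(p, L, s). (p, L @ x # s)) a = (\<lambda>(p, L, s). (p, L @ x # s)) b"
        moreover obtain p L s p' L' s' where ab: "a = (p, L, s)" "b = (p', L', s')" by (metis prod_cases3)
        ultimately have h: "first_at x u L" "first_at x u L'" "L @ x # s = L' @ x # s'" and "p = p'"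
          unfolding T_def by auto
        then show "a = b" using first_at_unique[OF h] ab by simp
      qed
      show "(\<lambda>(p, L, s). (p, L @ x # s)) ` T
        = (\<Union>j\<in>{..n}. {p \<in> min_words A g. wt p = j} \<times> {q \<in> ?small. wt q = n - j})" (is "?f ` T = ?B")
      proof (intro equalityI subsetI)
        fix pq assume "pq \<in> ?f ` T"
        then show "pq \<in> ?B" unfolding T_def by auto
      next
        fix pq assume "pq \<in> ?B"
        then obtain p q where pq: "pq = (p, q)" "p \<in> min_words A g" "q \<in> ?small" "wt p + wt q = n" by auto
        then obtain w1 w2 where w: "q = w1 @ x # w2" "emb u w1"
          using split1[of q "x # v"] rg unfolding containing_def by blast
        then obtain L z where L: "first_at x u L" "w1 @ [x] = L @ x # z" using first_at_exists by metis
        have "q = (w1 @ [x]) @ w2" using w(1) by simp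
        then have q: "q = L @ x # (z @ w2)" unfolding L(2) by simp
        then have "(p, L, z @ w2) \<in> T" using pq L(1) unfolding T_def by simp
        then show "pq \<in> ?f ` T" using pq(1) q by (intro image_eqI[of _ _ "(p, L, z @ w2)"]) auto
      qed
    qed
    have b2: "bij_betw (\<lambda>(p, L, s). L @ x # p @ s) T {q \<in> ?big. wt q = n}"
    proof (rule bij_betw_imageI)
      show "inj_on (\<lambda>(p, L, s). L @ x # p @ s) T"
      proof (rule inj_onI)
        fix a b assume "a \<in> T" "b \<in> T" and eq: "(\<lambda>(p, L, s). L @ x # p @ s) a = (\<lambda>(p, L, s). L @ x # p @ s) b"
        moreover obtain p L s p' L' s' where ab: "a = (p, L, s)" "b = (p', L', s')" by (metis prod_cases3)
        ultimately have h: "p \<in> min_words A g" "p' \<in> min_words A g" "first_at x u L" "first_at x u L'"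
          "L @ x # p @ s = L' @ x # p' @ s'" unfolding T_def by auto
        from first_at_unique[OF h(3-5)] have "L = L'" "p @ s = p' @ s'" by auto
        then show "a = b" using min_prefix_unique[of "emb g" p p'] h(1,2) ab by (auto simp: min_words_def)
      qed
      show "(\<lambda>(p, L, s). L @ x # p @ s) ` T = {q \<in> ?big. wt q = n}" (is "?f ` T = ?B")
      proof (intro equalityI subsetI)
        fix q assume "q \<in> ?f ` T"
        then obtain p L s where q: "q = L @ x # p @ s" and p: "p \<in> min_words A g" and L: "first_at x u L"
          and Ls: "L @ x # s \<in> W" "emb (u @ x # x # v) (L @ x # s)" and wt: "wt p + wt (L @ x # s) = n"
          unfolding T_def containing_def by auto
        obtain w1 w2 where w: "L @ x # s = w1 @ x # w2" "emb u w1" "emb (x # v) w2"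
          using split1[OF Ls rg(1)] by blast
        obtain L' z where L': "first_at x u L'" "w1 @ [x] = L' @ x # z" using first_at_exists[OF w(2)] by metis
        have "L @ x # s = (w1 @ [x]) @ w2" using w(1) by simp
        then have "L @ x # s = L' @ x # (z @ w2)" unfolding L'(2) by simp
        \<comment> \<open>The first cut in front of the matched \<open>x\<close> is \<open>L\<close>
          by uniqueness, so \<open>s\<close> ends with \<open>w2\<close> and contains
          \<open>x # v\<close>.\<close>
        then have s: "s = z @ w2" using first_at_unique[OF L L'(1)] by blast
        have LI: "L \<in> lists I" "s \<in> lists I" "w2 \<in> lists I" "p \<in> lists I"
          using Ls(1) W_lists s M p by auto
        have es: "emb (x # v) s" using w(3) emb_subseq[of w2 s] s LI emb_trans by (meson subseq_drop_many subseq_order.refl)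
        have uL: "emb u L" using L by (simp add: first_at_def)
        have uLx: "emb u (L @ [x])" using emb_trans[OF uL emb_subseq[of L "L @ [x]"]] LI I by auto
        have "(L @ [x]) @ p @ s \<in> W"
        proof (rule stable_insert[OF st _ u uLx])
          show "(L @ [x]) @ s \<in> W" using Ls(1) by simp
          show "emb (upow A K @ r) s" using right_generic_emb[OF st rg(1)] es emb_trans by blast
          show "p \<in> lists A" using p by (simp add: min_words_def)
        qed
        moreover have "emb (u @ [x] @ g @ (x # v)) (L @ [x] @ p @ s)"
          using emb_append[OF uL emb_append[OF emb_refl emb_append[OF _ es]], of "[x]" g p] p I LI
          by (simp add: min_words_def min_prefix_def)
        ultimately show "q \<in> ?B" using wt unfolding q containing_def by simp
      next
        fix q assume "q \<in> ?B"
        then have q: "q \<in> W" "emb (u @ x # g @ x # v) q" "wt q = n" by (auto simp: containing_def)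
        obtain w1 w2 where w: "q = w1 @ x # w2" "emb u w1" "emb (g @ x # v) w2"
          using split1[OF q(1,2) rg(2)] by blast
        have w1I: "w1 \<in> lists I" "w2 \<in> lists I" using q(1) W_lists w(1) by auto
        \<comment> \<open>The second \<open>x\<close> is matched rigidly as well, now with
          \<open>w1 @ [x]\<close> as left context.\<close>
        have "\<exists>s t. w2 = s @ x # t \<and> emb g s \<and> emb v t"
        proof (rule stable_split_letter[OF st x _ w(3) I(4) v])
          show "(w1 @ [x]) @ w2 \<in> W" using q(1) w(1) by simp
          show "emb (l @ upow A K) ((w1 @ [x]) @ g1)" if "g = g1 @ g2" for g1 g2
          proof -
            have "emb w1 ((w1 @ [x]) @ g1)" using w1I I that by (intro emb_subseq) (auto intro: subseq_rev_drop_many)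
            then show ?thesis using left_generic_emb[OF st u] w(2) emb_trans by blast
          qed
        qed
        then obtain s t where s: "w2 = s @ x # t" "emb g s" "emb v t" by blast
        obtain L z where L: "first_at x u L" "w1 @ [x] = L @ x # z" using first_at_exists[OF w(2)] by metis
        have "q = (w1 @ [x]) @ w2" using w(1) by simp
        then have qL: "q = L @ x # z @ s @ x # t" unfolding L(2) s(1) by simp
        have LI: "L \<in> lists I" "z \<in> lists I" "s \<in> lists I" "t \<in> lists I" using q(1) W_lists qL by auto
        have uL: "emb u L" using L by (simp add: first_at_def)
        have ext: "emb (x # v) (x # t)" using emb_append[OF emb_refl[of "[x]"] s(3)] I LI by simp
        have "(L @ [x]) @ (z @ s) @ (x # t) \<in> W" using q(1) qL by simp
        \<comment> \<open>Everything between the first cut and the second matched \<open>x\<close>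
          is over \<open>A\<close>, so its shortest prefix containing \<open>g\<close> belongs to
          \<open>min_words A g\<close>.\<close>
        then have zsA: "z @ s \<in> lists A"
        proof (rule stable_middle[OF st])
          have "emb u (L @ [x])" using emb_trans[OF uL emb_subseq[of L "L @ [x]"]] LI I by auto
          then show "emb (l @ upow A K) (L @ [x])" using left_generic_emb[OF st u] emb_trans by blast
          show "emb (upow A K @ r) (x # t)" using right_generic_emb[OF st rg(1)] ext emb_trans by blast
        qed
        have "emb s (z @ s)" using LI by (intro emb_subseq) (auto intro: subseq_drop_many)
        then have "emb g (z @ s)" using s(2) emb_trans by blast
        then obtain p p' where p: "z @ s = p @ p'" "min_prefix (emb g) p"
          using min_prefix_exists[of "emb g"] by metis
        then have pM: "p \<in> min_words A g" using zsA unfolding min_words_def by (metis (mono_tags) append_in_lists_conv mem_Collect_eq)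
        have p'I: "p \<in> lists I" "p' \<in> lists I" using LI p(1) by (metis append_in_lists_conv)+
        have q': "q = L @ x # p @ p' @ x # t" unfolding qL using p(1) by (metis append_assoc)
        have "subseq (L @ x # p' @ x # t) q"
          unfolding q' by (simp add: subseq_append' subseq_drop_many)
        then have "L @ x # p' @ x # t \<in> W"
          using down_closed_W q(1) unfolding down_closed_def by blast
        moreover have "emb (u @ [x] @ (x # v)) (L @ [x] @ (p' @ x # t))"
        proof (rule emb_append[OF uL emb_append[OF emb_refl]])
          have "emb (x # t) (p' @ x # t)" using p'I LI I by (intro emb_subseq) (auto intro: subseq_drop_many)
          then show "emb (x # v) (p' @ x # t)" using ext emb_trans by blast
        qed (use I LI p'I in auto)
        ultimately have "(p, L, p' @ x # t) \<in> T"
          unfolding T_def containing_def using L(1) pM q(3) q' by simp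
        then show "q \<in> ?f ` T" using q' by (intro image_eqI[of _ _ "(p, L, p' @ x # t)"]) auto
      qed
    qed
    show ?thesis
      using bij_betw_same_card[OF b1] bij_betw_same_card[OF b2] card_conc_pairs(2)[OF M S, of n]
      unfolding cnt_def[of ?big] by simp
  qed
  then show ?thesis by (intro fps_ext) (simp add: gf_def fps_mult_nth atLeast0AtMost)
qed

end

section \<open>Generic words\<close>

text \<open>Every gap is closed by an \<open>x\<close>; the \<open>x\<close> that opens the first
  gap stays outside.\<close>

definition gaps :: "'a \<Rightarrow> 'a list list \<Rightarrow> 'a list" where
  "gaps x hs = concat (map (\<lambda>h. h @ [x]) hs)"

lemma gaps_simps [simp]: "gaps x [] = []" "gaps x (h # hs) = h @ x # gaps x hs"
  by (simp_all add: gaps_def)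

lemma first_occurrence_unique:
  assumes "u @ x # v = u' @ x # v'" "x \<notin> set u" "x \<notin> set u'"
  shows "u = u' \<and> v = v'"
proof -
  have tw: "takeWhile (\<lambda>a. a \<noteq> x) (w @ x # y) = w" if "x \<notin> set w" for w y
    using that by (subst takeWhile_append2) auto
  have "u = u'" using tw[OF assms(2), of v] tw[OF assms(3), of v'] assms(1) by simp
  then show ?thesis using assms(1) by simp
qed

lemma gaps_unique:
  assumes "gaps x hs @ v = gaps x hs' @ v'" "length hs = length hs'"
    "\<And>h. h \<in> set hs \<Longrightarrow> x \<notin> set h" "\<And>h. h \<in> set hs' \<Longrightarrow> x \<notin> set h"
  shows "hs = hs' \<and> v = v'"
  using assms(2,1,3,4)
proof (induction hs hs' rule: list_induct2)
  case (Cons h hs h' hs')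
  have "h @ x # (gaps x hs @ v) = h' @ x # (gaps x hs' @ v')" using Cons.prems(1) by simp
  then have "h = h' \<and> gaps x hs @ v = gaps x hs' @ v'"
    by (rule first_occurrence_unique) (use Cons.prems in auto)
  then show ?case using Cons by simp
qed simp

text \<open>Leftmost matching: each \<open>x\<close> is taken at its next occurrence, which leaves
  the gaps free of \<open>x\<close>.\<close>

lemma subseq_gaps:
  assumes "subseq (replicate m x @ c) w"
  obtains hs v where "w = gaps x hs @ v" "length hs = m" "\<And>h. h \<in> set hs \<Longrightarrow> x \<notin> set h" "subseq c v"
  using assms
proof (induction m arbitrary: w thesis)
  case 0
  then show ?case by (metis append_Nil gaps_simps(1) list.size(3) empty_iff empty_set replicate_0)
next
  case (Suc m)
  have sub: "subseq (x # (replicate m x @ c)) w" using Suc.prems(2) by simp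
  then have "subseq [x] w" by (meson list_emb_Nil subseq_Cons2 subseq_order.trans)
  then have "x \<in> set w" by (simp add: subseq_singleton_left)
  then obtain h w' where h: "w = h @ x # w'" "x \<notin> set h" by (metis split_list_first)
  obtain a b where ab: "x # (replicate m x @ c) = a @ b" "subseq a h" "subseq b (x # w')"
    using sub unfolding h(1) by (rule subseq_appendE)
  have "a = []"
  proof (rule ccontr)
    assume "a \<noteq> []"
    then obtain a' where "a = x # a'" using ab(1) by (cases a) auto
    then have "subseq [x] h" using ab(2) by (meson list_emb_Nil subseq_Cons2 subseq_order.trans)
    then show False using h(2) by (simp add: subseq_singleton_left)
  qed
  then have "subseq (replicate m x @ c) w'" using ab by (metis append_Nil subseq_Cons2_iff)
  then obtain hs v where "w' = gaps x hs @ v" "length hs = m" "\<And>h. h \<in> set hs \<Longrightarrow> x \<notin> set h" "subseq c v"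
    using Suc.IH by metis
  then show ?case using Suc.prems(1)[of "h # hs" v] h by auto
qed

text \<open>A shortest prefix has no letter to spare after a copy of \<open>c\<close>, so all of
  \<open>d\<close> is matched behind it.\<close>

lemma min_prefix_subseq_rest:
  assumes "min_prefix (subseq c) p" "subseq (c @ d) (p @ w)"
  shows "subseq d w"
proof -
  obtain c1 c2 where c: "c @ d = c1 @ c2" "subseq c1 p" "subseq c2 w"
    using assms(2) by (rule subseq_appendE)
  show ?thesis
  proof (cases "length c1 \<le> length c")
    case True
    then obtain e where "c2 = e @ d" using c(1) by (auto simp: append_eq_append_conv2)
    then show ?thesis using c(3) by (metis subseq_drop_many subseq_order.refl subseq_order.trans)
  next
    case False
    then obtain e where e: "c1 = c @ e" "e \<noteq> []" using c(1) by (auto simp: append_eq_append_conv2)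
    obtain p1 p2 where p: "p = p1 @ p2" "subseq c p1" "subseq e p2"
      using list_emb_appendD[OF c(2)[unfolded e(1)]] by blast
    then have "p2 \<noteq> []" using e(2) by auto
    then have "strict_prefix p1 p" using p(1) by (simp add: strict_prefix_def)
    then show ?thesis using assms(1) p(2) unfolding min_prefix_def by blast
  qed
qed

text \<open>Induction by removing one element \<open>x\<close>, whose multiplicity is less than the
  size because not all elements are equal. If the rest is constant, \<open>x\<close> occurs once and
  can take every position.\<close>

lemma card_permutations_of_multiset_ge:
  assumes "\<And>a. M \<noteq> replicate_mset (size M) a"
  shows "size M \<le> card (permutations_of_multiset M)"
  using assms
proof (induction "size M" arbitrary: M)
  case (Suc n)
  have pos: "card (permutations_of_multiset N) \<ge> 1" for N :: "'a multiset"
    using permutations_of_multiset_not_empty[of N] by (simp add: Suc_leI card_gt_0_iff)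
  obtain x where x: "x \<in># M" using Suc.hyps(2) by (metis size_eq_Suc_imp_elem)
  have sz: "size (M - {#x#}) = n" using x Suc.hyps(2) by (simp add: size_Diff_singleton)
  show ?case
  proof (cases "\<exists>a. M - {#x#} = replicate_mset n a")
    case True
    then obtain a where a: "M - {#x#} = replicate_mset n a" by blast
    have M: "M = add_mset x (replicate_mset n a)" using x a by (metis insert_DiffM)
    have "x \<noteq> a"
    proof
      assume "x = a"
      then have "M = replicate_mset (size M) a" using M by simp
      then show False using Suc.prems by blast
    qed
    then have "count M x = 1" using M by (simp add: count_replicate_mset)
    then show ?thesis using card_permutations_of_multiset_remove_aux[OF x] pos[of "M - {#x#}"] by simp
  next
    case False
    then have IH: "n \<le> card (permutations_of_multiset (M - {#x#}))"
      using Suc.hyps(1)[of "M - {#x#}"] sz by simp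
    have "count M x \<le> n"
    proof (rule ccontr)
      assume "\<not> count M x \<le> n"
      then have "count M x = size M" using count_le_size[of M x] Suc.hyps(2) by simp
      then have "M = replicate_mset (size M) x"
        by (metis count_le_replicate_mset_subset_eq mset_subset_size order_refl
            size_replicate_mset subset_mset.le_imp_less_or_eq less_irrefl)
      then show False using Suc.prems by blast
    qed
    moreover have "n > 0"
    proof (rule ccontr)
      assume "\<not> n > 0"
      then show False using sz False by auto
    qed
    moreover have "card (permutations_of_multiset M) * count M x = size M * card (permutations_of_multiset (M - {#x#}))"
      by (rule card_permutations_of_multiset_remove_aux[OF x])
    ultimately have "size M * n \<le> card (permutations_of_multiset M) * n"
      using IH by (metis mult_le_mono2 order_trans)
    then show ?thesis using \<open>n > 0\<close> by simp
  qed
qed simp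

text \<open>Each alphabet has a root in (0, 1] of its mass equation by the intermediate value
  theorem. The least root serves all, because the masses increase with \<theta>.\<close>

lemma exists_critical_weight:
  fixes sz :: "'a \<Rightarrow> nat"
  assumes "finite F" "F \<noteq> {}" "\<And>A. A \<in> F \<Longrightarrow> finite A \<and> A \<noteq> {}"
    and "\<And>A x. A \<in> F \<Longrightarrow> x \<in> A \<Longrightarrow> 1 \<le> sz x"
  obtains \<theta> :: real where "0 < \<theta>" "\<theta> \<le> 1" "\<And>A. A \<in> F \<Longrightarrow> (\<Sum>x\<in>A. \<theta> ^ sz x) \<le> 1"
    "\<exists>A\<in>F. (\<Sum>x\<in>A. \<theta> ^ sz x) = 1"
proof -
  have "\<exists>t::real. 0 < t \<and> t \<le> 1 \<and> (\<Sum>x\<in>A. t ^ sz x) = 1" if A: "A \<in> F" for A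
  proof -
    let ?f = "\<lambda>t::real. \<Sum>x\<in>A. t ^ sz x"
    have "?f 0 = 0" using assms(4)[OF A] by (intro sum.neutral) (fastforce simp: power_0_left Suc_le_eq)
    moreover have "1 \<le> ?f 1" using assms(3)[OF A] by (simp add: Suc_leI card_gt_0_iff)
    moreover have "continuous_on {0..1} ?f" by (intro continuous_intros)
    ultimately obtain t where t: "0 \<le> t" "t \<le> 1" "?f t = 1"
      using IVT'[of ?f 0 1 1] by auto
    moreover have "t \<noteq> 0" using t(3) \<open>?f 0 = 0\<close> by auto
    ultimately show ?thesis by (intro exI[of _ t]) auto
  qed
  then obtain t where t: "\<And>A. A \<in> F \<Longrightarrow> 0 < t A \<and> t A \<le> 1 \<and> (\<Sum>x\<in>A. t A ^ sz x) = (1::real)" by metis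
  let ?\<theta> = "Min (t ` F)"
  have "?\<theta> \<in> t ` F" using assms(1,2) by (intro Min_in) auto
  then obtain A0 where A0: "A0 \<in> F" "?\<theta> = t A0" by auto
  have "(\<Sum>x\<in>A. ?\<theta> ^ sz x) \<le> 1" if "A \<in> F" for A
  proof -
    have "?\<theta> \<le> t A" using assms(1) that by (intro Min_le) auto
    moreover have "0 \<le> ?\<theta>" using t[OF A0(1)] A0(2) by simp
    ultimately have "(\<Sum>x\<in>A. ?\<theta> ^ sz x) \<le> (\<Sum>x\<in>A. t A ^ sz x)"
      by (intro sum_mono power_mono)
    then show ?thesis using t[OF that] by simp
  qed
  moreover have "0 < ?\<theta>" "?\<theta> \<le> 1" "\<exists>A\<in>F. (\<Sum>x\<in>A. ?\<theta> ^ sz x) = 1"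
    using t[OF A0(1)] A0 by auto
  ultimately show ?thesis using that by blast
qed

section \<open>Generic words of languages with the most blocks\<close>

fun genw :: "nat \<Rightarrow> ('a set \<times> 'a) list \<Rightarrow> 'a set \<Rightarrow> 'a list" where
  "genw N [] Z = upow Z N"
| "genw N ((A, b) # bs) Z = upow A N @ b # genw N bs Z"

text \<open>\<open>pre_word\<close> and \<open>tl_word\<close> are the surroundings of one block in
  a generic word; they become the contexts \<open>l\<close> and \<open>r\<close> of
  \<open>stable\<close>.\<close>

fun pre_word :: "nat \<Rightarrow> ('a set \<times> 'a) list \<Rightarrow> 'a list" where
  "pre_word N [] = []"
| "pre_word N ((A, b) # bs) = upow A N @ b # pre_word N bs"

fun hd_set :: "('a set \<times> 'a) list \<Rightarrow> 'a set \<Rightarrow> 'a set" where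
  "hd_set [] Z = Z"
| "hd_set ((A, b) # bs) Z = A"

fun tl_word :: "nat \<Rightarrow> ('a set \<times> 'a) list \<Rightarrow> 'a set \<Rightarrow> 'a list" where
  "tl_word N [] Z = []"
| "tl_word N ((A, b) # bs) Z = b # genw N bs Z"

lemma genw_hd_tl: "genw N bs Z = upow (hd_set bs Z) N @ tl_word N bs Z"
  by (cases bs) auto

lemma genw_append: "genw N (cs @ bs) Z = pre_word N cs @ genw N bs Z"
  by (induction N cs rule: pre_word.induct) auto

lemma genw_mono: "M \<le> N \<Longrightarrow> subseq (genw M bs Z) (genw N bs Z)"
  by (induction bs) (auto intro!: list_emb_append_mono upow_mono)

lemma tl_word_mono: "M \<le> N \<Longrightarrow> subseq (tl_word M bs Z) (tl_word N bs Z)"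
  by (cases bs) (auto intro: genw_mono)

text \<open>\<open>mass_le\<close> and \<open>ex_crit\<close> make 1/\<theta> the growth rate of
  \<open>W\<close>: no free monoid inside \<open>W\<close> exceeds it and one attains it.\<close>

locale pattern_growth = pattern_words I sz W emb one + weighted_growth I sz \<theta>
  for I :: "'a set" and sz W emb one \<theta> +
  assumes mass_le: "A \<subseteq> I \<Longrightarrow> lists A \<subseteq> W \<Longrightarrow> mass A \<le> 1"
    and ex_crit: "\<exists>A. crit A \<and> lists A \<subseteq> W"
    and unbounded: "\<not> bdd_above (range (cnt W))"
begin

text \<open>Replacing \<open>one\<close> by a letter of \<open>A\<close> embeds every word over
  \<open>insert one A\<close> into a word over \<open>A\<close>. So \<open>one\<close> could be
  added without leaving \<open>W\<close>, and the mass would become 1 + \<theta>.\<close>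

lemma crit_one:
  assumes "crit A" "lists A \<subseteq> W"
  shows "one \<in> A"
proof (rule ccontr)
  assume no: "one \<notin> A"
  have A: "A \<subseteq> I" "mass A = 1" using assms(1) by (auto simp: crit_def)
  then have "A \<noteq> {}" by (auto simp: mass_def)
  then obtain a where a: "a \<in> A" by blast
  have aI: "a \<in> I" using a A(1) by blast
  have repl: "v \<in> lists I \<and> map (\<lambda>y. if y = one then a else y) v \<in> lists I" if "v \<in> lists (insert one A)" for v
    using that aI one(1) A(1) by (induction v rule: list.induct) auto
  have "w \<in> W" if w: "w \<in> lists (insert one A)" for w
  proof -
    have "emb v (map (\<lambda>y. if y = one then a else y) v)" if "v \<in> lists (insert one A)" for v
      using that
    proof (induction v rule: list.induct)
      case (Cons y v)
      have "emb [y] [if y = one then a else y]"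
        using emb_one[of a] emb_refl[of "[y]"] a A(1) Cons.prems by auto
      then have "emb ([y] @ v) ([if y = one then a else y] @ map (\<lambda>y. if y = one then a else y) v)"
        by (rule emb_append) (use Cons repl[of v] repl[of "[y]"] in auto)
      then show ?case by simp
    qed (simp add: emb_refl)
    then have "emb w (map (\<lambda>y. if y = one then a else y) w)" using w by blast
    moreover have "map (\<lambda>y. if y = one then a else y) w \<in> lists A" using w a by auto
    ultimately show ?thesis using W_closed assms(2) repl[OF w] by blast
  qed
  then have "mass (insert one A) \<le> 1" using A(1) one by (intro mass_le) auto
  moreover have "finite A" using A(1) finite_I finite_subset by blast
  ultimately have "\<theta> ^ sz one + mass A \<le> 1" unfolding mass_def using no by simp
  then show False using A(2) one(2) \<theta>_pos by simp
qed

lemma lists_in_lang: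
  "A \<in> insert Z (fst ` set bs) \<Longrightarrow> w \<in> lists A \<Longrightarrow> \<exists>p \<in> lang bs Z. subseq w p"
proof (induction bs)
  case (Cons Ab bs)
  obtain A' b where Ab: "Ab = (A', b)" by fastforce
  show ?case
  proof (cases "A \<in> insert Z (fst ` set bs)")
    case True
    then obtain p where p: "p \<in> lang bs Z" "subseq w p" using Cons by blast
    then have "[] @ (b # p) \<in> lang (Ab # bs) Z" unfolding Ab lang.simps by (intro concI) auto
    moreover have "subseq w (b # p)" using p(2) by (rule list_emb_Cons)
    ultimately show ?thesis by auto
  next
    case False
    then have "w \<in> lists A'" using Cons.prems Ab by auto
    moreover obtain p where "p \<in> lang bs Z" using lang_nonempty by blast
    ultimately have "w @ (b # p) \<in> lang (Ab # bs) Z" unfolding Ab lang.simps by (intro concI) auto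
    then show ?thesis by (auto intro: subseq_rev_drop_many)
  qed
qed auto

lemma lists_subset_W:
  assumes "lang bs Z \<subseteq> W" "A \<in> insert Z (fst ` set bs)"
  shows "lists A \<subseteq> W"
proof
  fix w assume "w \<in> lists A"
  then show "w \<in> W" using lists_in_lang[OF assms(2)] assms(1) down_closed_W unfolding down_closed_def by blast
qed

lemma blocks_crit:
  assumes "blocks bs Z" "A \<in> insert Z (fst ` set bs)"
  shows "crit A"
  using assms by (auto simp: blocks_def)

lemma dens_W_ge:
  assumes "has_blocks (Suc k) W"
  obtains c n0 where "c > 0" "\<And>n. n \<ge> n0 \<Longrightarrow> dens W n \<ge> c * real (n + 1) ^ k"
proof -
  obtain bs Z where bs: "blocks bs Z" "length bs = k" "lang bs Z \<subseteq> W"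
    using assms unfolding has_blocks_def by auto
  have "one \<in> A" if "A \<in> insert Z (fst ` set bs)" for A
    using crit_one blocks_crit[OF bs(1) that] lists_subset_W[OF bs(3) that] by blast
  then obtain c n0 where c: "c > 0" "\<And>n. n \<ge> n0 \<Longrightarrow> dens (lang bs Z) n \<ge> c * real (n + 1) ^ k"
    using growth_lower[OF bs(1) _ one(2)] bs(2) by metis
  have "dens W n \<ge> c * real (n + 1) ^ k" if "n \<ge> n0" for n
    using c(2)[OF that] dens_mono[OF bs(3) W_lists, of n] by linarith
  then show ?thesis using that c(1) by blast
qed

text \<open>From here on \<open>k\<close> is the exponent: top languages have \<open>k\<close>
  separators and \<open>Suc k\<close> starred factors. A further factor would force a lower bound of
  order n^(k+1) against an upper bound of order n^k.\<close>

lemma block_number: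
  obtains k c C n0 where "has_blocks (Suc k) W" "\<not> has_blocks (Suc (Suc k)) W"
    "c > 0" "\<And>n. n \<ge> n0 \<Longrightarrow> dens W n \<ge> c * real (n + 1) ^ k"
    "C > 0" "\<And>n. dens W n \<le> C * real (n + 1) ^ k"
proof -
  obtain d where d: "has_blocks d W" "order_le d (dens W)"
    using growth_upper[OF mass_le down_closed_W] by blast
  have nd: "\<not> has_blocks (Suc d) W"
  proof
    assume "has_blocks (Suc d) W"
    then obtain c n0 where "c > 0" "\<And>n. n \<ge> n0 \<Longrightarrow> dens W n \<ge> c * real (n + 1) ^ d"
      using dens_W_ge by metis
    then have "d < d" by (rule order_le_conflict[OF d(2) dens_nonneg])
    then show False by simp
  qed
  obtain A where "crit A" "lists A \<subseteq> W" using ex_crit by blast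
  then have hb1: "has_blocks (Suc 0) W"
    unfolding has_blocks_def by (intro disjI2 exI[of _ "[]"] exI[of _ A]) simp
  have "d \<noteq> 0" using nd hb1 by metis
  then obtain k where k: "d = Suc k" by (cases d) auto
  obtain c n0 where "c > 0" "\<And>n. n \<ge> n0 \<Longrightarrow> dens W n \<ge> c * real (n + 1) ^ k"
    using dens_W_ge d(1) unfolding k by metis
  moreover obtain C where "C > 0" "\<And>n. dens W n \<le> C * real (n + 1) ^ k"
    using d(2) order_leE unfolding k by metis
  ultimately show ?thesis using that d(1) nd unfolding k by blast
qed

lemma lang_subseq_genw:
  assumes "blocks bs Z" "w \<in> lang bs Z" "subseq b w" "length b \<le> N"
  shows "subseq b (genw N bs Z)"
  using assms
proof (induction bs arbitrary: w b)
  case Nil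
  have "finite Z" using Nil.prems(1) finite_I finite_subset by (auto simp: crit_def)
  moreover have "b \<in> lists Z" using Nil.prems subseq_in_lists by auto
  ultimately show ?case using Nil.prems by (simp add: subseq_upow)
next
  case (Cons Ac bs)
  obtain A c where Ac: "Ac = (A, c)" by fastforce
  obtain u v where w: "w = u @ (c # v)" "u \<in> lists A" "v \<in> lang bs Z"
    using Cons.prems(2) unfolding Ac by (auto simp: conc_def)
  obtain b1 b2 where b: "b = b1 @ b2" "subseq b1 u" "subseq b2 (c # v)"
    using Cons.prems(3) unfolding w(1) by (rule subseq_appendE)
  have "finite A" using Cons.prems(1) finite_I finite_subset unfolding Ac by (auto simp: crit_def)
  moreover have "b1 \<in> lists A" using subseq_in_lists[OF b(2) w(2)] .
  ultimately have 1: "subseq b1 (upow A N)" using Cons.prems(4) b(1) by (intro subseq_upow) auto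
  have "subseq b2 ([c] @ v)" using b(3) by simp
  then obtain b3 b4 where b34: "b2 = b3 @ b4" "subseq b3 [c]" "subseq b4 v" by (rule subseq_appendE)
  have "subseq b4 (genw N bs Z)"
    using Cons.IH[OF _ w(3) b34(3)] Cons.prems(1,4) b(1) b34(1) unfolding Ac by simp
  then have "subseq (b1 @ (b3 @ b4)) (upow A N @ ([c] @ genw N bs Z))"
    using 1 b34(2) by (intro list_emb_append_mono)
  then show ?case unfolding Ac b(1) b34(1) by simp
qed

lemma genw_in_lang:
  assumes "blocks bs Z" shows "genw N bs Z \<in> lang bs Z"
  using assms
proof (induction bs)
  case Nil
  then have "finite Z" using finite_I finite_subset by (auto simp: crit_def)
  then show ?case using upow_in_lists[of Z N] by simp
next
  case (Cons Ac bs)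
  obtain A c where Ac: "Ac = (A, c)" by fastforce
  have "finite A" using Cons.prems finite_I finite_subset unfolding Ac by (auto simp: crit_def)
  then show ?case unfolding Ac genw.simps lang.simps
    using Cons upow_in_lists[of A N] Ac by (intro concI imageI) auto
qed

text \<open>One generic word decides for the whole language: a basis word has length at most
  \<open>K\<close>, so if it occurs in any member it occurs in \<open>genw K bs Z\<close>.\<close>

lemma genw_W:
  assumes "blocks bs Z" "genw K bs Z \<in> W"
  shows "lang bs Z \<subseteq> W"
proof
  fix w assume w: "w \<in> lang bs Z"
  show "w \<in> W"
  proof (rule ccontr)
    assume "w \<notin> W"
    moreover have "w \<in> lists I" using w lang_subset[OF assms(1)] by blast
    ultimately obtain b where b: "subseq b w" "b \<notin> W" "length b \<le> K" using basis by metis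
    have "subseq b (genw K bs Z)" by (rule lang_subseq_genw[OF assms(1) w b(1,3)])
    then have "b \<in> W" using assms(2) down_closed_W unfolding down_closed_def by blast
    then show False using b(2) by blast
  qed
qed

text \<open>A foreign letter \<open>b\<close> inside the block would split it into two blocks over
  the same alphabet with separator \<open>b\<close>, and by \<open>genw_W\<close> a language with
  one more factor would lie in \<open>W\<close>.\<close>

lemma stable_block:
  assumes "blocks (cs @ bs) Z" "lang (cs @ bs) Z \<subseteq> W" "\<not> has_blocks (Suc (Suc (length (cs @ bs)))) W"
  shows "stable (hd_set bs Z) (pre_word K cs) (tl_word K bs Z)"
proof -
  let ?A = "hd_set bs Z"
  have "genw K (cs @ bs) Z \<in> lists I"
    using genw_in_lang[OF assms(1)] lang_subset[OF assms(1)] by blast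
  then have "pre_word K cs @ upow ?A K @ tl_word K bs Z \<in> lists I"
    unfolding genw_append genw_hd_tl[of K bs Z] .
  then have words: "pre_word K cs \<in> lists I" "tl_word K bs Z \<in> lists I" by auto
  have "?A \<in> insert Z (fst ` set (cs @ bs))" by (cases bs) auto
  then have A: "crit ?A" using blocks_crit[OF assms(1)] by blast
  have "pre_word K cs @ upow ?A K @ b # upow ?A K @ tl_word K bs Z \<notin> W" if b: "b \<in> I - ?A" for b
  proof
    assume "pre_word K cs @ upow ?A K @ b # upow ?A K @ tl_word K bs Z \<in> W"
    then have "genw K (cs @ (?A, b) # bs) Z \<in> W" unfolding genw_append genw.simps genw_hd_tl[of K bs] by simp
    moreover have bl: "blocks (cs @ (?A, b) # bs) Z" using assms(1) A b by (auto simp: blocks_def)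
    ultimately have "lang (cs @ (?A, b) # bs) Z \<subseteq> W" by (intro genw_W)
    then have "has_blocks (Suc (Suc (length (cs @ bs)))) W"
      unfolding has_blocks_def using bl by (intro disjI2 exI[of _ "cs @ (?A, b) # bs"] exI[of _ Z]) simp
    then show False using assms(3) by blast
  qed
  moreover have "?A \<noteq> {}" using A by (auto simp: crit_def mass_def)
  ultimately show ?thesis unfolding stable_def using words A by (auto simp: crit_def)
qed

definition full_blocks :: "nat \<Rightarrow> (('a set \<times> 'a) list \<times> 'a set) set" where
  "full_blocks k = {(bs, Z). blocks bs Z \<and> length bs = k \<and> lang bs Z \<subseteq> W}"

lemma finite_full_blocks: "finite (full_blocks k)"
proof (rule finite_subset)
  show "full_blocks k \<subseteq> {bs. set bs \<subseteq> Pow I \<times> I \<and> length bs = k} \<times> Pow I"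
    unfolding full_blocks_def blocks_def crit_def by auto
  show "finite ({bs. set bs \<subseteq> Pow I \<times> I \<and> length bs = k} \<times> Pow I)"
    using finite_I by (intro finite_cartesian_product finite_lists_length_eq) auto
qed

definition sparse :: "nat \<Rightarrow> nat \<Rightarrow> 'a list set" where
  "sparse k N = {w \<in> W. \<forall>(bs, Z) \<in> full_blocks k. \<not> subseq (genw N bs Z) w}"

text \<open>Sparse words form a subword-closed language that includes no top language, as it would
  have to include its generic word. So its level is at most \<open>k\<close>, which means order
  n^(k-1) against n^k for \<open>W\<close>.\<close>

lemma sparse_negligible:
  assumes "\<not> has_blocks (Suc (Suc k)) W"
    and "c > 0" "\<And>n. n \<ge> n0 \<Longrightarrow> dens W n \<ge> c * real (n + 1) ^ k" "\<epsilon> > 0"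
  shows "\<forall>\<^sub>F n in sequentially. dens (sparse k N) n \<le> \<epsilon> * dens W n"
proof -
  have sub: "sparse k N \<subseteq> W" by (auto simp: sparse_def)
  have dc: "down_closed I (sparse k N)"
    unfolding down_closed_def
  proof (intro conjI allI impI)
    show "sparse k N \<subseteq> lists I" using sub W_lists by blast
    fix w v assume w: "w \<in> sparse k N" and v: "subseq v w"
    then have "v \<in> W" using down_closed_W sub unfolding down_closed_def by blast
    moreover have "\<not> subseq g v" if "\<not> subseq g w" for g
      using that v subseq_order.trans by blast
    ultimately show "v \<in> sparse k N" using w unfolding sparse_def by auto
  qed
  obtain j where j: "has_blocks j (sparse k N)" "order_le j (dens (sparse k N))"
    using growth_upper[OF mass_le dc sub] by blast
  have "\<not> has_blocks (Suc k) (sparse k N)"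
  proof
    assume "has_blocks (Suc k) (sparse k N)"
    then obtain bs Z where bs: "blocks bs Z" "length bs = k" "lang bs Z \<subseteq> sparse k N"
      unfolding has_blocks_def by auto
    then have "(bs, Z) \<in> full_blocks k" using sub unfolding full_blocks_def by auto
    moreover have "genw N bs Z \<in> sparse k N" using genw_in_lang[OF bs(1)] bs(3) by blast
    ultimately show False unfolding sparse_def by blast
  qed
  then have "j \<le> k" using has_blocks_antimono[OF j(1) dc, of "Suc k"] by linarith
  then show ?thesis by (rule order_le_negligible[OF j(2) dens_nonneg _ assms(2,3,4)])
qed

end

section \<open>Large Wilf classes\<close>

context pattern_growth begin

definition wilf_class :: "'a list \<Rightarrow> 'a list set" where
  "wilf_class w = {v \<in> W. wt v = wt w \<and> gf (containing v) = gf (containing w)}"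

lemma wilf_class_card_ge:
  assumes "w \<in> W" "inj_on f B" "R \<le> card B" "\<And>i. i \<in> B \<Longrightarrow> f i \<in> wilf_class w"
  shows "R \<le> card (wilf_class w)"
proof -
  have "finite (wilf_class w)"
    by (rule finite_subset[OF _ finite_wt[OF W_lists, of "wt w"]]) (auto simp: wilf_class_def)
  then have "card (f ` B) \<le> card (wilf_class w)" using assms(4) by (intro card_mono) auto
  then show ?thesis using card_image[OF assms(2)] assms(3) by simp
qed

lemma wt_gaps: "wt (gaps x hs) = sum_list (map wt hs) + length hs * sz x"
  by (induction hs) auto

lemma left_generic_append: "left_generic A l u \<Longrightarrow> w \<in> lists I \<Longrightarrow> left_generic A l (u @ w)"
  by (auto simp: left_generic_def intro: subseq_rev_drop_many)

lemma right_generic_append: "right_generic A r v \<Longrightarrow> w \<in> lists I \<Longrightarrow> right_generic A r (w @ v)"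
  by (auto simp: right_generic_def intro: subseq_drop_many)

lemma gaps_in_lists: "x \<in> A \<Longrightarrow> gaps x hs \<in> lists A \<longleftrightarrow> set hs \<subseteq> lists A"
  by (induction hs) auto

text \<open>In each step the remaining gaps belong to the right context. The result depends on the
  number of gaps and on a product of commuting factors, hence not on their order.\<close>

lemma gf_gaps:
  assumes st: "stable A l r" and x: "x \<in> A" "\<And>y. y \<in> A \<Longrightarrow> sz y \<le> sz x"
    and u: "left_generic A l u" and v: "right_generic A r v" and hs: "set hs \<subseteq> lists A"
  shows "gf (containing (u @ x # gaps x hs @ v)) =
    (\<Prod>h\<leftarrow>hs. gf (min_words A h)) * gf (containing (u @ x # replicate (length hs) x @ v))"
  using u hs
proof (induction hs arbitrary: u)
  case (Cons h hs)
  have xI: "x \<in> I" and IA: "lists A \<subseteq> lists I" using x(1) stableD(1)[OF st] lists_mono by auto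
  have "set hs \<subseteq> lists A" using Cons.prems by auto
  then have "gaps x hs \<in> lists I" using gaps_in_lists[OF x(1)] IA by blast
  then have rg: "right_generic A r (gaps x hs @ v)" using right_generic_append[OF v] by blast
  have lg: "left_generic A l (u @ [x])" using left_generic_append[OF Cons.prems(1)] xI by simp
  have "gf (containing (u @ x # gaps x (h # hs) @ v))
      = gf (min_words A h) * gf (containing (u @ x # x # gaps x hs @ v))"
    using gap_factor[OF st x Cons.prems(1) rg, of h] Cons.prems(2) by simp
  also have "gf (containing (u @ x # x # gaps x hs @ v))
      = (\<Prod>h\<leftarrow>hs. gf (min_words A h)) * gf (containing (u @ x # x # replicate (length hs) x @ v))"
    using Cons.IH[OF lg] \<open>set hs \<subseteq> lists A\<close> by simp
  finally show ?case by (simp add: mult.assoc)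
qed simp

text \<open>The permuted word stays in \<open>W\<close> because the whole stretch can be deleted and
  any word over \<open>A\<close> can be inserted in its place.\<close>

lemma wilf_class_permute_gaps:
  assumes st: "stable A l r" and x: "x \<in> A" "\<And>y. y \<in> A \<Longrightarrow> sz y \<le> sz x"
    and u: "left_generic A l u" and v: "right_generic A r v" and W: "u @ x # gaps x hs @ v \<in> W"
    and ms: "mset hs' = mset hs"
  shows "u @ x # gaps x hs' @ v \<in> wilf_class (u @ x # gaps x hs @ v)"
proof -
  have "u @ (x # gaps x hs) @ v \<in> W" using W by simp
  then have "x # gaps x hs \<in> lists A"
    by (rule stable_middle[OF st _ left_generic_emb[OF st u] right_generic_emb[OF st v]])
  then have hs: "set hs \<subseteq> lists A" using gaps_in_lists[OF x(1)] by simp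
  have set_eq: "set hs' = set hs" using ms by (metis set_mset_mset)
  have len: "length hs' = length hs" using ms by (metis size_mset)
  have uI: "u \<in> lists I" using u by (simp add: left_generic_def)
  have "subseq (u @ v) (u @ (x # gaps x hs) @ v)" by (simp add: subseq_append' subseq_drop_many list_emb_Cons)
  then have "u @ v \<in> W" using W down_closed_W unfolding down_closed_def by simp
  moreover have "x # gaps x hs' \<in> lists A" using gaps_in_lists[OF x(1), of hs'] hs set_eq x(1) by simp
  ultimately have "u @ (x # gaps x hs') @ v \<in> W"
    by (rule stable_insert[OF st _ u emb_refl[OF uI] right_generic_emb[OF st v]])
  moreover have "sum_list (map wt hs') = sum_list (map wt hs)"
    using ms by (metis mset_map sum_mset_sum_list)
  moreover have "(\<Prod>h\<leftarrow>hs'. gf (min_words A h)) = (\<Prod>h\<leftarrow>hs. gf (min_words A h))"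
    using ms by (metis mset_map prod_mset_prod_list)
  ultimately show ?thesis
    using gf_gaps[OF st x u v, of hs] gf_gaps[OF st x u v, of hs'] hs set_eq len
    by (simp add: wilf_class_def wt_gaps)
qed

definition top_letter :: "'a set \<Rightarrow> 'a" where
  "top_letter A = (SOME x. x \<in> A \<and> (\<forall>y\<in>A. sz y \<le> sz x))"

lemma top_letter:
  assumes "finite A" "A \<noteq> {}"
  shows "top_letter A \<in> A" "\<And>y. y \<in> A \<Longrightarrow> sz y \<le> sz (top_letter A)"
proof -
  have "Max (sz ` A) \<in> sz ` A" using assms by (intro Max_in) auto
  then obtain x where "x \<in> A" "sz x = Max (sz ` A)" by auto
  then have "x \<in> A \<and> (\<forall>y\<in>A. sz y \<le> sz x)" using assms(1) by auto
  then have "top_letter A \<in> A \<and> (\<forall>y\<in>A. sz y \<le> sz (top_letter A))"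
    unfolding top_letter_def by (rule someI)
  then show "top_letter A \<in> A" "\<And>y. y \<in> A \<Longrightarrow> sz y \<le> sz (top_letter A)" by auto
qed

text \<open>Deleting \<open>q\<close> of the equal gaps is injective, which makes these words rare when \<open>\<theta> < 1\<close>.\<close>

definition repetitive :: "'a list \<Rightarrow> 'a \<Rightarrow> nat \<Rightarrow> 'a list set" where
  "repetitive c x q = {w \<in> W. \<exists>p h0 h v. min_prefix (subseq c) p \<and> x \<notin> set h0 \<and> x \<notin> set h \<and>
     w = p @ h0 @ x # gaps x (replicate (Suc q) h) @ v}"

lemma cnt_repetitive_le:
  assumes "x \<in> I"
  shows "cnt (repetitive c x q) n \<le> (\<Sum>m\<le>n. if m + q \<le> n then cnt W m else 0)"
proof -
  let ?D = "{w \<in> repetitive c x q. wt w = n}"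
  let ?dec = "\<lambda>w (p, h0, h, v). min_prefix (subseq c) p \<and> x \<notin> set h0 \<and> x \<notin> set h \<and>
     w = p @ h0 @ x # gaps x (replicate (Suc q) h) @ v"
  have dec_ex: "\<exists>t. ?dec w t" if w: "w \<in> ?D" for w
  proof -
    obtain p h0 h v where d: "min_prefix (subseq c) p" "x \<notin> set h0" "x \<notin> set h"
      "w = p @ h0 @ x # gaps x (replicate (Suc q) h) @ v"
      using w unfolding repetitive_def by blast
    have "?dec w (p, h0, h, v)" unfolding prod.case by (intro conjI d)
    then show ?thesis by (rule exI)
  qed
  define t where "t w = (SOME t. ?dec w t)" for w
  have t: "?dec w (t w)" if "w \<in> ?D" for w
    unfolding t_def by (rule someI_ex[OF dec_ex[OF that]])
  \<comment> \<open>The shortened word can be decoded: \<open>p\<close> is a shortest prefix,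
    \<open>h0\<close> and \<open>h\<close> end at the next \<open>x\<close>, and the number
    \<open>q\<close> of deleted gaps is fixed.\<close>
  define f where "f w = (case t w of (p, h0, h, v) \<Rightarrow> p @ h0 @ x # h @ x # v)" for w
  have "inj_on f ?D"
  proof (rule inj_onI)
    fix w w' assume w: "w \<in> ?D" "w' \<in> ?D" and eq: "f w = f w'"
    obtain p h0 h v where tw: "t w = (p, h0, h, v)" by (metis prod_cases4)
    obtain p' h0' h' v' where tw': "t w' = (p', h0', h', v')" by (metis prod_cases4)
    have d: "min_prefix (subseq c) p" "x \<notin> set h0" "x \<notin> set h" "w = p @ h0 @ x # gaps x (replicate (Suc q) h) @ v"
      using t[OF w(1)] unfolding tw by auto
    have d': "min_prefix (subseq c) p'" "x \<notin> set h0'" "x \<notin> set h'" "w' = p' @ h0' @ x # gaps x (replicate (Suc q) h') @ v'"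
      using t[OF w(2)] unfolding tw' by auto
    have e: "p @ (h0 @ x # h @ x # v) = p' @ (h0' @ x # h' @ x # v')" using eq unfolding f_def tw tw' by simp
    have p: "p = p'" by (rule min_prefix_unique[OF d(1) d'(1) e])
    have e2: "h0 @ x # h @ x # v = h0' @ x # h' @ x # v'" using e unfolding p by simp
    have h0: "h0 = h0' \<and> h @ x # v = h' @ x # v'" by (rule first_occurrence_unique[OF e2 d(2) d'(2)])
    then have "h = h' \<and> v = v'" using first_occurrence_unique[of h x v h' v'] d(3) d'(3) by blast
    then show "w = w'" unfolding d(4) d'(4) using p h0 by blast
  qed
  moreover have "f ` ?D \<subseteq> (\<Union>m\<in>{m. m \<le> n \<and> m + q \<le> n}. {w \<in> W. wt w = m})"
  proof (intro subsetI)
    fix y assume "y \<in> f ` ?D"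
    then obtain w where w: "w \<in> ?D" "y = f w" by blast
    obtain p h0 h v where tw: "t w = (p, h0, h, v)" by (metis prod_cases4)
    have d: "w = p @ h0 @ x # h @ x # gaps x (replicate q h) @ v" "y = p @ h0 @ x # h @ x # v"
      using t[OF w(1)] w(2) unfolding tw f_def by auto
    have "subseq y w" unfolding d by (simp add: subseq_append' subseq_drop_many)
    moreover have "w \<in> W" "wt w = n" using w(1) unfolding repetitive_def by auto
    ultimately have y: "y \<in> W" using down_closed_W unfolding down_closed_def by blast
    have "wt w = wt y + wt (gaps x (replicate q h))" unfolding d by simp
    moreover have "q \<le> wt (gaps x (replicate q h))" 
      using mult_le_mono2[OF sz_pos[OF assms], of q] unfolding wt_gaps length_replicate by linarith
    ultimately have "wt y + q \<le> n" using \<open>wt w = n\<close> by simp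
    then show "y \<in> (\<Union>m\<in>{m. m \<le> n \<and> m + q \<le> n}. {w \<in> W. wt w = m})" using y by auto
  qed
  ultimately have "card ?D \<le> card (\<Union>m\<in>{m. m \<le> n \<and> m + q \<le> n}. {w \<in> W. wt w = m})"
    by (intro card_inj_on_le[of f]) (auto intro!: finite_wt W_lists)
  also have "\<dots> \<le> (\<Sum>m\<in>{m. m \<le> n \<and> m + q \<le> n}. cnt W m)"
    unfolding cnt_def by (intro card_UN_le) auto
  also have "\<dots> = (\<Sum>m\<le>n. if m + q \<le> n then cnt W m else 0)"
    by (rule sum.mono_neutral_cong_left) auto
  finally show ?thesis unfolding cnt_def[of "repetitive c x q"] .
qed

text \<open>The deletion shortens a word by at least \<open>q\<close>, and the sizes n - q, n - q -
  1, ... contribute a geometric tail that is small for large \<open>q\<close>, uniformly in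
  n.\<close>

lemma dens_repetitive_le:
  assumes "x \<in> I" "\<theta> < 1" "C > 0" "\<And>n. dens W n \<le> C * real (n + 1) ^ k"
  shows "dens (repetitive c x q) n \<le> C * \<theta> ^ q / (1 - \<theta>) * real (n + 1) ^ k"
proof -
  let ?D = "C * real (n + 1) ^ k"
  have bound: "(if m + q \<le> n then real (cnt W m) * \<theta> ^ n else 0) \<le> ?D * (if m + q \<le> n then \<theta> ^ (n - m) else 0)"
    if "m \<le> n" for m
  proof -
    have "dens W m \<le> C * real (m + 1) ^ k" by (rule assms(4))
    also have "\<dots> \<le> ?D" using that assms(3) by (intro mult_left_mono power_mono) auto
    finally have "dens W m * \<theta> ^ (n - m) \<le> ?D * \<theta> ^ (n - m)" using \<theta>_pos by (intro mult_right_mono) auto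
    moreover have "dens W m * \<theta> ^ (n - m) = real (cnt W m) * \<theta> ^ n"
      using that by (simp add: dens_def mult.assoc flip: power_add)
    ultimately show ?thesis by simp
  qed
  have geo: "(\<Sum>m\<le>n. if m + q \<le> n then \<theta> ^ (n - m) else 0) \<le> \<theta> ^ q / (1 - \<theta>)"
  proof -
    have "(\<Sum>m\<le>n. if m + q \<le> n then \<theta> ^ (n - m) else 0) = (\<Sum>m\<le>n. if q \<le> n - m then \<theta> ^ (n - m) else 0)"
      by (rule sum.cong) auto
    also have "\<dots> = (\<Sum>j\<le>n. if q \<le> j then \<theta> ^ j else 0)"
      by (rule sum_atMost_rev[of "\<lambda>j. if q \<le> j then \<theta> ^ j else 0"])
    also have "\<dots> = (\<Sum>j\<in>{q..n}. \<theta> ^ j)" by (rule sum.mono_neutral_cong_right) auto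
    also have "\<dots> = (\<Sum>i\<in>{i. i + q \<le> n}. \<theta> ^ (i + q))"
      by (rule sum.reindex_bij_witness[of _ "\<lambda>i. i + q" "\<lambda>j. j - q"]) auto
    also have "\<dots> = \<theta> ^ q * (\<Sum>i\<in>{i. i + q \<le> n}. \<theta> ^ i)"
      by (simp add: power_add sum_distrib_left mult.commute)
    also have "\<dots> \<le> \<theta> ^ q * (\<Sum>i<Suc n. \<theta> ^ i)"
      using \<theta>_pos by (intro mult_left_mono sum_mono2) auto
    also have "(\<Sum>i<Suc n. \<theta> ^ i) \<le> 1 / (1 - \<theta>)"
      using assms(2) \<theta>_pos by (subst sum_gp_strict) (auto intro: divide_right_mono)
    finally show ?thesis using \<theta>_pos by (simp add: mult_left_mono)
  qed
  have "dens (repetitive c x q) n \<le> real (\<Sum>m\<le>n. if m + q \<le> n then cnt W m else 0) * \<theta> ^ n"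
    unfolding dens_def using cnt_repetitive_le[OF assms(1), of c q n] \<theta>_pos by (intro mult_right_mono of_nat_mono) auto
  also have "\<dots> = (\<Sum>m\<le>n. if m + q \<le> n then real (cnt W m) * \<theta> ^ n else 0)"
    unfolding of_nat_sum sum_distrib_right by (rule sum.cong) auto
  also have "\<dots> \<le> (\<Sum>m\<le>n. ?D * (if m + q \<le> n then \<theta> ^ (n - m) else 0))"
    by (rule sum_mono) (use bound in auto)
  also have "\<dots> = ?D * (\<Sum>m\<le>n. if m + q \<le> n then \<theta> ^ (n - m) else 0)" by (simp only: sum_distrib_left)
  also have "\<dots> \<le> ?D * (\<theta> ^ q / (1 - \<theta>))" using geo assms(3) by (intro mult_left_mono) auto
  finally show ?thesis by (simp add: mult_ac)
qed

lemma hd_set_crit: "blocks bs Z \<Longrightarrow> crit (hd_set bs Z)"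
  by (cases bs) auto

text \<open>The members of the class come from rearranging \<open>Suc q\<close> gaps; since these
  are not all equal, there are at least as many arrangements as gaps.\<close>

lemma large_class_exponential:
  assumes bs: "(bs, Z) \<in> full_blocks k" "\<not> has_blocks (Suc (Suc k)) W"
    and x: "x = top_letter (hd_set bs Z)"
    and w: "w \<in> W" "subseq (genw (margin + (Suc (Suc q) + margin)) bs Z) w"
    and nrep: "w \<notin> repetitive (upow (hd_set bs Z) margin) x q"
  shows "Suc q \<le> card (wilf_class w)"
proof -
  let ?A = "hd_set bs Z" and ?r = "tl_word K bs Z"
  \<comment> \<open>The two margins make the parts before and behind generic. Of the
    \<open>Suc (Suc q)\<close> letters \<open>x\<close> in between, the first opens the gaps and
    each other one closes a gap.\<close>
  let ?N = "margin + (Suc (Suc q) + margin)"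
  have b: "blocks bs Z" "length bs = k" "lang bs Z \<subseteq> W" using bs(1) by (auto simp: full_blocks_def)
  then have st: "stable ?A [] ?r" using stable_block[of "[]" bs Z] bs(2) by simp
  have xA: "x \<in> ?A" "\<And>y. y \<in> ?A \<Longrightarrow> sz y \<le> sz x"
    unfolding x using top_letter[OF stableD(3,2)[OF st]] by auto
  obtain p w' where p: "w = p @ w'" "min_prefix (subseq (upow ?A margin)) p"
  proof (rule min_prefix_exists[of "subseq (upow ?A margin)" w])
    have "genw ?N bs Z = upow ?A margin @ (upow ?A (Suc (Suc q) + margin) @ tl_word ?N bs Z)"
      by (simp only: genw_hd_tl upow_add append_assoc)
    then show "subseq (upow ?A margin) w" using w(2) by (metis list_emb_append_mono subseq_order.trans prefixI prefix_imp_subseq)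
  qed blast
  have rest: "subseq (upow ?A (Suc (Suc q)) @ (upow ?A margin @ tl_word ?N bs Z)) w'"
    by (rule min_prefix_subseq_rest[OF p(2)]) (use w(2) in \<open>simp only: p(1) genw_hd_tl upow_add append_assoc\<close>)
  have "subseq (replicate (Suc (Suc q)) x) (upow ?A (Suc (Suc q)))"
    by (rule subseq_upow) (use xA(1) stableD(3)[OF st] in auto)
  moreover have "K \<le> ?N" by (simp add: margin_def)
  ultimately have "subseq (replicate (Suc (Suc q)) x @ (upow ?A margin @ ?r))
      (upow ?A (Suc (Suc q)) @ (upow ?A margin @ tl_word ?N bs Z))"
    by (intro list_emb_append_mono tl_word_mono) simp_all
  then have "subseq (replicate (Suc (Suc q)) x @ (upow ?A margin @ ?r)) w'"
    using rest by (rule subseq_order.trans)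
  then obtain hs0 v where hs0: "w' = gaps x hs0 @ v" "length hs0 = Suc (Suc q)"
      "\<And>h. h \<in> set hs0 \<Longrightarrow> x \<notin> set h" "subseq (upow ?A margin @ ?r) v"
    by (rule subseq_gaps) blast
  then obtain h0 hs where h0: "hs0 = h0 # hs" "length hs = Suc q" by (cases hs0) auto
  let ?u = "p @ h0"
  have weq: "w = ?u @ x # gaps x hs @ v" using p(1) hs0(1) h0(1) by simp
  have I: "p \<in> lists I" "h0 \<in> lists I" "v \<in> lists I" using w(1) W_lists weq by auto
  have lg: "left_generic ?A [] ?u"
    using p(2) I unfolding left_generic_def min_prefix_def by (auto intro: subseq_rev_drop_many)
  have rg: "right_generic ?A ?r v" using hs0(4) I unfolding right_generic_def by simp
  have nonconst: "mset hs \<noteq> replicate_mset (size (mset hs)) h" for h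
  proof
    assume "mset hs = replicate_mset (size (mset hs)) h"
    then have "set hs \<subseteq> {h}" by (metis set_mset_mset set_mset_replicate_mset_subset empty_subsetI order_refl)
    then have "hs = replicate (Suc q) h" using h0(2) by (metis replicate_eqI singletonD subsetD)
    moreover have "x \<notin> set h" using hs0(3)[of h] h0 calculation by auto
    moreover have "x \<notin> set h0" using hs0(3) h0(1) by simp
    ultimately have "w \<in> repetitive (upow ?A margin) x q"
      using w(1) p(2) weq unfolding repetitive_def by (auto simp del: replicate_Suc)
    then show False using nrep by blast
  qed
  show ?thesis
  proof (rule wilf_class_card_ge[OF w(1)])
    let ?B = "permutations_of_multiset (mset hs)"
    show "inj_on (\<lambda>hs'. ?u @ x # gaps x hs' @ v) ?B"
    proof (rule inj_onI)
      fix a b assume ab: "a \<in> ?B" "b \<in> ?B" "?u @ x # gaps x a @ v = ?u @ x # gaps x b @ v"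
      then have m: "mset a = mset hs" "mset b = mset hs" by (auto dest: permutations_of_multisetD)
      then have "length a = length b" "set a = set hs" "set b = set hs" by (metis size_mset, metis set_mset_mset, metis set_mset_mset)
      moreover have "gaps x a @ v = gaps x b @ v" using ab(3) by simp
      ultimately show "a = b" using gaps_unique[of x a v b v] hs0(3) h0(1) by auto
    qed
    show "Suc q \<le> card ?B" using card_permutations_of_multiset_ge[OF nonconst] h0(2) by simp
    fix hs' assume "hs' \<in> ?B"
    then have "mset hs' = mset hs" by (rule permutations_of_multisetD)
    then show "?u @ x # gaps x hs' @ v \<in> wilf_class w"
      using wilf_class_permute_gaps[OF st xA lg rg] w(1) unfolding weq by blast
  qed
qed

section \<open>Growth rate 1: moving copies of the letter \<open>one\<close>\<close>

lemma gf_shift_one: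
  assumes st: "stable {one} l r" and u: "left_generic {one} l u" and v: "right_generic {one} r v"
    and "2 \<le> a"
  shows "gf (containing (u @ replicate (Suc a) one @ v))
    = gf (min_words {one} [one]) * gf (containing (u @ replicate a one @ v))"
proof -
  \<comment> \<open>Two of the copies play the letters \<open>x\<close> of the gap formula, the
    others join the right context.\<close>
  obtain b where b: "a = Suc (Suc b)" using assms(4) by (metis add_2_eq_Suc le_Suc_ex)
  have "right_generic {one} r (replicate b one @ v)"
    by (rule right_generic_append[OF v]) (use one in auto)
  then show ?thesis using gap_factor[OF st _ _ u, of one "replicate b one @ v" "[one]"] unfolding b by simp
qed

text \<open>The first two blocks yield runs of \<open>one\<close>, and lengthening either run by one
  multiplies the generating function by the same factor. So only the total length of the two runs
  matters.\<close>

lemma large_class_polynomial: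
  assumes bs: "(bs, Z) \<in> full_blocks k" "\<not> has_blocks (Suc (Suc k)) W" and k: "k \<noteq> 0"
    and only: "\<And>A. crit A \<Longrightarrow> lists A \<subseteq> W \<Longrightarrow> A = {one}"
    and w: "w \<in> W" "subseq (genw (margin + (q + 2 + margin)) bs Z) w"
  shows "q \<le> card (wilf_class w)"
proof -
  \<comment> \<open>With \<open>q + 2\<close> copies between the margins, fewer than
    \<open>q\<close> can be moved away while at least two remain, as \<open>gf_shift_one\<close>
    requires.\<close>
  let ?N = "margin + (q + 2 + margin)"
  have b: "blocks bs Z" "length bs = k" "lang bs Z \<subseteq> W" using bs(1) by (auto simp: full_blocks_def)
  have sets: "A = {one}" if "A \<in> insert Z (fst ` set bs)" for A
    using only[OF blocks_crit[OF b(1) that] lists_subset_W[OF b(3) that]] .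
  obtain A1 b1 cs where bs_eq: "bs = (A1, b1) # cs" using b(2) k by (cases bs) auto
  have A1: "A1 = {one}" using sets[of A1] bs_eq by simp
  have hd2: "hd_set cs Z = {one}" by (rule sets) (cases cs; auto simp: bs_eq)
  have b1: "b1 \<noteq> one" "b1 \<in> I" using b(1) A1 unfolding bs_eq by auto
  let ?U = "upow {one} :: nat \<Rightarrow> 'a list"
  let ?r2 = "tl_word K cs Z" and ?l2 = "?U K @ [b1]"
  let ?r1 = "b1 # ?U K @ ?r2"
  have st1: "stable {one} [] ?r1"
    using stable_block[of "[]" bs Z] b bs(2) unfolding bs_eq A1 by (simp add: genw_hd_tl hd2)
  have st2: "stable {one} ?l2 ?r2"
    using stable_block[of "[(A1, b1)]" cs Z] b bs(2) unfolding bs_eq A1 by (simp add: hd2)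
  have "K \<le> ?N" "K \<le> margin" by (simp_all add: margin_def)
  have "genw ?N bs Z = ?U margin @ ?U (q + 2) @ (?U margin @ b1 # ?U margin) @ ?U (q + 2) @ (?U margin @ tl_word ?N cs Z)"
    unfolding bs_eq A1 genw.simps genw_hd_tl[of ?N cs] hd2 by (simp only: upow_add append_assoc append_Cons)
  then have sub: "subseq (?U margin @ ?U (q + 2) @ (?U margin @ b1 # ?U margin) @ ?U (q + 2) @ (?U margin @ tl_word ?N cs Z)) w"
    using w(2) by simp
  \<comment> \<open>\<open>m1\<close> and \<open>m2\<close> turn out to be the two runs. The part
    \<open>wm\<close> around the separator \<open>b1\<close> has a margin on each side, so it serves
    in the right context of the first run and in the left context of the second.\<close>
  obtain u m1 wm m2 v where dec: "w = u @ m1 @ wm @ m2 @ v" "subseq (?U margin) u" "subseq (?U (q + 2)) m1"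
      "subseq (?U margin @ b1 # ?U margin) wm" "subseq (?U (q + 2)) m2" "subseq (?U margin @ tl_word ?N cs Z) v"
    using list_emb_appendD[OF sub] list_emb_appendD by metis
  have I: "u \<in> lists I" "m1 \<in> lists I" "wm \<in> lists I" "m2 \<in> lists I" "v \<in> lists I"
    using w(1) W_lists unfolding dec(1) by auto
  have lg1: "left_generic {one} [] u" using dec(2) I by (simp add: left_generic_def)
  have "subseq (?U margin @ ?r2) (?U margin @ tl_word ?N cs Z)"
    unfolding subseq_append' by (rule tl_word_mono[OF \<open>K \<le> ?N\<close>])
  then have rv: "subseq (?U margin @ ?r2) v" using dec(6) by (rule subseq_order.trans)
  then have rg2: "right_generic {one} ?r2 v" using I by (simp add: right_generic_def)
  have UK: "subseq (?U K) (?U margin)" by (rule upow_mono[OF \<open>K \<le> margin\<close>])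
  have "subseq ((?U margin @ b1 # ?U K) @ ?r2) (wm @ v)"
  proof (rule list_emb_append_mono)
    have "subseq (?U margin @ b1 # ?U K) (?U margin @ b1 # ?U margin)" using UK by (simp add: subseq_append')
    then show "subseq (?U margin @ b1 # ?U K) wm" using dec(4) by (rule subseq_order.trans)
    show "subseq ?r2 v" using rv by (metis subseq_drop_many subseq_order.refl subseq_order.trans)
  qed
  moreover have "subseq (wm @ v) (wm @ y @ v)" for y by (simp add: subseq_append' subseq_drop_many)
  ultimately have "subseq ((?U margin @ b1 # ?U K) @ ?r2) (wm @ y @ v)" for y
    using subseq_order.trans by blast
  then have rg1': "subseq (?U margin @ ?r1) (wm @ y @ v)" for y by simp
  have rg1: "right_generic {one} ?r1 (wm @ y @ v)" if "y \<in> lists I" for y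
    using rg1' I that by (simp add: right_generic_def)
  have "subseq (?l2 @ ?U margin) (?U margin @ b1 # ?U margin)"
    using list_emb_append_mono[OF UK, of "b1 # ?U margin" "b1 # ?U margin"] by simp
  then have "subseq (?l2 @ ?U margin) wm" using dec(4) by (rule subseq_order.trans)
  then have lg2: "left_generic {one} ?l2 (u @ y @ wm)" if "y \<in> lists I" for y
    using I that by (auto simp: left_generic_def intro: subseq_drop_many)
  have "u @ m1 @ (wm @ m2 @ v) \<in> W" using w(1) dec(1) by simp
  then have "m1 \<in> lists {one}"
    by (rule stable_middle[OF st1 _ left_generic_emb[OF st1 lg1] right_generic_emb[OF st1 rg1[OF I(4)]]])
  moreover have "(u @ m1 @ wm) @ m2 @ v \<in> W" using w(1) dec(1) by simp
  then have "m2 \<in> lists {one}"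
    by (rule stable_middle[OF st2 _ left_generic_emb[OF st2 lg2[OF I(2)]] right_generic_emb[OF st2 rg2]])
  ultimately obtain a c where ac: "m1 = replicate a one" "m2 = replicate c one"
    by (metis in_lists_conv_set replicate_eqI singletonD)
  have a: "q + 2 \<le> a" "q + 2 \<le> c"
    using list_emb_length[OF dec(3)] list_emb_length[OF dec(5)] length_upow[of "{one}" "q + 2"] unfolding ac by auto
  let ?g = "\<lambda>i j. u @ replicate i one @ wm @ replicate j one @ v"
  let ?M = "gf (min_words {one} [one])"
  have repI: "replicate i one \<in> lists I" for i using one by auto
  have shift1: "gf (containing (?g (Suc i) j)) = ?M * gf (containing (?g i j))" if "2 \<le> i" for i j
    using gf_shift_one[OF st1 lg1 rg1[OF repI] that] by simp
  have shift2: "gf (containing (?g i (Suc j))) = ?M * gf (containing (?g i j))" if "2 \<le> j" for i j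
    using gf_shift_one[OF st2 lg2[OF repI] rg2 that] by simp
  have swap: "gf (containing (?g (i + d) j)) = gf (containing (?g i (j + d)))" if "2 \<le> i" "2 \<le> j" for i j d
    using that(2)
  proof (induction d arbitrary: j)
    case (Suc d)
    have "gf (containing (?g (i + Suc d) j)) = gf (containing (?g (i + d) (Suc j)))"
      using shift1[of "i + d" j] shift2[of j "i + d"] that(1) Suc.prems by simp
    also have "\<dots> = gf (containing (?g i (Suc j + d)))" using Suc.IH[of "Suc j"] Suc.prems by simp
    finally show ?case by simp
  qed simp
  show ?thesis
  proof (rule wilf_class_card_ge[OF w(1)])
    let ?f = "\<lambda>d. ?g (a - d) (c + d)"
    show "inj_on ?f {..<q}"
    proof (rule linorder_inj_onI)
      fix d e assume de: "d < e" "d \<in> {..<q}" "e \<in> {..<q}"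
      define t where "t = a - e"
      have t: "a - d = t + (e - d)" "a - e = t" using de a unfolding t_def by auto
      \<comment> \<open>The letter \<open>b1\<close> in \<open>wm\<close> stops the leading run of
        \<open>one\<close> after \<open>u\<close>, so the length of that run reveals
        \<open>d\<close>.\<close>
      have "subseq [b1] (?U margin @ b1 # ?U margin)" unfolding subseq_singleton_left by simp
      then have "subseq [b1] wm" using dec(4) by (rule subseq_order.trans)
      then have "b1 \<in> set wm" unfolding subseq_singleton_left .
      then have tw: "takeWhile (\<lambda>y. y = one) (wm @ y) = takeWhile (\<lambda>y. y = one) wm" for y
        using b1(1) by (intro takeWhile_append1) auto
      have "takeWhile (\<lambda>y. y = one) (replicate i one @ y) = replicate i one @ takeWhile (\<lambda>y. y = one) y" for i y
        by (induction i) auto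
      then have len: "length (takeWhile (\<lambda>y. y = one) (replicate i one @ wm @ y)) = i + length (takeWhile (\<lambda>y. y = one) wm)" for i y
        by (simp add: tw)
      show "?f d \<noteq> ?f e"
      proof
        assume "?f d = ?f e"
        then have "replicate (a - d) one @ wm @ (replicate (c + d) one @ v) = replicate (a - e) one @ wm @ (replicate (c + e) one @ v)"
          by simp
        then have "a - d = a - e" using len by (metis add_right_cancel)
        then show False using t de by simp
      qed
    qed (auto)
    show "q \<le> card {..<q}" by simp
    fix d assume "d \<in> {..<q}"
    then have d: "d < q" by simp
    have "subseq (replicate (a - d) one) (replicate a one)"
      using replicate_add[of "a - d" d one] d a by (simp add: prefix_imp_subseq)
    then have "subseq (?g (a - d) c) w" unfolding dec(1) ac by (simp add: subseq_append' list_emb_append_mono)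
    then have "(u @ replicate (a - d) one @ wm @ replicate c one) @ v \<in> W"
      using w(1) down_closed_W unfolding down_closed_def by simp
    then have "(u @ replicate (a - d) one @ wm @ replicate c one) @ replicate d one @ v \<in> W"
    proof (rule stable_insert[OF st2 _ lg2[OF repI]])
      show "emb (u @ replicate (a - d) one @ wm) (u @ replicate (a - d) one @ wm @ replicate c one)"
        using I one by (intro emb_subseq) (auto simp: subseq_append' subseq_rev_drop_many)
      show "emb (?U K @ ?r2) v" by (rule right_generic_emb[OF st2 rg2])
    qed auto
    then have "?f d \<in> W" by (simp add: replicate_add)
    moreover have "wt (?f d) = wt w" unfolding dec(1) ac using d a by (simp add: wt_def sum_list_replicate one(2))
    moreover have "gf (containing (?f d)) = gf (containing w)"
      using swap[of "a - d" c d] d a unfolding dec(1) ac by simp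
    ultimately show "?f d \<in> wilf_class w" unfolding wilf_class_def by simp
  qed
qed

text \<open>Exceptional are the words without a generic subword and, if \<theta> < 1, the repetitive
  words of each top language. Each kind gets at most half of the allowed fraction 1/R.\<close>

theorem few_small_classes:
  assumes "R > 0"
  obtains B where "B \<subseteq> W" "\<And>w. w \<in> W \<Longrightarrow> w \<notin> B \<Longrightarrow> R \<le> card (wilf_class w)"
    "\<forall>\<^sub>F n in sequentially. real R * real (cnt B n) \<le> real (cnt W n)"
proof -
  obtain k c C n0 where k: "has_blocks (Suc k) W" "\<not> has_blocks (Suc (Suc k)) W"
    "c > 0" "\<And>n. n \<ge> n0 \<Longrightarrow> dens W n \<ge> c * real (n + 1) ^ k"
    "C > 0" "\<And>n. dens W n \<le> C * real (n + 1) ^ k" using block_number by metis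
  have to_cnt: "real R * real (cnt B n) \<le> real (cnt W n)" if "real R * dens B n \<le> dens W n" for B n
  proof -
    have "real R * real (cnt B n) * \<theta> ^ n \<le> real (cnt W n) * \<theta> ^ n"
      using that by (simp add: dens_def mult.assoc)
    then show ?thesis using \<theta>_pos by (simp add: mult_le_cancel_right)
  qed
  let ?\<epsilon> = "1 / (2 * real R)"
  have \<epsilon>: "?\<epsilon> > 0" using assms by simp
  have sp: "\<forall>\<^sub>F n in sequentially. dens (sparse k N) n \<le> ?\<epsilon> * dens W n" for N
    by (rule sparse_negligible[OF k(2,3,4) \<epsilon>])
  show ?thesis
  proof (cases "\<theta> < 1")
    case True
    let ?F = "full_blocks k"
    let ?f = "real (card ?F)"
    \<comment> \<open>\<open>q0\<close> keeps the repetitive words of all \<open>?f\<close> top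
      languages together below the fraction \<open>?\<epsilon>\<close> of the lower bound for
      \<open>W\<close>; the added 1 keeps the denominator positive.\<close>
    have "c * (1 - \<theta>) / (2 * real R * C * (?f + 1)) > 0" using k True assms by simp
    then obtain q0 where q0: "\<theta> ^ q0 < c * (1 - \<theta>) / (2 * real R * C * (?f + 1))"
      using real_arch_pow_inv[OF _ True] by blast
    define q where "q = max q0 R"
    have "\<theta> ^ q \<le> \<theta> ^ q0" unfolding q_def using \<theta>_pos \<theta>_le_1 by (intro power_decreasing) auto
    then have "\<theta> ^ q \<le> c * (1 - \<theta>) / (2 * real R * C * (?f + 1))" using q0 by simp
    then have "\<theta> ^ q * (2 * real R * C * (?f + 1)) \<le> c * (1 - \<theta>)"
      using k assms by (subst (asm) pos_le_divide_eq) auto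
    moreover have "\<theta> ^ q * (2 * real R * C * ?f) \<le> \<theta> ^ q * (2 * real R * C * (?f + 1))"
      using \<theta>_pos k by (intro mult_left_mono) auto
    ultimately have q: "?f * (C * \<theta> ^ q / (1 - \<theta>)) \<le> ?\<epsilon> * c"
      using True assms by (simp add: field_simps)
    define N where "N = margin + (Suc (Suc q) + margin)"
    define rep where "rep = (\<lambda>(bs, Z). repetitive (upow (hd_set bs Z) margin) (top_letter (hd_set bs Z)) q)"
    define B where "B = sparse k N \<union> (\<Union>\<tau>\<in>?F. rep \<tau>)"
    have rep_W: "rep \<tau> \<subseteq> W" for \<tau> by (auto simp: rep_def repetitive_def split: prod.split)
    have rep_dens: "dens (rep \<tau>) n \<le> C * \<theta> ^ q / (1 - \<theta>) * real (n + 1) ^ k" if \<tau>: "\<tau> \<in> ?F" for \<tau> n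
    proof -
      obtain bs Z where bZ: "\<tau> = (bs, Z)" by fastforce
      have "crit (hd_set bs Z)" using \<tau> unfolding bZ full_blocks_def by (auto intro: hd_set_crit)
      then have "finite (hd_set bs Z)" "hd_set bs Z \<noteq> {}" "hd_set bs Z \<subseteq> I"
        using finite_I finite_subset by (auto simp: crit_def mass_def)
      then have "top_letter (hd_set bs Z) \<in> I" using top_letter(1) by blast
      then show ?thesis unfolding bZ rep_def prod.case using True k(5,6) by (intro dens_repetitive_le)
    qed
    have large: "R \<le> card (wilf_class w)" if w: "w \<in> W" "w \<notin> B" for w
    proof -
      obtain bs Z where bZ: "(bs, Z) \<in> ?F" "subseq (genw N bs Z) w"
        using w unfolding B_def sparse_def by auto
      have "w \<notin> rep (bs, Z)" using w(2) bZ(1) unfolding B_def by blast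
      then have "Suc q \<le> card (wilf_class w)"
        using large_class_exponential[OF bZ(1) k(2) refl w(1)] bZ(2) unfolding rep_def N_def by simp
      then show ?thesis unfolding q_def by simp
    qed
    have "\<forall>\<^sub>F n in sequentially. real R * real (cnt B n) \<le> real (cnt W n)"
      using sp[of N] eventually_ge_at_top[of n0]
    proof eventually_elim
      case (elim n)
      have UNW: "(\<Union>\<tau>\<in>?F. rep \<tau>) \<subseteq> lists I" using rep_W W_lists by blast
      have "dens B n \<le> dens (sparse k N) n + dens (\<Union>\<tau>\<in>?F. rep \<tau>) n"
        unfolding B_def by (rule dens_Un_le[OF _ UNW]) (use W_lists in \<open>auto simp: sparse_def\<close>)
      also have "dens (\<Union>\<tau>\<in>?F. rep \<tau>) n \<le> (\<Sum>\<tau>\<in>?F. dens (rep \<tau>) n)"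
        using rep_W W_lists by (intro dens_UN_le finite_full_blocks) blast
      also have "\<dots> \<le> (\<Sum>\<tau>\<in>?F. C * \<theta> ^ q / (1 - \<theta>) * real (n + 1) ^ k)"
        by (intro sum_mono rep_dens)
      also have "\<dots> = ?f * (C * \<theta> ^ q / (1 - \<theta>)) * real (n + 1) ^ k" by simp
      also have "\<dots> \<le> ?\<epsilon> * c * real (n + 1) ^ k" by (intro mult_right_mono q) auto
      also have "\<dots> \<le> ?\<epsilon> * dens W n" unfolding mult.assoc
        by (rule mult_left_mono[OF k(4)[OF elim(2)]]) (use \<epsilon> in auto)
      finally have "dens B n \<le> ?\<epsilon> * dens W n + ?\<epsilon> * dens W n" using elim(1) by linarith
      then have "real R * dens B n \<le> dens W n" using assms by (simp add: field_simps)
      then show ?case by (rule to_cnt)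
    qed
    moreover have "B \<subseteq> W" unfolding B_def using rep_W by (auto simp: sparse_def)
    ultimately show ?thesis using that large by blast
  next
    case False
    then have \<theta>1: "\<theta> = 1" using \<theta>_le_1 by simp
    \<comment> \<open>At \<theta> = 1 the density is the plain count, bounded if k = 0. Unbounded
      growth therefore provides two blocks.\<close>
    have "k \<noteq> 0"
    proof
      assume "k = 0"
      then have "real (cnt W n) \<le> C" for n
      proof -
        have "dens W n = real (cnt W n)" by (subst dens_def) (simp add: \<theta>1)
        then show ?thesis using k(6)[of n] \<open>k = 0\<close> by simp
      qed
      then have "cnt W n \<le> nat \<lceil>C\<rceil>" for n by (meson le_nat_iff nat_ceiling_le_eq of_nat_le_iff order_trans real_nat_ceiling_ge)
      then show False using unbounded by (auto simp: bdd_above_def)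
    qed
    \<comment> \<open>At \<theta> = 1 the mass is the number of letters, so critical alphabets are
      singletons.\<close>
    have only: "A = {one}" if "crit A" "lists A \<subseteq> W" for A
    proof -
      have "mass A = real (card A)" by (subst mass_def) (simp add: \<theta>1)
      then have "card A = 1" using that(1) by (simp add: crit_def)
      then show ?thesis using crit_one[OF that] by (auto simp: card_1_singleton_iff)
    qed
    define B where "B = sparse k (margin + (R + 2 + margin))"
    have "R \<le> card (wilf_class w)" if w: "w \<in> W" "w \<notin> B" for w
    proof -
      obtain bs Z where "(bs, Z) \<in> full_blocks k" "subseq (genw (margin + (R + 2 + margin)) bs Z) w"
        using w unfolding B_def sparse_def by auto
      then show ?thesis using large_class_polynomial[OF _ k(2) \<open>k \<noteq> 0\<close> only w(1)] by blast
    qed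
    moreover have "\<forall>\<^sub>F n in sequentially. real R * real (cnt B n) \<le> real (cnt W n)"
      using sp[of "margin + (R + 2 + margin)"]
    proof eventually_elim
      case (elim n)
      have "real R * dens B n \<le> real R * (?\<epsilon> * dens W n)" unfolding B_def using elim by (intro mult_left_mono) auto
      also have "\<dots> \<le> dens W n" using assms by simp
      finally show ?case by (rule to_cnt)
    qed
    moreover have "B \<subseteq> W" by (auto simp: B_def sparse_def)
    ultimately show ?thesis using that by blast
  qed
qed

end

section \<open>Sums of indecomposable permutations\<close>

lemma is_perm_iff: "is_perm p \<longleftrightarrow> set p = {1..length p} \<and> distinct p"
  unfolding is_perm_def permutations_of_set_def by simp

lemma is_perm_nth: "is_perm p \<Longrightarrow> i < length p \<Longrightarrow> 1 \<le> p ! i \<and> p ! i \<le> length p"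
  unfolding is_perm_iff using nth_mem[of i p] by auto

lemma length_perm_sum [simp]: "length (perm_sum a b) = length a + length b"
  by (simp add: perm_sum_def)

lemma perm_sum_Nil [simp]: "perm_sum [] b = b" "perm_sum a [] = a"
  by (simp_all add: perm_sum_def)

lemma perm_sum_assoc: "perm_sum (perm_sum a b) c = perm_sum a (perm_sum b c)"
  by (simp add: perm_sum_def comp_def add_ac)

lemma is_perm_sum: "is_perm a \<Longrightarrow> is_perm b \<Longrightarrow> is_perm (perm_sum a b)"
proof -
  assume a: "is_perm a" and b: "is_perm b"
  have "(\<lambda>x. x + length a) ` {1..length b} = {length a + 1..length a + length b}"
    using image_add_atLeastAtMost[of "length a" 1 "length b"] by (simp add: add.commute)
  then show ?thesis using a b
    by (auto simp: is_perm_iff perm_sum_def distinct_map inj_on_def)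
qed

lemma perm_sum_inject:
  assumes "perm_sum a b = perm_sum c d" "length a = length c"
  shows "a = c \<and> b = d"
proof -
  have "a = c" and eq: "map (\<lambda>x. x + length a) b = map (\<lambda>x. x + length a) d"
    using assms by (auto simp: perm_sum_def)
  moreover have "b = d" using eq by (rule map_injective) (simp add: inj_def)
  ultimately show ?thesis by simp
qed

text \<open>With any value, \<open>q1\<close> has all smaller ones too, so its values are exactly
  those up to \<open>length q1\<close>.\<close>

lemma perm_append_split:
  assumes "is_perm (q1 @ q2)" "\<And>x y. x \<in> set q1 \<Longrightarrow> y \<in> set q2 \<Longrightarrow> x < y"
  obtains b where "is_perm q1" "is_perm b" "q2 = map (\<lambda>x. x + length q1) b"
proof -
  let ?k = "length q1" and ?n = "length q1 + length q2"
  have un: "set q1 \<union> set q2 = {1..?n}" and dist: "distinct q1" "distinct q2" "set q1 \<inter> set q2 = {}"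
    using assms(1) unfolding is_perm_iff by auto
  have le: "x \<le> ?k" if "x \<in> set q1" for x
  proof -
    have "{1..x} \<subseteq> set q1"
    proof
      fix y assume "y \<in> {1..x}"
      moreover have "x \<le> ?n" using that un by auto
      ultimately have "y \<in> set q1 \<union> set q2" unfolding un by auto
      then show "y \<in> set q1" using assms(2)[OF that, of y] \<open>y \<in> {1..x}\<close> by auto
    qed
    then have "card {1..x} \<le> card (set q1)" by (intro card_mono) auto
    then show ?thesis using distinct_card[OF dist(1)] by simp
  qed
  have "set q1 \<subseteq> {1..?k}" using le un by auto
  then have q1: "set q1 = {1..?k}"
    using distinct_card[OF dist(1)] by (intro card_subset_eq) auto
  have "set q2 = {1..?n} - {1..?k}" using un dist(3) q1 by blast
  moreover have "{1..?n} - {1..?k} = {?k+1..?n}" by (rule set_eqI) (simp, linarith)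
  ultimately have q2: "set q2 = {?k+1..?n}" by (rule trans)
  define b where "b = map (\<lambda>x. x - ?k) q2"
  have q2b: "q2 = map (\<lambda>x. x + ?k) b"
    unfolding b_def using q2 by (auto intro!: map_idI[symmetric])
  have "set b = (\<lambda>x. x - ?k) ` {?k+1..?n}" unfolding b_def using q2 by simp
  also have "\<dots> = {1..length q2}"
  proof (intro equalityI subsetI)
    fix y assume "y \<in> {1..length q2}"
    then show "y \<in> (\<lambda>x. x - ?k) ` {?k+1..?n}" by (intro image_eqI[of _ _ "y + ?k"]) auto
  qed auto
  finally have "is_perm b"
    using dist(2) unfolding is_perm_iff q2b by (auto simp: distinct_map)
  moreover have "is_perm q1" using q1 dist(1) unfolding is_perm_iff by simp
  ultimately show ?thesis using q2b that by blast
qed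

text \<open>Monotone relabellings restrict and compose more easily than comparisons of positions;
  transitivity of containment becomes a composition.\<close>

lemma order_isomorphic_iff_map:
  "order_isomorphic s t \<longleftrightarrow> (\<exists>g. strict_mono_on (set s) g \<and> t = map g s)"
proof
  assume iso: "order_isomorphic s t"
  then have len: "length s = length t"
    and lt: "\<And>i j. i < length s \<Longrightarrow> j < length s \<Longrightarrow> s ! i < s ! j \<longleftrightarrow> t ! i < t ! j"
    unfolding order_isomorphic_def by auto
  define ix where "ix x = (SOME i. i < length s \<and> s ! i = x)" for x
  have ix: "ix x < length s \<and> s ! ix x = x" if "x \<in> set s" for x
    unfolding ix_def by (rule someI_ex) (use that in \<open>auto simp: in_set_conv_nth\<close>)
  have "t ! ix (s ! i) = t ! i" if "i < length s" for i
  proof -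
    have "s ! i \<in> set s" using that by simp
    note ix[OF this]
    then show ?thesis using lt[of i "ix (s ! i)"] lt[of "ix (s ! i)" i] that
      by (metis less_irrefl not_less_iff_gr_or_eq)
  qed
  then have "t = map (\<lambda>x. t ! ix x) s" using len by (intro nth_equalityI) auto
  moreover have "strict_mono_on (set s) (\<lambda>x. t ! ix x)"
  proof (rule strict_mono_onI)
    fix x y assume "x \<in> set s" "y \<in> set s" "x < y"
    then show "t ! ix x < t ! ix y" using ix[of x] ix[of y] lt[of "ix x" "ix y"] by simp
  qed
  ultimately show "\<exists>g. strict_mono_on (set s) g \<and> t = map g s" by blast
next
  assume "\<exists>g. strict_mono_on (set s) g \<and> t = map g s"
  then obtain g where g: "strict_mono_on (set s) g" "t = map g s" by blast
  show "order_isomorphic s t"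
    unfolding order_isomorphic_def g(2)
    using strict_mono_on_less[OF g(1)] by simp
qed

lemma perm_contains_iff_map:
  "perm_contains p q \<longleftrightarrow> (\<exists>s g. subseq s p \<and> strict_mono_on (set s) g \<and> q = map g s)"
  unfolding perm_contains_def order_isomorphic_iff_map by blast

lemma subseq_mapD:
  assumes "subseq t (map g s)"
  obtains t' where "subseq t' s" "t = map g t'"
  using assms unfolding subseq_conv_nths by (auto simp: nths_map)

lemma perm_contains_refl: "perm_contains p p"
  unfolding perm_contains_def order_isomorphic_def by blast

lemma perm_contains_Nil: "perm_contains p []"
  unfolding perm_contains_def order_isomorphic_def by (intro exI[of _ "[]"]) simp

lemma perm_contains_trans:
  assumes "perm_contains p q" "perm_contains q r"
  shows "perm_contains p r"
proof -
  obtain s g where s: "subseq s p" "strict_mono_on (set s) g" "q = map g s"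
    using assms(1) unfolding perm_contains_iff_map by blast
  obtain t h where t: "subseq t q" "strict_mono_on (set t) h" "r = map h t"
    using assms(2) unfolding perm_contains_iff_map by blast
  obtain t' where t': "subseq t' s" "t = map g t'" using t(1) subseq_mapD unfolding s(3) by blast
  have sub: "set t' \<subseteq> set s" using t'(1) by (auto dest: list_emb_set)
  have "strict_mono_on (set t') (h \<circ> g)"
    using s(2) t(2) sub unfolding t'(2) strict_mono_on_def by (auto simp: subset_iff)
  moreover have "subseq t' p" using t'(1) s(1) subseq_order.trans by blast
  ultimately show ?thesis unfolding perm_contains_iff_map t(3) t'(2) by fastforce
qed

lemma perm_contains_length: "perm_contains p q \<Longrightarrow> length q \<le> length p"
  unfolding perm_contains_iff_map by (auto dest: list_emb_length)

text \<open>A subsequence of full length is the whole list, and an entry of a permutation is one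
  more than the number of smaller entries, so the relative order determines it.\<close>

lemma perm_contains_same_length:
  assumes "perm_contains p q" "is_perm p" "is_perm q" "length p = length q"
  shows "p = q"
proof -
  obtain s where s: "subseq s p" "order_isomorphic s q"
    using assms(1) unfolding perm_contains_def by blast
  then have "length s = length p" using assms(4) unfolding order_isomorphic_def by simp
  then have "s = p" using s(1) subseq_same_length by blast
  then have lt: "p ! i < p ! j \<longleftrightarrow> q ! i < q ! j" if "i < length p" "j < length p" for i j
    using s(2) that unfolding order_isomorphic_def by auto
  have val: "card {j. j < length r \<and> r ! j < r ! i} = r ! i - 1"
    if "is_perm r" "i < length r" for r i
  proof -
    have "(!) r ` {j. j < length r \<and> r ! j < r ! i} = {1..<r ! i}"
    proof (intro equalityI subsetI)
      fix x assume "x \<in> {1..<r ! i}"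
      moreover have "r ! i \<le> length r" using is_perm_nth that by blast
      ultimately have "x \<in> set r" using that(1) unfolding is_perm_iff by auto
      then obtain j where "j < length r" "r ! j = x" by (auto simp: in_set_conv_nth)
      then show "x \<in> (!) r ` {j. j < length r \<and> r ! j < r ! i}"
        using \<open>x \<in> {1..<r ! i}\<close> by auto
    qed (use is_perm_nth[OF that(1)] in auto)
    moreover have "inj_on ((!) r) {j. j < length r \<and> r ! j < r ! i}"
      using that(1) by (intro inj_on_nth) (auto simp: is_perm_iff)
    ultimately show ?thesis by (metis card_atLeastLessThan card_image)
  qed
  have "p ! i = q ! i" if i: "i < length p" for i
  proof -
    have "{j. j < length p \<and> p ! j < p ! i} = {j. j < length q \<and> q ! j < q ! i}"
      using lt i assms(4) by auto
    then have "p ! i - 1 = q ! i - 1"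
      using val[OF assms(2) i] val[OF assms(3), of i] i assms(4) by simp
    then show ?thesis using is_perm_nth[OF assms(2) i] is_perm_nth[OF assms(3), of i] i assms(4) by linarith
  qed
  then show ?thesis using assms(4) by (intro nth_equalityI) auto
qed

lemma perm_contains_sum_mono:
  assumes "perm_contains p q" "perm_contains p' q'"
    and "is_perm p" "is_perm q" "is_perm p'" "is_perm q'"
  shows "perm_contains (perm_sum p p') (perm_sum q q')"
proof -
  obtain s where s: "subseq s p" "order_isomorphic s q" using assms(1) unfolding perm_contains_def by blast
  obtain s' where s': "subseq s' p'" "order_isomorphic s' q'" using assms(2) unfolding perm_contains_def by blast
  let ?s = "s @ map (\<lambda>x. x + length p) s'"
  have "subseq ?s (perm_sum p p')"
    unfolding perm_sum_def by (intro list_emb_append_mono s subseq_map s')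
  moreover have "order_isomorphic ?s (perm_sum q q')"
    unfolding order_isomorphic_def
  proof (intro conjI allI impI)
    have len: "length s = length q" "length s' = length q'"
      using s(2) s'(2) unfolding order_isomorphic_def by auto
    then show "length ?s = length (perm_sum q q')" by simp
    fix i j assume i: "i < length ?s" and j: "j < length ?s"
    have "set s \<subseteq> set p" "set s' \<subseteq> set p'" using s(1) s'(1) by (auto dest: list_emb_set)
    then have sb: "1 \<le> s ! k \<and> s ! k \<le> length p" if "k < length s" for k
      using assms(3) nth_mem[OF that] \<open>set s \<subseteq> set p\<close> unfolding is_perm_iff
      by (metis atLeastAtMost_iff subsetD)
    have sb': "1 \<le> s' ! k" if "k < length s'" for k
      using assms(5) nth_mem[OF that] \<open>set s' \<subseteq> set p'\<close> unfolding is_perm_iff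
      by (metis atLeastAtMost_iff subsetD)
    have qb: "1 \<le> q ! k \<and> q ! k \<le> length q" if "k < length s" for k
      using is_perm_nth[OF assms(4)] that len by simp
    have qb': "1 \<le> q' ! k" if "k < length s'" for k
      using is_perm_nth[OF assms(6)] that len by simp
    have iso: "s ! i < s ! j \<longleftrightarrow> q ! i < q ! j" if "i < length s" "j < length s" for i j
      using s(2) that unfolding order_isomorphic_def by auto
    have iso': "s' ! i < s' ! j \<longleftrightarrow> q' ! i < q' ! j" if "i < length s'" "j < length s'" for i j
      using s'(2) that unfolding order_isomorphic_def by auto
    consider "i < length s" "j < length s" | "i < length s" "j \<ge> length s"
      | "i \<ge> length s" "j < length s" | "i \<ge> length s" "j \<ge> length s" by linarith
    then show "?s ! i < ?s ! j \<longleftrightarrow> perm_sum q q' ! i < perm_sum q q' ! j"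
    proof cases
      case 1 then show ?thesis using iso len by (simp add: perm_sum_def nth_append)
    next
      case 2
      have "j - length s < length s'" using 2 j by simp
      then have "s ! i < s' ! (j - length s) + length p" "q ! i < q' ! (j - length s) + length q"
        using sb[of i] sb'[of "j - length s"] qb[of i] qb'[of "j - length s"] 2 by linarith+
      then show ?thesis using 2 j len by (simp add: perm_sum_def nth_append)
    next
      case 3
      have "i - length s < length s'" using 3 i by simp
      then have "s ! j < s' ! (i - length s) + length p" "q ! j < q' ! (i - length s) + length q"
        using sb[of j] sb'[of "i - length s"] qb[of j] qb'[of "i - length s"] 3 by linarith+
      then show ?thesis using 3 i len by (simp add: perm_sum_def nth_append)
    next
      case 4
      then show ?thesis using iso'[of "i - length s" "j - length s"] i j len
        by (simp add: perm_sum_def nth_append)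
    qed
  qed
  ultimately show ?thesis unfolding perm_contains_def by blast
qed

text \<open>The occurrence is cut where \<open>p\<close> ends. Its entries in \<open>p\<close> are
  smaller than those in the shifted \<open>p'\<close>, so the two parts of \<open>q\<close> form a
  sum.\<close>

lemma perm_contains_sumD:
  assumes "perm_contains (perm_sum p p') q" "is_perm p" "is_perm p'" "is_perm q"
  obtains q1 q2 where "is_perm q1" "is_perm q2" "q = perm_sum q1 q2"
    "perm_contains p q1" "perm_contains p' q2"
proof -
  obtain s g where s: "subseq s (perm_sum p p')" "strict_mono_on (set s) g" "q = map g s"
    using assms(1) unfolding perm_contains_iff_map by blast
  obtain s1 s2 where s12: "s = s1 @ s2" "subseq s1 p" "subseq s2 (map (\<lambda>x. x + length p) p')"
    using s(1) unfolding perm_sum_def by (rule subseq_appendE)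
  obtain t where t: "subseq t p'" "s2 = map (\<lambda>x. x + length p) t" using s12(3) by (rule subseq_mapD)
  have sub: "set s1 \<subseteq> set p" "set t \<subseteq> set p'" using s12(2) t(1) by (auto dest: list_emb_set)
  have lt: "g x < g y" if "x \<in> set s1" "y \<in> set s2" for x y
  proof -
    have "x \<le> length p" using that(1) sub(1) assms(2) unfolding is_perm_iff by auto
    moreover have "y > length p" using that(2) sub(2) assms(3) unfolding is_perm_iff t(2) by auto
    ultimately show ?thesis using s(2) that unfolding s12(1) strict_mono_on_def by auto
  qed
  have q: "q = map g s1 @ map g s2" using s(3) s12(1) by simp
  obtain b where b: "is_perm (map g s1)" "is_perm b" "map g s2 = map (\<lambda>x. x + length (map g s1)) b"
    by (rule perm_append_split[of "map g s1" "map g s2"]) (use assms(4) q lt in auto)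
  have mono: "strict_mono_on (set s1) g" using s(2) unfolding s12(1) strict_mono_on_def by auto
  let ?h = "\<lambda>x. g (x + length p) - length s1"
  have beq: "b = map ?h t"
  proof -
    have "map (\<lambda>x. x - length s1) (map g s2) = b" using b(3) by (simp add: comp_def)
    then show ?thesis unfolding t(2) by (simp add: comp_def)
  qed
  have ge: "g x \<ge> length s1" if "x \<in> set s2" for x
  proof -
    have "g x \<in> set (map g s2)" using that by simp
    then show ?thesis unfolding b(3) by auto
  qed
  have "strict_mono_on (set t) ?h"
  proof (rule strict_mono_onI)
    fix x y assume "x \<in> set t" "y \<in> set t" "x < y"
    then have "g (x + length p) < g (y + length p)"
      using s(2) unfolding s12(1) t(2) strict_mono_on_def by auto
    moreover have "g (x + length p) \<ge> length s1" using \<open>x \<in> set t\<close> by (intro ge) (simp add: t(2))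
    ultimately show "?h x < ?h y" by linarith
  qed
  then have "perm_contains p' b" using t(1) beq unfolding perm_contains_iff_map by blast
  moreover have "perm_contains p (map g s1)" using s12(2) mono unfolding perm_contains_iff_map by blast
  moreover have "q = perm_sum (map g s1) b" unfolding q b(3) perm_sum_def by simp
  ultimately show ?thesis using b that by blast
qed

section \<open>Unique factorisation into indecomposables\<close>

definition sum_word :: "nat list list \<Rightarrow> nat list" where
  "sum_word w = foldr perm_sum w []"

lemma sum_word_simps [simp]: "sum_word [] = []" "sum_word (x # w) = perm_sum x (sum_word w)"
  by (simp_all add: sum_word_def)

lemma sum_word_append: "sum_word (v @ w) = perm_sum (sum_word v) (sum_word w)"
  by (induction v) (simp_all add: perm_sum_assoc)

lemma length_sum_word: "length (sum_word w) = sum_list (map length w)"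
  by (induction w) simp_all

text \<open>The empty permutation is left out because it would spoil uniqueness and have size
  0.\<close>

definition indec :: "nat list set" where
  "indec = {x. sum_indecomposable x \<and> x \<noteq> []}"

lemma is_perm_Nil [simp]: "is_perm []"
  by (simp add: is_perm_iff)

lemma indec_is_perm: "x \<in> indec \<Longrightarrow> is_perm x"
  by (simp add: indec_def sum_indecomposable_def)

lemma is_perm_sum_word: "w \<in> lists indec \<Longrightarrow> is_perm (sum_word w)"
  by (induction w) (auto simp: indec_is_perm is_perm_sum)

text \<open>If \<open>y\<close> were longer, it would be \<open>x\<close> followed by a beginning of
  the shifted \<open>P\<close>, whose values are all larger, so \<open>y\<close> would be a
  nontrivial sum.\<close>

lemma perm_sum_indec_length:
  assumes "perm_sum x P = perm_sum y Q" "is_perm x" "is_perm P" "x \<noteq> []" "y \<in> indec"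
  shows "length y \<le> length x"
proof (rule ccontr)
  assume less: "\<not> length y \<le> length x"
  have "y @ map (\<lambda>v. v + length y) Q = x @ map (\<lambda>v. v + length x) P"
    using assms(1) by (simp add: perm_sum_def)
  then obtain r where r: "y = x @ r" "map (\<lambda>v. v + length x) P = r @ map (\<lambda>v. v + length y) Q"
    using less by (auto simp: append_eq_append_conv2)
  have "set r \<subseteq> set (map (\<lambda>v. v + length x) P)" unfolding r(2) by auto
  then have "u < v" if "u \<in> set x" "v \<in> set r" for u v
    using that assms(2,3) unfolding is_perm_iff by fastforce
  moreover have "is_perm (x @ r)" using indec_is_perm[OF assms(5)] r(1) by simp
  ultimately obtain b where b: "is_perm b" "r = map (\<lambda>v. v + length x) b"
    using perm_append_split by metis
  moreover have "r \<noteq> []" using less r(1) by auto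
  ultimately have "y = perm_sum x b" "b \<noteq> []" using r(1) by (auto simp: perm_sum_def)
  then show False using assms(2,4,5) b(1) unfolding indec_def sum_indecomposable_def by blast
qed

lemma sum_word_inj:
  "v \<in> lists indec \<Longrightarrow> w \<in> lists indec \<Longrightarrow> sum_word v = sum_word w \<Longrightarrow> v = w"
proof (induction v arbitrary: w)
  case Nil
  then show ?case by (cases w) (auto simp: perm_sum_def indec_def)
next
  case (Cons x v)
  then obtain y w' where w: "w = y # w'"
    by (cases w) (auto simp: perm_sum_def indec_def)
  have ne: "x \<noteq> []" "y \<noteq> []" and xy: "x \<in> indec" "y \<in> indec" "w' \<in> lists indec" "v \<in> lists indec"
    using Cons.prems unfolding w by (auto simp: indec_def)
  have eq: "perm_sum x (sum_word v) = perm_sum y (sum_word w')" using Cons.prems(3) w by simp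
  have "length x = length y"
    using perm_sum_indec_length[OF eq] perm_sum_indec_length[OF eq[symmetric]]
      ne xy is_perm_sum_word indec_is_perm by (meson le_antisym)
  then have "x = y" "sum_word v = sum_word w'" using perm_sum_inject[OF eq] by auto
  then show ?case using Cons.IH xy w by blast
qed

lemma ex_sum_word:
  "is_perm p \<Longrightarrow> \<exists>w \<in> lists indec. sum_word w = p"
proof (induction "length p" arbitrary: p rule: less_induct)
  case less
  show ?case
  proof (cases "p = []")
    case True
    then show ?thesis by (intro bexI[of _ "[]"]) auto
  next
    case ne: False
    show ?thesis
    proof (cases "sum_indecomposable p")
      case True
      then show ?thesis using ne by (intro bexI[of _ "[p]"]) (auto simp: indec_def)
    next
      case False
      then obtain a b where ab: "is_perm a" "is_perm b" "a \<noteq> []" "b \<noteq> []" "p = perm_sum a b"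
        using less.prems unfolding sum_indecomposable_def by blast
      obtain u v where "u \<in> lists indec" "sum_word u = a" "v \<in> lists indec" "sum_word v = b"
        using less.hyps[of a] less.hyps[of b] ab by auto
      then show ?thesis using ab(5) by (intro bexI[of _ "u @ v"]) (auto simp: sum_word_append)
    qed
  qed
qed

text \<open>Factoring \<open>a\<close> and \<open>b\<close> separately gives a second word for the
  same permutation, so the two words agree.\<close>

lemma sum_word_eq_perm_sum:
  assumes "w \<in> lists indec" "sum_word w = perm_sum a b" "is_perm a" "is_perm b"
  obtains w1 w2 where "w = w1 @ w2" "sum_word w1 = a" "sum_word w2 = b"
proof -
  obtain u v where uv: "u \<in> lists indec" "sum_word u = a" "v \<in> lists indec" "sum_word v = b"
    using ex_sum_word assms(3,4) by metis
  then have "w = u @ v" using assms(1,2) by (intro sum_word_inj) (auto simp: sum_word_append)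
  then show ?thesis using uv that by blast
qed

text \<open>The pattern comes first, as in \<open>subseq\<close>, whereas
  \<open>perm_contains\<close> has the host first.\<close>

definition sum_emb :: "nat list list \<Rightarrow> nat list list \<Rightarrow> bool" where
  "sum_emb w p \<longleftrightarrow> perm_contains (sum_word p) (sum_word w)"

lemma sum_emb_append_mono:
  assumes "sum_emb w p" "sum_emb w' p'" "w \<in> lists indec" "p \<in> lists indec" "w' \<in> lists indec" "p' \<in> lists indec"
  shows "sum_emb (w @ w') (p @ p')"
  using assms unfolding sum_emb_def sum_word_append
  by (intro perm_contains_sum_mono is_perm_sum_word)

lemma sum_emb_subseq:
  assumes "subseq w p" "p \<in> lists indec"
  shows "sum_emb w p"
  using assms
proof (induction rule: list_emb.induct)
  case (list_emb_Nil ys)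
  then show ?case by (simp add: sum_emb_def perm_contains_Nil)
next
  case (list_emb_Cons xs ys y)
  have "xs \<in> lists indec" using list_emb_set[OF list_emb_Cons.hyps] list_emb_Cons.prems by fastforce
  then show ?case
    using sum_emb_append_mono[of "[]" "[y]" xs ys] list_emb_Cons by (simp add: sum_emb_def perm_contains_Nil)
next
  case (list_emb_Cons2 x y xs ys)
  have "xs \<in> lists indec" using list_emb_set[OF list_emb_Cons2.hyps(2)] list_emb_Cons2.prems by fastforce
  then show ?case
    using sum_emb_append_mono[of "[x]" "[x]" xs ys] list_emb_Cons2 by (simp add: sum_emb_def perm_contains_refl)
qed

lemma sum_emb_appendD:
  assumes "sum_emb w (p @ p')" "w \<in> lists indec" "p \<in> lists indec" "p' \<in> lists indec"
  shows "\<exists>w1 w2. w = w1 @ w2 \<and> sum_emb w1 p \<and> sum_emb w2 p'"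
proof -
  obtain a b where ab: "is_perm a" "is_perm b" "sum_word w = perm_sum a b"
    "perm_contains (sum_word p) a" "perm_contains (sum_word p') b"
    using perm_contains_sumD assms unfolding sum_emb_def sum_word_append
    by (metis is_perm_sum_word)
  show ?thesis
    using sum_word_eq_perm_sum[OF assms(2) ab(3,1,2)] ab(4,5) unfolding sum_emb_def by metis
qed

lemma sum_emb_same_size:
  assumes "sum_emb w p" "w \<in> lists indec" "p \<in> lists indec"
    and "length (sum_word w) = length (sum_word p)"
  shows "w = p"
  using perm_contains_same_length[of "sum_word p" "sum_word w"] assms is_perm_sum_word sum_word_inj
  unfolding sum_emb_def by metis

lemma singleton_indec: "[1] \<in> indec"
proof -
  have "is_perm [1]" by (simp add: is_perm_iff)
  moreover have "\<not> (a \<noteq> [] \<and> b \<noteq> [] \<and> [1] = perm_sum a b)" for a b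
  proof
    assume h: "a \<noteq> [] \<and> b \<noteq> [] \<and> [1] = perm_sum a b"
    then have "length a + length b = 1" by (metis One_nat_def length_Cons length_perm_sum list.size(3))
    moreover have "length a > 0" "length b > 0" using h by auto
    ultimately show False by linarith
  qed
  ultimately show ?thesis unfolding indec_def sum_indecomposable_def by blast
qed

lemma perm_contains_singleton:
  assumes "p \<noteq> []" shows "perm_contains p [1]"
  using assms unfolding perm_contains_def order_isomorphic_def
  by (intro exI[of _ "[hd p]"]) (auto simp: subseq_singleton_left)

section \<open>Wilf collapse\<close>

context pattern_words begin

text \<open>An infinite language over a finite alphabet has arbitrarily long words, and each of them
  contains the power of \<open>one\<close> of its own length.\<close>

lemma lists_one_subset_W:
  assumes "infinite W"
  shows "lists {one} \<subseteq> W"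
proof
  fix v assume "v \<in> lists {one}"
  then have v: "v = replicate (length v) one" by (metis in_lists_conv_set replicate_eqI singletonD)
  have "\<not> W \<subseteq> {w. set w \<subseteq> I \<and> length w \<le> length v}"
    using assms finite_lists_length_le[OF finite_I] finite_subset by blast
  then obtain w where w: "w \<in> W" "length v \<le> length w" using W_lists by force
  have "emb (replicate (length u) one) u" if "u \<in> lists I" for u
    using that
  proof (induction u rule: list.induct)
    case (Cons x u)
    have "emb ([one] @ replicate (length u) one) ([x] @ u)"
      by (rule emb_append) (use Cons emb_one one in auto)
    then show ?case by simp
  qed (simp add: emb_refl)
  then have "emb (replicate (length w) one) w" using w(1) W_lists by blast
  then have "replicate (length w) one \<in> W"
    using W_closed[OF w(1)] one(1) by (simp add: lists_eq_set subset_iff)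
  moreover have "subseq v (replicate (length w) one)"
    using v w(2) replicate_add[of "length v" "length w - length v" one] by (metis le_add_diff_inverse prefixI prefix_imp_subseq)
  ultimately show "v \<in> W" using down_closed_W unfolding down_closed_def by blast
qed

end

text \<open>Classes of elements outside \<open>Y\<close> are disjoint with at least \<open>R\<close>
  members in \<open>X\<close>, so \<open>R\<close> times their number is at most
  \<open>card X\<close>; elements of \<open>Y\<close> add at most \<open>card Y\<close> further
  classes.\<close>

lemma card_quotient_le:
  assumes "equiv C r" "X \<subseteq> C" "finite X" "Y \<subseteq> X"
    and large: "\<And>x. x \<in> X - Y \<Longrightarrow> R \<le> card (r `` {x} \<inter> X)"
  shows "R * card (X // r) \<le> R * card Y + card X"
proof -
  let ?c = "\<lambda>x. r `` {x}"
  let ?Q = "?c ` (X - Y)"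
  have finY: "finite Y" using assms(3,4) finite_subset by blast
  have "X // r = ?c ` Y \<union> ?Q" using assms(4) unfolding quotient_def by blast
  then have "card (X // r) \<le> card (?c ` Y) + card ?Q" by (simp add: card_Un_le)
  also have "\<dots> \<le> card Y + card ?Q" using card_image_le[OF finY] by simp
  finally have 1: "card (X // r) \<le> card Y + card ?Q" .
  have "R * card ?Q = (\<Sum>c\<in>?Q. R)" by simp
  also have "\<dots> \<le> (\<Sum>c\<in>?Q. card (c \<inter> X))" using large by (intro sum_mono) auto
  also have "\<dots> = card (\<Union>c\<in>?Q. c \<inter> X)"
  proof (rule card_UN_disjoint[symmetric])
    show "finite ?Q" using assms(3) by simp
    show "\<forall>c\<in>?Q. finite (c \<inter> X)" using assms(3) by simp
    show "\<forall>c\<in>?Q. \<forall>d\<in>?Q. c \<noteq> d \<longrightarrow> (c \<inter> X) \<inter> (d \<inter> X) = {}"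
    proof (intro ballI impI)
      fix c d assume cd: "c \<in> ?Q" "d \<in> ?Q" "c \<noteq> d"
      have "?Q \<subseteq> C // r" using assms(2) by (auto intro: quotientI)
      then have "c \<inter> d = {}" using quotient_disj[OF assms(1)] cd by blast
      then show "(c \<inter> X) \<inter> (d \<inter> X) = {}" by blast
    qed
  qed
  also have "\<dots> \<le> card X" using assms(3) by (intro card_mono) auto
  finally have "R * card ?Q \<le> card X" .
  then show ?thesis using mult_le_mono2[OF 1, of R] by (simp add: distrib_left)
qed

section \<open>The permutation class as a language of words\<close>

locale finitely_indecomposable_class =
  fixes C :: "nat list set"
  assumes C_class: "perm_class C" and fin_indec: "finite {p \<in> C. sum_indecomposable p}"
    and growth_unbounded: "\<not> bdd_above (range (growth C))"
begin

definition letters :: "nat list set" where "letters = C \<inter> indec"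

definition words :: "nat list list set" where "words = {w \<in> lists letters. sum_word w \<in> C}"

lemma letters_indec: "lists letters \<subseteq> lists indec"
  by (rule lists_mono) (auto simp: letters_def)

lemma C_closed: "p \<in> C \<Longrightarrow> is_perm q \<Longrightarrow> perm_contains p q \<Longrightarrow> q \<in> C"
  using C_class unfolding perm_class_def by blast

lemma finite_letters: "finite letters"
proof -
  have "letters \<subseteq> {p \<in> C. sum_indecomposable p}" unfolding letters_def indec_def by blast
  then show ?thesis using fin_indec by (rule finite_subset)
qed

lemma one_letter: "[1] \<in> letters"
proof -
  have "\<exists>p\<in>C. p \<noteq> []"
  proof (rule ccontr)
    assume "\<not> (\<exists>p\<in>C. p \<noteq> [])"
    then have "growth C n \<le> card {[] :: nat list}" for n
      unfolding growth_def of_size_def by (intro card_mono) auto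
    then show False using growth_unbounded unfolding bdd_above_def by blast
  qed
  then show ?thesis
    using C_closed perm_contains_singleton indec_is_perm[OF singleton_indec] singleton_indec
    unfolding letters_def by blast
qed

sublocale pattern_words letters length words sum_emb "[1]"
proof unfold_locales
  interpret weighted_alphabet letters length
    by unfold_locales (rule finite_letters, auto simp: letters_def indec_def Suc_leI)
  have wt: "wt w = length (sum_word w)" for w :: "nat list list"
    by (simp add: wt_def length_sum_word)
  show "finite letters" by (rule finite_letters)
  show "1 \<le> length x" if "x \<in> letters" for x using that by (auto simp: letters_def indec_def Suc_leI)
  show "words \<subseteq> lists letters" by (auto simp: words_def)
  show "w \<in> words" if "p \<in> words" "w \<in> lists letters" "sum_emb w p" for p w
    using that C_closed is_perm_sum_word letters_indec unfolding words_def sum_emb_def by blast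
  show "sum_emb u w" if "sum_emb u v" "sum_emb v w" for u v w
    using that perm_contains_trans unfolding sum_emb_def by blast
  show "sum_emb w p" if "subseq w p" "p \<in> lists letters" for w p
    using that sum_emb_subseq letters_indec by blast
  show "sum_emb (w @ w') (p @ p')" if "sum_emb w p" "sum_emb w' p'" "w \<in> lists letters" "p \<in> lists letters"
    "w' \<in> lists letters" "p' \<in> lists letters" for w p w' p'
    using that letters_indec by (intro sum_emb_append_mono) auto
  show "\<exists>w1 w2. w = w1 @ w2 \<and> sum_emb w1 p \<and> sum_emb w2 p'" if "sum_emb w (p @ p')" "w \<in> lists letters"
    "p \<in> lists letters" "p' \<in> lists letters" for w p p'
    using that letters_indec by (intro sum_emb_appendD) auto
  show "wt w \<le> wt p" if "sum_emb w p" for w p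
    using that perm_contains_length unfolding sum_emb_def wt by blast
  show "w = p" if "sum_emb w p" "w \<in> lists letters" "p \<in> lists letters" "wt w = wt p" for w p
    using that letters_indec by (intro sum_emb_same_size) (auto simp: wt)
  show "[1] \<in> letters" by (rule one_letter)
  show "length [1 :: nat] = 1" by simp
  show "sum_emb [[1]] [x]" if "x \<in> letters" for x
    using that perm_contains_singleton[of x] by (simp add: sum_emb_def letters_def indec_def)
qed

lemma wt_eq: "wt w = length (sum_word w)"
  by (simp add: wt_def length_sum_word)

lemma ex_word:
  assumes "p \<in> C"
  obtains w where "w \<in> words" "sum_word w = p"
proof -
  have "is_perm p" using assms C_class unfolding perm_class_def by blast
  then obtain w where w: "w \<in> lists indec" "sum_word w = p" using ex_sum_word by blast
  have "x \<in> C" if "x \<in> set w" for x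
  proof -
    have "sum_emb [x] w" using that w(1) by (intro sum_emb_subseq) (simp_all add: subseq_singleton_left)
    then have "perm_contains p x" using w(2) by (simp add: sum_emb_def)
    moreover have "is_perm x" using that w(1) by (auto intro: indec_is_perm)
    ultimately show ?thesis using C_closed[OF assms] by blast
  qed
  then have "w \<in> lists letters" using w(1) by (auto simp: letters_def)
  then show ?thesis using that w(2) assms by (simp add: words_def)
qed

lemma sum_word_inj_on: "inj_on sum_word words"
  using sum_word_inj letters_indec unfolding words_def inj_on_def by blast

lemma sum_word_image: "sum_word ` {w \<in> words. wt w = n} = of_size C n"
proof (intro equalityI subsetI)
  fix p assume "p \<in> of_size C n"
  then obtain w where "w \<in> words" "sum_word w = p" "length p = n"
    using ex_word unfolding of_size_def by blast
  then show "p \<in> sum_word ` {w \<in> words. wt w = n}" by (auto simp: wt_eq)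
qed (auto simp: words_def of_size_def wt_eq)

lemma cnt_words: "cnt words n = growth C n"
  unfolding cnt_def growth_def sum_word_image[symmetric]
  by (rule card_image[symmetric]) (rule inj_on_subset[OF sum_word_inj_on], auto)

lemma card_containing:
  assumes "w \<in> words"
  shows "card {p \<in> of_size C m. perm_contains p (sum_word w)} = cnt (containing w) m"
proof -
  have "{p \<in> of_size C m. perm_contains p (sum_word w)} = sum_word ` {v \<in> containing w. wt v = m}"
    unfolding sum_word_image[symmetric] containing_def sum_emb_def by auto
  moreover have "inj_on sum_word {v \<in> containing w. wt v = m}"
    by (rule inj_on_subset[OF sum_word_inj_on]) (auto simp: containing_def)
  ultimately show ?thesis by (simp add: cnt_def card_image)
qed

lemma wilf_equivalent_words:
  assumes "v \<in> words" "w \<in> words" "gf (containing v) = gf (containing w)"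
  shows "(sum_word v, sum_word w) \<in> wilf_equivalence C"
proof -
  have avoid: "card {p \<in> of_size C m. avoids p a}
      = growth C m - card {p \<in> of_size C m. perm_contains p a}" for m a
  proof -
    have "{p \<in> of_size C m. avoids p a} = of_size C m - {p \<in> of_size C m. perm_contains p a}"
      by (auto simp: avoids_def)
    then show ?thesis using finite_of_size[OF C_class] unfolding growth_def
      by (simp add: card_Diff_subset)
  qed
  have "cnt (containing v) m = cnt (containing w) m" for m
    using arg_cong[OF assms(3), of "\<lambda>f. fps_nth f m"] by (simp add: gf_def)
  then show ?thesis
    using assms(1,2) unfolding wilf_equivalence_def avoid
    by (simp add: card_containing words_def)
qed

lemma infinite_words: "infinite words"
proof
  assume fin: "finite words"
  have "growth C n \<le> card words" for n
    unfolding cnt_words[symmetric] cnt_def by (intro card_mono fin) auto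
  then show False using growth_unbounded unfolding bdd_above_def by blast
qed

lemma ex_pattern_growth: "\<exists>\<theta>. pattern_growth letters length words sum_emb [1] \<theta>"
proof -
  \<comment> \<open>The empty alphabet has mass 0 for every \<theta> and yields no root, so it is
    left out; \<open>{[1]}\<close> keeps the family nonempty.\<close>
  let ?F = "{A. A \<subseteq> letters \<and> A \<noteq> {} \<and> lists A \<subseteq> words}"
  have "{[1]} \<in> ?F" using one_letter lists_one_subset_W[OF infinite_words] by simp
  moreover have "finite ?F" using finite_letters by (auto intro: finite_subset[of _ "Pow letters"])
  ultimately obtain \<theta> :: real where \<theta>: "0 < \<theta>" "\<theta> \<le> 1" "\<And>A. A \<in> ?F \<Longrightarrow> (\<Sum>x\<in>A. \<theta> ^ length x) \<le> 1"
      "\<exists>A\<in>?F. (\<Sum>x\<in>A. \<theta> ^ length x) = 1"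
    using exists_critical_weight[of ?F length] finite_letters finite_subset sz_pos
    by (smt (verit, ccfv_threshold) empty_iff mem_Collect_eq subsetD)
  interpret weighted_growth letters length \<theta> by unfold_locales (use \<theta> in auto)
  have "pattern_growth letters length words sum_emb [1] \<theta>"
  proof unfold_locales
    show "mass A \<le> 1" if "A \<subseteq> letters" "lists A \<subseteq> words" for A
    proof (cases "A = {}")
      case False
      then show ?thesis using \<theta>(3)[of A] that by (simp add: mass_def)
    qed (simp add: mass_def)
    show "\<exists>A. crit A \<and> lists A \<subseteq> words" using \<theta>(4) by (auto simp: crit_def mass_def)
    show "\<not> bdd_above (range (cnt words))" using growth_unbounded by (simp add: cnt_words[abs_def])
  qed
  then show ?thesis by blast
qed

text \<open>The factor 2 has two sources: one \<open>growth C n\<close> bounds \<open>R\<close>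
  times the number of exceptional words, the other \<open>R\<close> times the number of large
  classes.\<close>

lemma wilf_classes_le:
  assumes "R > 0"
  shows "\<forall>\<^sub>F n in sequentially. real R * real (wilf_classes C n) \<le> 2 * real (growth C n)"
proof -
  obtain \<theta> where "pattern_growth letters length words sum_emb [1] \<theta>" using ex_pattern_growth by blast
  then interpret pg: pattern_growth letters length words sum_emb "[1]" \<theta> .
  obtain B where B: "B \<subseteq> words" "\<And>w. w \<in> words \<Longrightarrow> w \<notin> B \<Longrightarrow> R \<le> card (pg.wilf_class w)"
    "\<forall>\<^sub>F n in sequentially. real R * real (cnt B n) \<le> real (cnt words n)"
    using pg.few_small_classes[OF assms] by metis
  have "R * wilf_classes C n \<le> R * cnt B n + growth C n" for n
  proof -
    let ?Y = "sum_word ` {w \<in> B. wt w = n}"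
    let ?r = "wilf_equivalence C"
    have Y: "?Y \<subseteq> of_size C n" unfolding sum_word_image[symmetric] using B(1) by auto
    have "R * card (of_size C n // ?r) \<le> R * card ?Y + card (of_size C n)"
    proof (rule card_quotient_le[OF equiv_wilf_equivalence _ finite_of_size[OF C_class] Y])
      show "of_size C n \<subseteq> C" by (auto simp: of_size_def)
      fix x assume x: "x \<in> of_size C n - ?Y"
      then obtain w where w: "w \<in> words" "wt w = n" "x = sum_word w"
        unfolding sum_word_image[symmetric] by auto
      then have "w \<notin> B" using x by auto
      then have "R \<le> card (pg.wilf_class w)" using B(2) w(1) by blast
      also have "\<dots> = card (sum_word ` pg.wilf_class w)"
        by (rule card_image[symmetric], rule inj_on_subset[OF sum_word_inj_on]) (auto simp: pg.wilf_class_def)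
      also have "\<dots> \<le> card (?r `` {x} \<inter> of_size C n)"
      proof (rule card_mono)
        show "finite (?r `` {x} \<inter> of_size C n)" using finite_of_size[OF C_class] by blast
        show "sum_word ` pg.wilf_class w \<subseteq> ?r `` {x} \<inter> of_size C n"
        proof
          fix y assume "y \<in> sum_word ` pg.wilf_class w"
          then obtain v where v: "y = sum_word v" "v \<in> words" "wt v = n" "gf (containing v) = gf (containing w)"
            using w(2) by (auto simp: pg.wilf_class_def)
          have "(x, y) \<in> ?r" unfolding w(3) v(1) by (rule wilf_equivalent_words[OF w(1) v(2) v(4)[symmetric]])
          moreover have "y \<in> of_size C n" unfolding sum_word_image[symmetric] using v by blast
          ultimately show "y \<in> ?r `` {x} \<inter> of_size C n" by blast
        qed
      qed
      finally show "R \<le> card (?r `` {x} \<inter> of_size C n)" .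
    qed
    moreover have "card ?Y \<le> cnt B n"
      unfolding cnt_def by (intro card_image_le finite_wt) (use B(1) words_def in auto)
    ultimately show ?thesis unfolding wilf_classes_def growth_def
      by (meson add_le_mono1 le_trans mult_le_mono2)
  qed
  then have le: "real R * real (wilf_classes C n) \<le> real R * real (cnt B n) + real (growth C n)" for n
    by (metis of_nat_add of_nat_le_iff of_nat_mult)
  show ?thesis
    using B(3)
  proof eventually_elim
    case (elim n)
    then show ?case using le[of n] by (simp add: cnt_words)
  qed
qed

end

theorem theorem4p3:
  fixes C :: "nat list set"
  assumes "perm_class C"
    and "finite {p \<in> C. sum_indecomposable p}"
    and "\<not> bdd_above (range (growth C))"
  shows "wilf_collapse C"
  unfolding wilf_collapse_def
proof (rule landau_o.smallI)
  interpret finitely_indecomposable_class C by unfold_locales (fact assms)+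
  fix c :: real assume c: "c > 0"
  obtain R :: nat where R: "2 / c < real R" using reals_Archimedean2 by blast
  moreover have "0 < 2 / c" using c by simp
  ultimately have "real R > 0" by linarith
  then have "\<forall>\<^sub>F n in sequentially. real R * real (wilf_classes C n) \<le> 2 * real (growth C n)"
    by (intro wilf_classes_le) simp
  then show "\<forall>\<^sub>F n in sequentially. norm (real (wilf_classes C n)) \<le> c * norm (real (growth C n))"
  proof eventually_elim
    case (elim n)
    have "2 \<le> c * real R" using R c by (simp add: field_simps)
    then have "2 * real (growth C n) \<le> c * real R * real (growth C n)" by (intro mult_right_mono) auto
    then have "real R * real (wilf_classes C n) \<le> real R * (c * real (growth C n))"
      using elim by (simp add: mult_ac)
    then show ?case using \<open>real R > 0\<close> by simp
  qed
qed

end
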